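(* Let $(\tau,p)$ be an unbounded probabilistic context tree on a countable alphabet $A$, let $0<\epsilon<1$, and suppose that $(\tau,p)$ has an $\epsilon$-regular reference string $w$ with associated function $\ell^{w}:\mathbb{N}\to\mathbb{N}$ satisfying $$\limsup_{k\to\infty}\frac{\log(\ell^{w}(k))}{C_{\epsilon}\,k}<1,\qquad C_{\epsilon}:=-\frac{1}{|w|}\log\bigl(1-\epsilon^{|w|}\bigr)>0 .$$ Let $\mathbf{X}=(X_n)_{n\in\mathbb{Z}}$ be the (unique) stationary chain compatible with $(\tau,p)$, with law $\mu$. Then for $\mu$-almost every realization of $\mathbf{X}$ there exists a sequence of random times $\mathbf{T}^{\mathbf{X}}=(T_i^{\mathbf{X}})_{i\in\mathbb{Z}}$ (indexed so that $T_i^{\mathbf{X}}<T_{i+1}^{\mathbf{X}}$ for all $i$ and $T_0^{\mathbf{X}}\le 0<T_1^{\mathbf{X}}$) such that (1) for any $i\in\mathbb{Z}$, the event $\{T_i^{\mathbf{X}}=k\}$ is measurable with respect to the $\sigma$-algebra generated by $X_k^{+\infty}=(X_k,X_{k+1},\ldots)$; and (2) conditionally on $\mathbf{T}^{\mathbf{X}}$, the strings $(X_{T_i^{\mathbf{X}}},\ldots,X_{T_{i+1}^{\mathbf{X}}-1})_{i\ne 0}$ are i.i.d. and have finite expected size (length).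
   Context: Strings: $\mathbb{N}=\{0,1,2,\ldots\}$. For a countable alphabet $A$, $a_m^n$ denotes the string $a_m\ldots a_n$, of length $n-m+1$; $|v|$ denotes the length of a string $v$. $A^{-\mathbb{N}}=A^{\{\ldots,-2,-1\}}$ is the set of infinite pasts and $A^\star=\bigcup_{j\ge 0}A^{\{-j,\ldots,-1\}}$ the set of finite strings (including the empty string $\emptyset$). A string $s$ is a suffix of $v$ if $|s|\le|v|$ and $v_{-|s|}^{-1}=s$. Context trees: A tree is a subset $\tau\subset A^\star\cup A^{-\mathbb{N}}$ in which no string is a suffix of another string; it is unbounded if $\sup\{|v|:v\in\tau\}=+\infty$; it is complete (a context tree) if every $a_{-\infty}^{-1}\in A^{-\mathbb{N}}$ has a (necessarily unique) suffix in $\tau$, called its context $c_\tau(a_{-\infty}^{-1})$. A probabilistic context tree $(\tau,p)$ is a context tree $\tau$ with a family $p=\{p(\cdot|v):v\in\tau\}$ of transition probabilities over $A$. A stochastic chain $(X_n)_{n\in\mathbb{Z}}$ of law $\mathbb{P}$ is compatible with $(\tau,p)$ if for $\mathbb{P}$-a.e. past $a_{-\infty}^{-1}$ and every $a\in A$, $\mathbb{P}(X_0=a|X_{-\infty}^{-1}=a_{-\infty}^{-1})=p(a|c_\tau(a_{-\infty}^{-1}))$. Under the hypotheses of the claim there is exactly one stationary law $\mu$ compatible with $(\tau,p)$. $\epsilon$-regularity: $a\in A$ is $\epsilon$-regular if $\inf_{v\in\tau}p(a|v)\ge\epsilon>0$; a finite string is $\epsilon$-regular if all symbols appearing in it are.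 Reference string: for a nonempty finite string $w$ and $v\in\tau$ let $m^w(v)=\inf\{j:0\le j\le|v|-|w|,\ v_{-j-|w|}^{-j-1}=w\}$, with $m^w(v)=+\infty$ if there is no such $j$. $w$ is a reference string of $\tau$ with function $\ell^w:\mathbb{N}\to\mathbb{N}$ (finite valued) if $|v|=m^w(v)+|w|+\ell^w(m^w(v))$ for every $v\in\tau$ (so $|v|=+\infty$ exactly when $m^w(v)=+\infty$). Convention: $\log 0=-\infty$.
   Formalization: Claim (1) is proved as stated for i ≤ 0; for i ≥ 1, {T_i = k} lies in σ(X_1, X_2, …), and for every k the event that k is some T_i lies in σ(X_k, …). In (2) the strings with i ≠ 0 are i.i.d., and given T they are independent with one common law given the length. *)

theory Defs
  imports "HOL-Probability.Probability"
begin

section \<open>Strings and context trees\<close>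

text \<open>The countable alphabet is a type of class \<open>countable\<close>. A finite string
  is written from left to right, so the list \<open>[a, b]\<close> has last symbol \<open>b\<close>
  at position \<open>-1\<close>; an infinite past is indexed backwards, so that \<open>Past u\<close> has
  symbol \<open>u j\<close> at position \<open>- j - 1\<close>.\<close>

datatype 'a strg = Fin "'a list" | Past "nat \<Rightarrow> 'a"

primrec slen :: "'a strg \<Rightarrow> enat" where
  "slen (Fin l) = enat (length l)"
| "slen (Past u) = \<infinity>"

text \<open>The symbol at position \<open>- j - 1\<close>, meaningful for \<open>j\<close> below the length.\<close>

primrec sym_at :: "'a strg \<Rightarrow> nat \<Rightarrow> 'a" where
  "sym_at (Fin l) j = rev l ! j"
| "sym_at (Past u) j = u j"

definition is_suffix :: "'a strg \<Rightarrow> 'a strg \<Rightarrow> bool" where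
  "is_suffix s v \<longleftrightarrow> slen s \<le> slen v \<and> (\<forall>j. enat j < slen s \<longrightarrow> sym_at v j = sym_at s j)"

definition is_tree :: "'a strg set \<Rightarrow> bool" where
  "is_tree \<tau> \<longleftrightarrow> (\<forall>s\<in>\<tau>. \<forall>v\<in>\<tau>. s \<noteq> v \<longrightarrow> \<not> is_suffix s v)"

definition unbounded_tree :: "'a strg set \<Rightarrow> bool" where
  "unbounded_tree \<tau> \<longleftrightarrow> (SUP v\<in>\<tau>. slen v) = \<infinity>"

definition context_tree :: "'a strg set \<Rightarrow> bool" where
  "context_tree \<tau> \<longleftrightarrow> is_tree \<tau> \<and> (\<forall>u. \<exists>v\<in>\<tau>. is_suffix v (Past u))"

definition ctx :: "'a strg set \<Rightarrow> (nat \<Rightarrow> 'a) \<Rightarrow> 'a strg" where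
  "ctx \<tau> u = (THE v. v \<in> \<tau> \<and> is_suffix v (Past u))"

section \<open>Regularity and reference strings\<close>

text \<open>Transition probabilities are given by \<open>p :: 'a strg \<Rightarrow> 'a pmf\<close>; only the values
  on the tree matter.\<close>

definition regular_symbol :: "'a strg set \<Rightarrow> ('a strg \<Rightarrow> 'a pmf) \<Rightarrow> real \<Rightarrow> 'a \<Rightarrow> bool" where
  "regular_symbol \<tau> p \<epsilon> a \<longleftrightarrow> \<epsilon> > 0 \<and> (INF v\<in>\<tau>. pmf (p v) a) \<ge> \<epsilon>"

definition regular_string :: "'a strg set \<Rightarrow> ('a strg \<Rightarrow> 'a pmf) \<Rightarrow> real \<Rightarrow> 'a list \<Rightarrow> bool" where
  "regular_string \<tau> p \<epsilon> w \<longleftrightarrow> (\<forall>a\<in>set w. regular_symbol \<tau> p \<epsilon> a)"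

text \<open>Distance from the end of \<open>v\<close> to the last occurrence of \<open>w\<close> in \<open>v\<close>; the infimum
  of the empty set in \<^typ>\<open>enat\<close> is \<open>\<infinity>\<close>.\<close>

definition last_occ :: "'a list \<Rightarrow> 'a strg \<Rightarrow> enat" where
  "last_occ w v = Inf {enat j | j. enat (j + length w) \<le> slen v \<and>
                                   (\<forall>i<length w. sym_at v (j + i) = sym_at (Fin w) i)}"

definition reference_string :: "'a strg set \<Rightarrow> 'a list \<Rightarrow> (nat \<Rightarrow> nat) \<Rightarrow> bool" where
  "reference_string \<tau> w lw \<longleftrightarrow> w \<noteq> [] \<and>
     (\<forall>v\<in>\<tau>. slen v = (case last_occ w v of
                         enat m \<Rightarrow> enat (m + length w + lw m)
                       | \<infinity> \<Rightarrow> \<infinity>))"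

definition C_const :: "real \<Rightarrow> 'a list \<Rightarrow> real" where
  "C_const \<epsilon> w = - (1 / real (length w)) * ln (1 - \<epsilon> ^ length w)"

text \<open>Logarithm with \<open>log 0 = -\<infinity>\<close>, whereas \<open>ln 0 = 0\<close> for the library function.\<close>

definition elog :: "nat \<Rightarrow> ereal" where
  "elog n = (if n = 0 then - \<infinity> else ereal (ln (real n)))"

section \<open>Stationary chains\<close>

definition seq_space :: "(int \<Rightarrow> 'a) measure" where
  "seq_space = PiM UNIV (\<lambda>_. count_space UNIV)"

text \<open>The \<open>\<sigma>\<close>-algebra on \<open>\<Omega>\<close> generated by the coordinates in \<open>I\<close>.\<close>

definition coord_algebra :: "(int \<Rightarrow> 'a) set \<Rightarrow> int set \<Rightarrow> (int \<Rightarrow> 'a) measure" where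
  "coord_algebra \<Omega> I =
     vimage_algebra \<Omega> (\<lambda>x. restrict x I) (PiM I (\<lambda>_. count_space UNIV))"

definition past :: "(int \<Rightarrow> 'a) \<Rightarrow> nat \<Rightarrow> 'a" where
  "past x j = x (- int j - 1)"

definition chain_law :: "(int \<Rightarrow> 'a) measure \<Rightarrow> bool" where
  "chain_law \<mu> \<longleftrightarrow> prob_space \<mu> \<and> sets \<mu> = sets seq_space"

definition stationary :: "(int \<Rightarrow> 'a) measure \<Rightarrow> bool" where
  "stationary \<mu> \<longleftrightarrow> distr \<mu> seq_space (\<lambda>x n. x (n + 1)) = \<mu>"

definition compatible ::
  "(int \<Rightarrow> 'a) measure \<Rightarrow> 'a strg set \<Rightarrow> ('a strg \<Rightarrow> 'a pmf) \<Rightarrow> bool" where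
  "compatible \<mu> \<tau> p \<longleftrightarrow>
     (AE x in \<mu>. \<forall>a. real_cond_exp \<mu> (coord_algebra UNIV {..<0}) (indicator {y. y 0 = a}) x
                       = pmf (p (ctx \<tau> (past x))) a)"

section \<open>Blocks between random times\<close>

text \<open>The string \<open>x(t i), \<dots>, x(t (i + 1) - 1)\<close>.\<close>

definition block :: "(int \<Rightarrow> int) \<Rightarrow> (int \<Rightarrow> 'a) \<Rightarrow> int \<Rightarrow> 'a list" where
  "block t x i = map x [t i .. t (i + 1) - 1]"

definition iid_off_zero :: "(int \<Rightarrow> 'a) measure \<Rightarrow> (int \<Rightarrow> (int \<Rightarrow> 'a) \<Rightarrow> 'b) \<Rightarrow> bool" where
  "iid_off_zero \<mu> B \<longleftrightarrow>
     prob_space.indep_vars \<mu> (\<lambda>_. count_space UNIV) B (- {0}) \<and>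
     (\<forall>i j. i \<noteq> 0 \<longrightarrow> j \<noteq> 0 \<longrightarrow>
        distr \<mu> (count_space UNIV) (B i) = distr \<mu> (count_space UNIV) (B j))"

text \<open>Since the random times determine the lengths of the blocks, \<open>i.i.d. conditionally on
  the times\<close> can only mean: given the times, the blocks are independent, and the law of the
  block with index \<open>i\<close> is \<open>q\<close> of its prescribed length, with one and the same kernel \<open>q\<close> for
  all \<open>i\<close>.\<close>

definition cond_iid_off_zero ::
  "(int \<Rightarrow> 'a) measure \<Rightarrow> ((int \<Rightarrow> 'a) \<Rightarrow> int \<Rightarrow> int) \<Rightarrow> bool" where
  "cond_iid_off_zero \<mu> T \<longleftrightarrow>
     (\<exists>q :: int \<Rightarrow> 'a list pmf. \<forall>J s. finite J \<longrightarrow> 0 \<notin> J \<longrightarrow>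
        (AE x in \<mu>.
           real_cond_exp \<mu> (vimage_algebra UNIV T (PiM UNIV (\<lambda>_. count_space UNIV)))
               (indicator {y. \<forall>i\<in>J. block (T y) y i = s i}) x
           = (\<Prod>i\<in>J. pmf (q (T x (i + 1) - T x i)) (s i))))"

end

theory Submission
  imports Defs
begin

text \<open>Call \<open>k\<close> a regeneration time if \<open>N + 1\<close> copies of \<open>w\<close> are written from position \<open>k\<close> on and
if no context used after this run reaches back behind \<open>k\<close>. Since \<open>w\<close> is a reference string, the
length of the context at time \<open>n\<close> is a function of the distance from \<open>n\<close> to the last copy of \<open>w\<close>;
after the run this copy lies in \<open>x\<^sub>k, x\<^sub>k\<^sub>+\<^sub>1, \<dots>\<close>. Hence whether \<open>k\<close> is a regeneration time can be
read off the sequence from \<open>k\<close> on.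

After the run, as long as \<open>k\<close> stays a candidate, the probability of a word is a product of
transition probabilities determined by the word (\<open>regen_word\<close>). So, given the run, the future that
regenerates at \<open>k\<close> is independent of the past (\<open>regeneration\<close>). Moreover, once \<open>k\<close> is a regeneration
time, the sequence up to the end of its run decides which earlier times are regeneration times,
because contexts that stay after \<open>k\<close> also stay after every \<open>j \<le> k\<close> (\<open>regen_upto_extend\<close>). Everything
before \<open>k\<close>, including the earlier regeneration times, is therefore an event of the past, and the
probability of seeing consecutive regeneration times with prescribed words between them factorises
(\<open>pattern_renewal\<close>, \<open>cycle_law\<close>).

Regeneration times exist because of the growth condition. Regularity of \<open>w\<close> bounds the
probability that the last copy of \<open>w\<close> is at distance at least \<open>m\<close> by a constant times
\<open>exp (- C m)\<close>, while \<open>lw m \<le> exp (\<theta> C m)\<close> eventually, for some \<open>\<theta> < 1\<close>. After a run of \<open>N + 1\<close> copies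
the expected number of times at which a context reaches back behind the run is at most the
sum of \<open>(lw m - N |w|)\<^sup>+\<close> against this geometric tail, which is below \<open>1\<close> for large \<open>N\<close>
(\<open>exists_run_length\<close>, \<open>Pr_regen_pos\<close>). Regularity also makes the conditional probability of a
regeneration, given any past, bounded below, which forces infinitely many of them in both
directions (\<open>AE_regen_unbounded\<close>).

What remains is renewal theory for two-sided stationary sequences. Let \<open>\<rho>\<close> be the probability that
\<open>0\<close> is a regeneration time and let \<open>\<rho> f(s)\<close> be the probability that in addition the word up to the
next one is \<open>s\<close> (\<open>cycle_weight\<close> below). The product formula says that the blocks are independent, that a block with
non-zero index has law \<open>f\<close>, and that the block around the origin has the size-biased law \<open>\<rho> |s| f(s)\<close>,
because each of its \<open>|s|\<close> positions may be the origin. As the latter is a probability law, the mean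
length under \<open>f\<close> is \<open>1 / \<rho>\<close>. Given all times, the product formula leaves in each block the law \<open>f\<close>
restricted to words of the prescribed length.\<close>

section \<open>Window events\<close>

text \<open>The events that depend on finitely many coordinates replace the filtration: they are measurable because
  the alphabet is countable, and they generate the product \<open>\<sigma>\<close>-algebra.\<close>

definition window :: "int \<Rightarrow> int \<Rightarrow> ((int \<Rightarrow> 'a) \<Rightarrow> bool) \<Rightarrow> bool" where
  "window a b P \<longleftrightarrow> (\<forall>x y. (\<forall>i. a \<le> i \<longrightarrow> i < b \<longrightarrow> x i = y i) \<longrightarrow> P x \<longrightarrow> P y)"

definition wd :: "(int \<Rightarrow> 'a) \<Rightarrow> int \<Rightarrow> int \<Rightarrow> 'a list" where
  "wd x a b = map x [a..b - 1]"

lemma windowI: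
  assumes "\<And>x y. (\<And>i. a \<le> i \<Longrightarrow> i < b \<Longrightarrow> x i = y i) \<Longrightarrow> P x \<longleftrightarrow> P y"
  shows "window a b P"
  using assms unfolding window_def by blast

lemma windowD:
  assumes "window a b P" "\<And>i. a \<le> i \<Longrightarrow> i < b \<Longrightarrow> x i = y i"
  shows "P x \<longleftrightarrow> P y"
  using assms unfolding window_def by metis

lemma window_mono: "window a b P \<Longrightarrow> a' \<le> a \<Longrightarrow> b \<le> b' \<Longrightarrow> window a' b' P"
  unfolding window_def by (meson order_trans order_less_le_trans)

lemma window_conj: "window a b P \<Longrightarrow> window a b Q \<Longrightarrow> window a b (\<lambda>x. P x \<and> Q x)"
  unfolding window_def by blast

lemma window_not: "window a b P \<Longrightarrow> window a b (\<lambda>x. \<not> P x)"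
  unfolding window_def by metis

text
  \<open>Here the premise is a condition on parameters only, which may then be used to bound the window.\<close>

lemma window_imp: "(Q \<Longrightarrow> window a b P) \<Longrightarrow> window a b (\<lambda>x. Q \<longrightarrow> P x)"
  unfolding window_def by blast

lemma window_impl: "window a b P \<Longrightarrow> window a b Q \<Longrightarrow> window a b (\<lambda>x. P x \<longrightarrow> Q x)"
  unfolding window_def by metis

lemma window_all: "(\<And>k. window a b (P k)) \<Longrightarrow> window a b (\<lambda>x. \<forall>k. P k x)"
  unfolding window_def by blast

lemma window_True: "window a b (\<lambda>x. Q)"
  unfolding window_def by blast

lemma wd_eq_iff: "wd x a b = wd y a b \<longleftrightarrow> (\<forall>i. a \<le> i \<longrightarrow> i < b \<longrightarrow> x i = y i)"
  unfolding wd_def by auto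

lemma length_wd: "length (wd x a b) = nat (b - a)"
  unfolding wd_def by simp

lemma wd_snoc: "a \<le> b \<Longrightarrow> wd x a (b + 1) = wd x a b @ [x b]"
  unfolding wd_def by (simp add: upto_rec2)

lemma window_wd: "window a b (\<lambda>x. wd x a b = s)"
  by (rule windowI) (metis wd_eq_iff)

lemma measurable_map_word:
  fixes M :: "(int \<Rightarrow> 'a :: countable) measure"
  assumes "\<And>i. i \<in> set is \<Longrightarrow> (\<lambda>x. x i) \<in> measurable M (count_space UNIV)"
  shows "(\<lambda>x. map x is) \<in> measurable M (count_space UNIV)"
  using assms
proof (induction "is")
  case (Cons i js)
  have a: "(\<lambda>x. map x js) \<in> measurable M (count_space UNIV)" using Cons by simp
  have b: "(\<lambda>x. x i) \<in> measurable M (count_space UNIV)" using Cons by simp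
  have "(\<lambda>x. (case (x i, map x js) of (a, l) \<Rightarrow> a # l)) \<in> measurable M (count_space UNIV)"
    using measurable_compose_countable[OF _ a, of "\<lambda>l x. x i # l"]
      measurable_compose[OF b, of "\<lambda>a. a # _" "count_space UNIV"] by simp
  thus ?case by simp
qed simp

lemma window_measurable:
  fixes M :: "(int \<Rightarrow> 'a :: countable) measure"
  assumes "window a b P"
    and "\<And>i. a \<le> i \<Longrightarrow> i < b \<Longrightarrow> (\<lambda>x. x i) \<in> measurable M (count_space UNIV)"
  shows "Measurable.pred M P"
proof -
  have w: "(\<lambda>x. wd x a b) \<in> measurable M (count_space UNIV)"
    unfolding wd_def by (rule measurable_map_word) (use assms(2) in auto)
  have "P = (\<lambda>x. wd x a b \<in> (\<lambda>y. wd y a b) ` Collect P)"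
  proof (rule ext)
    fix x
    show "P x = (wd x a b \<in> (\<lambda>y. wd y a b) ` Collect P)"
      unfolding image_iff wd_eq_iff Bex_def mem_Collect_eq
      using assms(1) unfolding window_def by metis
  qed
  moreover have "Measurable.pred M (\<lambda>x. wd x a b \<in> (\<lambda>y. wd y a b) ` Collect P)"
    by (rule measurable_compose[OF w]) simp
  ultimately show ?thesis by simp
qed

lemma space_seq_space [simp]: "space seq_space = UNIV"
  unfolding seq_space_def by (simp add: space_PiM)

lemma measurable_coord_seq_space [measurable]: "(\<lambda>x. x i) \<in> measurable seq_space (count_space UNIV)"
  unfolding seq_space_def by (rule measurable_component_singleton) simp

definition window_sets :: "(int \<Rightarrow> 'a) set set" where
  "window_sets = {{x. P x} | P. \<exists>a b. window a b P}"

lemma Int_stable_window_sets: "Int_stable window_sets"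
proof (rule Int_stableI)
  fix A B :: "(int \<Rightarrow> 'a) set"
  assume "A \<in> window_sets" "B \<in> window_sets"
  then obtain P a b Q c d where "A = {x. P x}" "window a b P" "B = {x. Q x}" "window c d Q"
    unfolding window_sets_def by blast
  moreover from this have "window (min a c) (max b d) P" "window (min a c) (max b d) Q"
    by (auto elim!: window_mono)
  ultimately show "A \<inter> B \<in> window_sets"
    unfolding window_sets_def
    using window_conj[of "min a c" "max b d" P Q]
    by (auto intro!: exI[of _ "\<lambda>x. P x \<and> Q x"])
qed

lemma sets_seq_space_window:
  "sets (seq_space :: (int \<Rightarrow> 'a :: countable) measure) = sigma_sets UNIV window_sets"
proof
  show "sigma_sets UNIV window_sets \<subseteq> sets (seq_space :: (int \<Rightarrow> 'a) measure)"
  proof (rule sets.sigma_sets_subset[of _ seq_space, simplified])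
    show "window_sets \<subseteq> sets (seq_space :: (int \<Rightarrow> 'a) measure)"
      unfolding window_sets_def
      using window_measurable[where M = "seq_space :: (int \<Rightarrow> 'a) measure"] by (auto simp: pred_def)
  qed
  show "sets seq_space \<subseteq> sigma_sets (UNIV :: (int \<Rightarrow> 'a) set) window_sets"
    unfolding seq_space_def sets_PiM_single
  proof (simp, rule sigma_sets_mono, clarsimp)
    fix i :: int and A :: "'a set"
    have "window i (i + 1) (\<lambda>x. x i \<in> A)" by (rule windowI) (metis order_refl zless_add1_eq)
    hence "{f. f i \<in> A} \<in> window_sets" unfolding window_sets_def by blast
    thus "{f. f i \<in> A} \<in> sigma_sets UNIV window_sets" by blast
  qed
qed

lemma measurable_coord_algebra:
  "i \<in> I \<Longrightarrow> (\<lambda>x. x i) \<in> measurable (coord_algebra \<Omega> I) (count_space UNIV)"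
proof -
  assume i: "i \<in> I"
  have "(\<lambda>x. restrict x I) \<in> measurable (coord_algebra \<Omega> I) (PiM I (\<lambda>_. count_space UNIV))"
    unfolding coord_algebra_def by (rule measurable_vimage_algebra1) (auto simp: space_PiM)
  from measurable_compose[OF this measurable_component_singleton[OF i]] i show ?thesis by simp
qed

lemma space_coord_algebra [simp]: "space (coord_algebra \<Omega> I) = \<Omega>"
  unfolding coord_algebra_def by simp

section \<open>Stationary laws\<close>

locale stationary_law =
  fixes \<mu> :: "(int \<Rightarrow> 'a :: countable) measure"
  assumes chain: "chain_law \<mu>"
    and stat: "stationary \<mu>"
begin

sublocale prob_space \<mu>
  using chain unfolding chain_law_def by blast

lemma sets_mu: "sets \<mu> = sets seq_space"
  using chain unfolding chain_law_def by blast

lemma space_mu [simp]: "space \<mu> = UNIV"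
  using sets_eq_imp_space_eq[OF sets_mu] by simp

abbreviation Pr :: "((int \<Rightarrow> 'a) \<Rightarrow> bool) \<Rightarrow> real" where
  "Pr P \<equiv> measure \<mu> {x. P x}"

lemma measurable_coord [measurable]: "(\<lambda>x. x i) \<in> measurable \<mu> (count_space UNIV)"
  using measurable_cong_sets[OF sets_mu refl] measurable_coord_seq_space by blast

lemma measurable_wd [measurable]: "(\<lambda>x. wd x a b) \<in> measurable \<mu> (count_space UNIV)"
  unfolding wd_def by (rule measurable_map_word) simp

lemma window_pred: "window a b P \<Longrightarrow> Measurable.pred \<mu> P"
  by (rule window_measurable) auto

lemma window_event: "window a b P \<Longrightarrow> {x. P x} \<in> events"
  using window_pred by (simp add: pred_def)

lemma measurable_shift [measurable]: "(\<lambda>x n. x (n + c)) \<in> measurable \<mu> \<mu>"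
proof -
  have "(\<lambda>x n. x (n + c)) \<in> measurable \<mu> seq_space"
    unfolding seq_space_def by (rule measurable_PiM_single') (auto simp: space_PiM)
  thus ?thesis using measurable_cong_sets[OF refl sets_mu] by blast
qed

lemma Pr_shift_one:
  assumes "{x. P x} \<in> events"
  shows "Pr (\<lambda>x. P (\<lambda>n. x (n + 1))) = Pr P"
proof -
  have m: "(\<lambda>x n. x (n + 1)) \<in> measurable \<mu> seq_space"
    using measurable_shift[of 1] measurable_cong_sets[OF refl sets_mu] by blast
  have "Pr P = measure (distr \<mu> seq_space (\<lambda>x n. x (n + 1))) {x. P x}"
    using stat unfolding stationary_def by simp
  also have "\<dots> = measure \<mu> ((\<lambda>x n. x (n + 1)) -` {x. P x} \<inter> space \<mu>)"
    by (rule measure_distr[OF m]) (use assms sets_mu in simp)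
  also have "(\<lambda>x n. x (n + 1)) -` {x. P x} \<inter> space \<mu> = {x. P (\<lambda>n. x (n + 1))}" by auto
  finally show ?thesis by simp
qed

lemma shift_event:
  assumes "{x. P x} \<in> events"
  shows "{x. P (\<lambda>n. x (n + c))} \<in> events"
proof -
  have "(\<lambda>x n. x (n + c)) -` {x. P x} \<inter> space \<mu> \<in> events"
    by (rule measurable_sets[OF measurable_shift assms])
  moreover have "(\<lambda>x n. x (n + c)) -` {x. P x} \<inter> space \<mu> = {x. P (\<lambda>n. x (n + c))}" by auto
  ultimately show ?thesis by simp
qed

lemma Pr_shift:
  assumes "{x. P x} \<in> events"
  shows "Pr (\<lambda>x. P (\<lambda>n. x (n + c))) = Pr P"
proof -
  have pos: "Pr (\<lambda>x. P (\<lambda>n. x (n + int c))) = Pr P" if "{x. P x} \<in> events" for c P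
    using that
  proof (induction c arbitrary: P)
    case (Suc c)
    have "Pr (\<lambda>x. P (\<lambda>n. x (n + int (Suc c)))) = Pr (\<lambda>x. (\<lambda>y. P (\<lambda>n. y (n + int c))) (\<lambda>n. x (n + 1)))"
      by (simp add: ac_simps)
    also have "\<dots> = Pr (\<lambda>y. P (\<lambda>n. y (n + int c)))"
      by (rule Pr_shift_one) (rule shift_event[OF Suc.prems])
    also have "\<dots> = Pr P" by (rule Suc.IH[OF Suc.prems])
    finally show ?case .
  qed simp
  show ?thesis
  proof (cases "c \<ge> 0")
    case True
    thus ?thesis using pos[OF assms, of "nat c"] by simp
  next
    case False
    have "Pr (\<lambda>x. (\<lambda>y. P (\<lambda>n. y (n + c))) (\<lambda>n. x (n + int (nat (- c))))) = Pr (\<lambda>y. P (\<lambda>n. y (n + c)))"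
      by (rule pos) (rule shift_event[OF assms])
    thus ?thesis using False by (simp add: add.assoc)
  qed
qed

lemma Pr_partition:
  fixes V :: "(int \<Rightarrow> 'a) \<Rightarrow> 'b :: countable"
  assumes P: "{x. P x} \<in> events" and V: "V \<in> measurable \<mu> (count_space UNIV)"
  shows "ennreal (Pr P) = (\<integral>\<^sup>+s. ennreal (Pr (\<lambda>x. P x \<and> V x = s)) \<partial>count_space UNIV)"
proof -
  have m: "{x. P x \<and> V x = s} \<in> events" for s
  proof -
    have "V -` {s} \<inter> space \<mu> \<in> events" by (rule measurable_sets[OF V]) simp
    moreover have "{x. P x \<and> V x = s} = {x. P x} \<inter> (V -` {s} \<inter> space \<mu>)" by auto
    ultimately show ?thesis using P by auto
  qed
  have "{x. P x} = (\<Union>s. {x. P x \<and> V x = s})" by auto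
  hence "emeasure \<mu> {x. P x} = emeasure \<mu> (\<Union>s\<in>UNIV. {x. P x \<and> V x = s})" by simp
  also have "\<dots> = (\<integral>\<^sup>+s. emeasure \<mu> {x. P x \<and> V x = s} \<partial>count_space UNIV)"
    by (rule emeasure_UN_countable) (use m in \<open>auto simp: disjoint_family_on_def\<close>)
  finally show ?thesis by (simp add: emeasure_eq_measure)
qed

text
  \<open>Used to pass from words to arbitrary window events: a proportionality that holds on each cell of a countable partition holds in total.\<close>

lemma Pr_ratio_partition:
  fixes V :: "(int \<Rightarrow> 'a) \<Rightarrow> 'b :: countable"
  assumes P: "{x. P x} \<in> events" and Q: "{x. Q x} \<in> events"
    and V: "V \<in> measurable \<mu> (count_space UNIV)"
    and c: "c \<ge> 0" "d \<ge> 0"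
    and eq: "\<And>s. Pr (\<lambda>x. P x \<and> V x = s) * c = d * Pr (\<lambda>x. Q x \<and> V x = s)"
  shows "Pr P * c = d * Pr Q"
proof -
  have "ennreal (Pr P * c) = ennreal (Pr P) * ennreal c" by (simp add: ennreal_mult c)
  also have "\<dots> = (\<integral>\<^sup>+s. ennreal (Pr (\<lambda>x. P x \<and> V x = s)) * ennreal c \<partial>count_space UNIV)"
    unfolding Pr_partition[OF P V] by (rule nn_integral_multc[symmetric]) simp
  also have "\<dots> = (\<integral>\<^sup>+s. ennreal d * ennreal (Pr (\<lambda>x. Q x \<and> V x = s)) \<partial>count_space UNIV)"
    using eq c by (simp add: ennreal_mult[symmetric])
  also have "\<dots> = ennreal d * ennreal (Pr Q)"
    unfolding Pr_partition[OF Q V] by (rule nn_integral_cmult) simp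
  finally have "ennreal (Pr P * c) = ennreal (d * Pr Q)" by (simp add: ennreal_mult c)
  thus ?thesis using c by simp
qed

text \<open>The events with this approximation property form a \<open>\<sigma>\<close>-algebra that contains the
  window events.\<close>

lemma approx_by_window:
  assumes "A \<in> events" "e > 0"
  shows "\<exists>P a b. window a b P \<and> measure \<mu> ((A - {x. P x}) \<union> ({x. P x} - A)) < e"
proof -
  have "A \<in> sigma_sets UNIV window_sets" using assms(1) sets_mu sets_seq_space_window by blast
  thus ?thesis using assms(2)
  proof (induction arbitrary: e)
    case (Basic A)
    then obtain P a b where "A = {x. P x}" "window a b P" unfolding window_sets_def by blast
    thus ?case using Basic by (intro exI[of _ P] exI[of _ a] exI[of _ b]) simp
  next
    case Empty
    thus ?case by (intro exI[of _ "\<lambda>_. False"] exI[of _ 0] exI[of _ 0]) (simp add: window_True)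
  next
    case (Compl A)
    then obtain P a b where P: "window a b P" "measure \<mu> ((A - {x. P x}) \<union> ({x. P x} - A)) < e" by blast
    have "((UNIV - A) - {x. \<not> P x}) \<union> ({x. \<not> P x} - (UNIV - A)) = (A - {x. P x}) \<union> ({x. P x} - A)"
      by auto
    thus ?case using P window_not[OF P(1)] by (metis (no_types, lifting))
  next
    case (Union A)
    have ev: "A i \<in> events" for i
      using Union(1) sets_mu sets_seq_space_window by blast
    \<comment> \<open>split the error: half for truncating the union, the rest shared equally among the pieces\<close>
    have "(\<lambda>n. measure \<mu> (\<Union>i<n. A i)) \<longlonglongrightarrow> measure \<mu> (\<Union>n. \<Union>i<n. A i)"
      by (rule finite_Lim_measure_incseq) (use ev in \<open>auto simp: incseq_def intro: less_le_trans\<close>)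
    moreover have "(\<Union>n. \<Union>i<n. A i) = (\<Union>i. A i)" by blast
    ultimately have "(\<lambda>n. measure \<mu> (\<Union>i<n. A i)) \<longlonglongrightarrow> measure \<mu> (\<Union>i. A i)" by simp
    from LIMSEQ_D[OF this, of "e / 2"] Union(3) obtain n
      where n: "\<bar>measure \<mu> (\<Union>i<n. A i) - measure \<mu> (\<Union>i. A i)\<bar> < e / 2" by auto
    have sub: "(\<Union>i<n. A i) \<subseteq> (\<Union>i. A i)" by blast
    have d1: "measure \<mu> ((\<Union>i. A i) - (\<Union>i<n. A i)) < e / 2"
      using n finite_measure_Diff[OF _ _ sub] finite_measure_mono[OF sub] ev by auto
    have pos: "e / (2 * real (n + 1)) > 0" using Union(3) by simp
    have "\<forall>i. \<exists>P a b. window a b P \<and> measure \<mu> ((A i - {x. P x}) \<union> ({x. P x} - A i)) < e / (2 * real (n + 1))"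
      using Union(2)[OF pos] by blast
    then obtain P a b where P: "\<And>i. window (a i) (b i) (P i)"
      "\<And>i. measure \<mu> ((A i - {x. P i x}) \<union> ({x. P i x} - A i)) < e / (2 * real (n + 1))" by metis
    define Q where "Q x \<longleftrightarrow> (\<exists>i<n. P i x)" for x
    have "\<exists>a' b'. \<forall>i<m. window a' b' (P i)" for m
    proof (induction m)
      case (Suc m)
      then obtain a' b' where "\<forall>i<m. window a' b' (P i)" by blast
      hence "\<forall>i<Suc m. window (min a' (a m)) (max b' (b m)) (P i)"
        using window_mono[OF P(1)[of m]] by (auto simp: less_Suc_eq elim!: window_mono)
      thus ?case by blast
    qed simp
    then obtain a' b' where ab: "\<forall>i<n. window a' b' (P i)" by blast
    have wQ: "window a' b' Q" unfolding Q_def window_def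
      using ab unfolding window_def by metis
    let ?D = "\<lambda>i. (A i - {x. P i x}) \<union> ({x. P i x} - A i)"
    have D: "?D i \<in> events" for i using ev window_event[OF P(1)] by auto
    have "measure \<mu> (((\<Union>i. A i) - {x. Q x}) \<union> ({x. Q x} - (\<Union>i. A i)))
        \<le> measure \<mu> (((\<Union>i. A i) - (\<Union>i<n. A i)) \<union> (\<Union>i<n. ?D i))"
      by (rule finite_measure_mono) (use ev D in \<open>auto simp: Q_def\<close>)
    also have "\<dots> \<le> measure \<mu> ((\<Union>i. A i) - (\<Union>i<n. A i)) + measure \<mu> (\<Union>i<n. ?D i)"
      by (rule measure_Un_le) (use ev D in auto)
    also have "measure \<mu> (\<Union>i<n. ?D i) \<le> (\<Sum>i<n. measure \<mu> (?D i))"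
      by (rule finite_measure_subadditive_finite) (use D in auto)
    also have "(\<Sum>i<n. measure \<mu> (?D i)) \<le> real n * (e / (2 * real (n + 1)))"
      using sum_bounded_above[of "{..<n}" "\<lambda>i. measure \<mu> (?D i)" "e / (2 * real (n + 1))"]
        P(2) by (auto intro: less_imp_le)
    also have "\<dots> \<le> e / 2" using Union(3) by (simp add: field_simps)
    finally have "measure \<mu> (((\<Union>i. A i) - {x. Q x}) \<union> ({x. Q x} - (\<Union>i. A i))) < e"
      using d1 by linarith
    thus ?case using wQ by blast
  qed
qed

end

section \<open>Consecutive regeneration times\<close>

definition consec :: "(int \<Rightarrow> bool) \<Rightarrow> int \<Rightarrow> int \<Rightarrow> bool" where
  "consec R k k' \<longleftrightarrow> k < k' \<and> R k \<and> R k' \<and> (\<forall>j. k < j \<longrightarrow> j < k' \<longrightarrow> \<not> R j)"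

text \<open>The set of regeneration times between \<open>u a\<close> and \<open>u b\<close> is exactly
  \<open>u a < \<dots> < u b\<close>, and the words between them are prescribed. Asking for
  \<open>R (u b)\<close> separately makes the definition meaningful for \<open>a = b\<close>, the start of the
  induction.\<close>

definition pattern ::
  "(int \<Rightarrow> bool) \<Rightarrow> (int \<Rightarrow> 'a) \<Rightarrow> (int \<Rightarrow> int) \<Rightarrow> (int \<Rightarrow> 'a list set) \<Rightarrow> int \<Rightarrow> int \<Rightarrow> bool" where
  "pattern R x u A a b \<longleftrightarrow> R (u b) \<and>
     (\<forall>i. a \<le> i \<longrightarrow> i < b \<longrightarrow> consec R (u i) (u (i + 1)) \<and> wd x (u i) (u (i + 1)) \<in> A i)"

lemma pattern_step:
  "a < b \<Longrightarrow> pattern R x u A a b \<longleftrightarrow>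
     (consec R (u a) (u (a + 1)) \<and> wd x (u a) (u (a + 1)) \<in> A a) \<and> pattern R x u A (a + 1) b"
  unfolding pattern_def by (smt (verit))

lemma pattern_start: "a \<le> b \<Longrightarrow> pattern R x u A a b \<Longrightarrow> R (u a)"
  unfolding pattern_def consec_def by (metis order_refl order_neq_le_trans)

lemma increasing_range:
  fixes u :: "int \<Rightarrow> int"
  assumes "\<And>i. a \<le> i \<Longrightarrow> i < b \<Longrightarrow> u i < u (i + 1)" "a \<le> i" "i \<le> j" "j \<le> b"
  shows "u i \<le> u j"
  using assms(3,4)
proof (induction j rule: int_ge_induct)
  case (step j)
  thus ?case using assms(1)[of j] assms(2) by force
qed simp

section \<open>Stationary regenerative processes\<close>

lemma consec_unique_right: "consec R k k' \<Longrightarrow> consec R k k'' \<Longrightarrow> k' = k''"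
  unfolding consec_def by (metis linorder_neqE_linordered_idom)

lemma consec_unique_left: "consec R k k' \<Longrightarrow> consec R k'' k' \<Longrightarrow> k = k''"
  unfolding consec_def by (metis linorder_neqE_linordered_idom)

lemma pred_finite_trace:
  assumes "finite S" "\<And>j. j \<in> S \<Longrightarrow> Measurable.pred M (\<lambda>x. R x j)"
  shows "Measurable.pred M (\<lambda>x. P {j \<in> S. R x j})"
  using assms
proof (induction S arbitrary: P rule: finite_induct)
  case (insert s S)
  have "{j \<in> insert s S. R x j} = (if R x s then insert s {j \<in> S. R x j} else {j \<in> S. R x j})" for x
    by auto
  hence eq: "(\<lambda>x. P {j \<in> insert s S. R x j})
    = (\<lambda>x. (R x s \<and> P (insert s {j \<in> S. R x j})) \<or> (\<not> R x s \<and> P {j \<in> S. R x j}))" by auto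
  have [measurable]: "Measurable.pred M (\<lambda>x. R x s)" using insert.prems by simp
  have [measurable]: "Measurable.pred M (\<lambda>x. P {j \<in> S. R x j})" for P
    by (rule insert.IH) (use insert.prems in simp)
  show ?case unfolding eq by measurable
qed simp

text \<open>The renewal theory uses only the following about the random set \<open>R x\<close>: membership of
  \<open>k\<close> is a countable intersection of events that depend on finitely many coordinates from
  \<open>k\<close> on; the set moves with the sequence; it is unbounded on both sides; and cutting at one of its
  points splits off a factor.\<close>

locale regenerative_process = stationary_law \<mu>
  for \<mu> :: "(int \<Rightarrow> 'a :: countable) measure" +
  fixes R :: "(int \<Rightarrow> 'a) \<Rightarrow> int \<Rightarrow> bool"
  assumes R_closed: "\<exists>D. (\<forall>i::nat. window k (k + int i) (D i)) \<and> (\<forall>x. R x k \<longleftrightarrow> (\<forall>i. D i x))"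
    and R_shift: "R (\<lambda>n. x (n + c)) k \<longleftrightarrow> R x (k + c)"
    and R_unbounded: "AE x in \<mu>. (\<forall>k. \<exists>n\<ge>k. R x n) \<and> (\<forall>k. \<exists>n\<le>k. R x n)"
    and renewal: "a < b \<Longrightarrow> Pr (\<lambda>x. pattern (R x) x u A a b) * Pr (\<lambda>x. R x 0)
      = Pr (\<lambda>x. consec (R x) 0 (u (a + 1) - u a) \<and> wd x 0 (u (a + 1) - u a) \<in> A a) *
        Pr (\<lambda>x. pattern (R x) x u A (a + 1) b)"
begin

subsection \<open>Measurability and the law of consecutive cycles\<close>

lemma R_pred:
  assumes "\<And>i. k \<le> i \<Longrightarrow> (\<lambda>x. x i) \<in> measurable M (count_space UNIV)"
  shows "Measurable.pred M (\<lambda>x. R x k)"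
proof -
  obtain D :: "nat \<Rightarrow> (int \<Rightarrow> 'a) \<Rightarrow> bool"
    where D': "(\<forall>i. window k (k + int i) (D i)) \<and> (\<forall>x. R x k \<longleftrightarrow> (\<forall>i. D i x))"
    using R_closed[of k] by (rule exE)
  note D = D'[THEN conjunct1, rule_format] D'[THEN conjunct2, THEN spec]
  have "Measurable.pred M (\<lambda>x. D i x)" for i
    by (rule window_measurable[OF D(1)]) (rule assms)
  thus ?thesis unfolding D(2) by (rule pred_intros_countable)
qed

lemma R_pred_mu [measurable]: "Measurable.pred \<mu> (\<lambda>x. R x k)"
  by (rule R_pred) simp

lemma R_event: "{x. R x k} \<in> events"
  using R_pred_mu[of k] by (simp add: pred_def)

definition \<rho> :: real where "\<rho> = Pr (\<lambda>x. R x 0)"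

text \<open>Conditionally on a regeneration at \<open>0\<close>, the probability that the next one is at
  \<open>d\<close> and that the word up to it lies in \<open>A\<close>.\<close>

definition cycle_prob :: "int \<Rightarrow> 'a list set \<Rightarrow> real" where
  "cycle_prob d A = Pr (\<lambda>x. consec (R x) 0 d \<and> wd x 0 d \<in> A) / \<rho>"

lemma Pr_R: "Pr (\<lambda>x. R x k) = \<rho>"
proof -
  have "Pr (\<lambda>x. R (\<lambda>n. x (n + k)) 0) = Pr (\<lambda>x. R x 0)" by (rule Pr_shift[OF R_event])
  thus ?thesis by (simp add: R_shift \<rho>_def)
qed

lemma rho_pos: "\<rho> > 0"
proof (rule ccontr)
  assume "\<not> \<rho> > 0"
  hence "\<rho> = 0" unfolding \<rho>_def by (simp add: zero_less_measure_iff)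
  hence "AE x in \<mu>. \<not> R x k" for k
    by (intro AE_I'[of "{x. R x k}"]) (auto intro!: null_setsI simp: emeasure_eq_measure Pr_R R_event)
  hence "AE x in \<mu>. \<forall>k. \<not> R x k" by (simp add: AE_all_countable)
  with R_unbounded have "AE x in \<mu>. False" by eventually_elim blast
  thus False by simp
qed

lemma cycle_law:
  assumes "a \<le> b"
  shows "Pr (\<lambda>x. pattern (R x) x u A a b) = \<rho> * (\<Prod>i\<in>{a..<b}. cycle_prob (u (i + 1) - u i) (A i))"
  using assms
proof (induction a rule: int_le_induct)
  case base
  have "pattern (R x) x u A b b \<longleftrightarrow> R x (u b)" for x unfolding pattern_def by auto
  thus ?case by (simp add: Pr_R)
next
  case (step a)
  have "{a - 1..<b} = insert (a - 1) {a..<b}" using step.hyps by auto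
  hence "(\<Prod>i\<in>{a - 1..<b}. cycle_prob (u (i + 1) - u i) (A i))
      = cycle_prob (u a - u (a - 1)) (A (a - 1)) * (\<Prod>i\<in>{a..<b}. cycle_prob (u (i + 1) - u i) (A i))" by simp
  moreover have "Pr (\<lambda>x. pattern (R x) x u A (a - 1) b) * \<rho>
      = (\<rho> * cycle_prob (u a - u (a - 1)) (A (a - 1))) * Pr (\<lambda>x. pattern (R x) x u A a b)"
    using renewal[of "a - 1" b u A] step.hyps rho_pos by (simp add: cycle_prob_def \<rho>_def[symmetric])
  ultimately show ?case using step.IH rho_pos by simp
qed

subsection \<open>Enumerating the regeneration times\<close>

text \<open>The index of the last regeneration time that is at most \<open>k\<close>, when index \<open>0\<close> is
  given to the last one that is at most \<open>0\<close>. In this form the index depends, for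
  \<open>k \<le> 0\<close>, only on the set \<open>R x\<close> to the right of \<open>k\<close>, and for
  \<open>k \<ge> 1\<close> only on its part in \<open>{1..k}\<close>; this is what makes the times measurable with
  respect to the future.\<close>

definition cnt :: "(int \<Rightarrow> 'a) \<Rightarrow> int \<Rightarrow> int" where
  "cnt x k = int (card {j \<in> {1..k}. R x j}) - int (card {j \<in> {k + 1..0}. R x j})"

definition \<Omega> :: "(int \<Rightarrow> 'a) set" where
  "\<Omega> = {x. (\<forall>k. \<exists>n\<ge>k. R x n) \<and> (\<forall>k. \<exists>n\<le>k. R x n)}"

text \<open>Off \<open>\<Omega>\<close> there may be no regeneration time of index \<open>i\<close>, hence the default
  value.\<close>

definition T :: "(int \<Rightarrow> 'a) \<Rightarrow> int \<Rightarrow> int" where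
  "T x i = (if x \<in> \<Omega> then THE k. R x k \<and> cnt x k = i else i)"

lemma cnt_step: "cnt x k = cnt x (k - 1) + (if R x k then 1 else 0)"
proof (cases "k \<ge> 1")
  case True
  define S where "S = {j \<in> {1..k - 1}. R x j}"
  have "{1..k} = insert k {1..k - 1}" using True by auto
  hence e: "{j \<in> {1..k}. R x j} = (if R x k then insert k S else S)" unfolding S_def by auto
  have "finite S" by (rule finite_subset[of S "{1..k - 1}"]) (auto simp: S_def)
  moreover have "k \<notin> S" unfolding S_def by auto
  ultimately have "card {j \<in> {1..k}. R x j} = card S + (if R x k then 1 else 0)" unfolding e by simp
  moreover have "cnt x (k - 1) = int (card S)" unfolding cnt_def S_def using True by simp
  ultimately show ?thesis using True unfolding cnt_def[of x k] by simp
next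
  case False
  define S where "S = {j \<in> {k + 1..0}. R x j}"
  have "{k..0} = insert k {k + 1..0}" using False by auto
  hence e: "{j \<in> {k..0}. R x j} = (if R x k then insert k S else S)" unfolding S_def by auto
  have "finite S" by (rule finite_subset[of S "{k + 1..0}"]) (auto simp: S_def)
  moreover have "k \<notin> S" unfolding S_def by auto
  ultimately have "card {j \<in> {k..0}. R x j} = card S + (if R x k then 1 else 0)" unfolding e by simp
  moreover have "cnt x k = - int (card S)" unfolding cnt_def S_def using False by simp
  ultimately show ?thesis using False unfolding cnt_def[of x "k - 1"] by simp
qed

lemma cnt_0: "cnt x 0 = 0"
  unfolding cnt_def by simp

lemma cnt_mono: "k \<le> k' \<Longrightarrow> cnt x k \<le> cnt x k'"
proof (induction k' rule: int_ge_induct)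
  case (step k')
  thus ?case using cnt_step[of x "k' + 1"] by simp
qed simp

lemma cnt_less: "k < k' \<Longrightarrow> R x k' \<Longrightarrow> cnt x k < cnt x k'"
  using cnt_mono[of k "k' - 1" x] cnt_step[of x k'] by simp

lemma cnt_less_iff: "R x k \<Longrightarrow> R x k' \<Longrightarrow> cnt x k < cnt x k' \<longleftrightarrow> k < k'"
  using cnt_less[of k k' x] cnt_mono[of k' k x] by linarith

text \<open>A counting function with steps \<open>0\<close> and \<open>1\<close> that is unbounded on both sides takes
  each value, and takes it first at a point of \<open>R x\<close>.\<close>

lemma cnt_surj:
  assumes "x \<in> \<Omega>"
  shows "\<exists>k. R x k \<and> cnt x k = i"
proof -
  have up: "\<exists>k. cnt x k \<ge> int m" for m
  proof (induction m)
    case 0 thus ?case using cnt_0[of x] by (metis of_nat_0 order_refl)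
  next
    case (Suc m)
    then obtain k where k: "cnt x k \<ge> int m" by blast
    obtain n where n: "n \<ge> k + 1" "R x n" using assms unfolding \<Omega>_def by blast
    thus ?case using cnt_less[of k n x] k by (intro exI[of _ n]) simp
  qed
  have down: "\<exists>k. cnt x k \<le> - int m" for m
  proof (induction m)
    case 0 thus ?case using cnt_0[of x] by (metis of_nat_0 minus_zero order_refl)
  next
    case (Suc m)
    then obtain k where k: "cnt x k \<le> - int m" by blast
    obtain n where n: "n \<le> k" "R x n" using assms unfolding \<Omega>_def by blast
    thus ?case using cnt_step[of x n] cnt_mono[of n k x] k by (intro exI[of _ "n - 1"]) simp
  qed
  obtain k0 where "cnt x k0 \<le> - int (nat (1 - i))" using down by blast
  hence k0: "cnt x k0 < i" by linarith
  obtain k1 where "cnt x k1 \<ge> int (nat i)" using up by blast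
  hence k1: "cnt x k1 \<ge> i" by linarith
  have "k0 \<le> k1" using k0 k1 cnt_mono[of k1 k0 x] by linarith
  moreover have "k0 \<le> k \<Longrightarrow> cnt x k \<ge> i \<Longrightarrow> \<exists>j. R x j \<and> cnt x j = i" for k
  proof (induction k rule: int_ge_induct)
    case (step k)
    show ?case
    proof (cases "cnt x k \<ge> i")
      case False
      hence "R x (k + 1) \<and> cnt x (k + 1) = i"
        using step.prems cnt_step[of x "k + 1"] by (auto split: if_splits)
      thus ?thesis by blast
    qed (use step.IH in blast)
  qed (use k0 in simp)
  ultimately show ?thesis using k1 by blast
qed

lemma T_iff:
  assumes "x \<in> \<Omega>"
  shows "T x i = k \<longleftrightarrow> R x k \<and> cnt x k = i"
proof -
  have "\<exists>!k. R x k \<and> cnt x k = i"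
    using cnt_surj[OF assms] cnt_less_iff[of x] by (metis less_irrefl linorder_neqE_linordered_idom)
  from theI'[OF this] this show ?thesis using assms unfolding T_def by (metis (mono_tags, lifting))
qed

lemma T_R: "x \<in> \<Omega> \<Longrightarrow> R x (T x i)" and cnt_T: "x \<in> \<Omega> \<Longrightarrow> cnt x (T x i) = i"
  using T_iff by blast+

lemma T_increasing: "x \<in> \<Omega> \<Longrightarrow> T x i < T x (i + 1)"
  using cnt_less_iff[OF T_R T_R, of x i "i + 1"] cnt_T by simp

lemma T_0: "x \<in> \<Omega> \<Longrightarrow> T x 0 \<le> 0"
  using cnt_less[of 0 "T x 0" x] T_R[of x 0] cnt_T[of x 0] cnt_0[of x] by force

lemma T_1: "x \<in> \<Omega> \<Longrightarrow> 0 < T x 1"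
  using cnt_mono[of "T x 1" 0 x] cnt_T[of x 1] cnt_0[of x] by force

lemma T_consec:
  assumes x: "x \<in> \<Omega>"
  shows "consec (R x) (T x i) (T x (i + 1))"
  unfolding consec_def
proof (intro conjI allI impI notI T_R[OF x] T_increasing[OF x])
  fix j assume j: "T x i < j" "j < T x (i + 1)" "R x j"
  show False
    using cnt_less[OF j(1,3)] cnt_less[OF j(2) T_R[OF x]] cnt_T[OF x, of i] cnt_T[OF x, of "i + 1"]
    by linarith
qed

text \<open>A chain of consecutive points of \<open>R x\<close> whose link from \<open>u 0\<close> to
  \<open>u 1\<close> straddles the origin must be the enumeration itself: it agrees with it at index
  \<open>0\<close>, and consecutive points determine each other in both directions.\<close>

lemma T_window_iff:
  assumes x: "x \<in> \<Omega>" and ab: "a \<le> 0" "0 < b" and u: "u 0 \<le> 0" "0 < u 1"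
  shows "(\<forall>i. a \<le> i \<longrightarrow> i \<le> b \<longrightarrow> T x i = u i) \<longleftrightarrow> (\<forall>i. a \<le> i \<longrightarrow> i < b \<longrightarrow> consec (R x) (u i) (u (i + 1)))"
proof
  assume *: "\<forall>i. a \<le> i \<longrightarrow> i \<le> b \<longrightarrow> T x i = u i"
  show "\<forall>i. a \<le> i \<longrightarrow> i < b \<longrightarrow> consec (R x) (u i) (u (i + 1))"
  proof (intro allI impI)
    fix i assume "a \<le> i" "i < b"
    thus "consec (R x) (u i) (u (i + 1))"
      using T_consec[OF x, of i] *[rule_format, of i] *[rule_format, of "i + 1"] by simp
  qed
next
  assume c: "\<forall>i. a \<le> i \<longrightarrow> i < b \<longrightarrow> consec (R x) (u i) (u (i + 1))"
  have c0: "consec (R x) (u 0) (u 1)" using c[rule_format, of 0] ab by simp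
  have t0: "consec (R x) (T x 0) (T x 1)" using T_consec[OF x, of 0] by simp
  have "\<not> u 0 < T x 0"
    using c0 T_R[OF x, of 0] T_0[OF x] u(2) unfolding consec_def by (meson order_le_less_trans)
  moreover have "\<not> T x 0 < u 0"
    using t0 c0 u(1) T_1[OF x] unfolding consec_def by (meson order_le_less_trans)
  ultimately have T0: "T x 0 = u 0" by linarith
  have right: "i \<le> b \<longrightarrow> T x i = u i" if "0 \<le> i" for i
    using that
  proof (induction i rule: int_ge_induct)
    case (step i)
    show ?case
    proof
      assume i: "i + 1 \<le> b"
      hence "T x i = u i" using step.IH by simp
      thus "T x (i + 1) = u (i + 1)"
        using c[rule_format, of i] T_consec[OF x, of i] i step.hyps ab
          consec_unique_right[of "R x" "u i" "T x (i + 1)" "u (i + 1)"] by simp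
    qed
  qed (simp add: T0)
  have left: "a \<le> i \<longrightarrow> T x i = u i" if "i \<le> 0" for i
    using that
  proof (induction i rule: int_le_induct)
    case (step i)
    show ?case
    proof
      assume i: "a \<le> i - 1"
      hence "T x i = u i" using step.IH by simp
      thus "T x (i - 1) = u (i - 1)"
        using c[rule_format, of "i - 1"] T_consec[OF x, of "i - 1"] i step.hyps ab
          consec_unique_left[of "R x" "T x (i - 1)" "u i" "u (i - 1)"] by simp
    qed
  qed (simp add: T0)
  show "\<forall>i. a \<le> i \<longrightarrow> i \<le> b \<longrightarrow> T x i = u i" using left right by (meson linear)
qed

lemma Omega_event: "\<Omega> \<in> events"
proof -
  have "Measurable.pred \<mu> (\<lambda>x. (\<forall>k. \<exists>n\<ge>k. R x n) \<and> (\<forall>k. \<exists>n\<le>k. R x n))" by measurable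
  thus ?thesis unfolding \<Omega>_def by (simp add: pred_def)
qed

lemma AE_Omega: "AE x in \<mu>. x \<in> \<Omega>"
  using R_unbounded unfolding \<Omega>_def by simp

lemma pred_cnt:
  assumes "\<And>j. (1 \<le> j \<and> j \<le> k) \<or> (k + 1 \<le> j \<and> j \<le> 0) \<Longrightarrow> Measurable.pred M (\<lambda>x. R x j)"
  shows "Measurable.pred M (\<lambda>x. cnt x k = i)"
proof (cases "k \<ge> 0")
  case True
  hence "(\<lambda>x. cnt x k = i) = (\<lambda>x. int (card {j \<in> {1..k}. R x j}) = i)" unfolding cnt_def by simp
  also have "Measurable.pred M \<dots>"
    by (rule pred_finite_trace[where P = "\<lambda>S. int (card S) = i"]) (use assms in auto)
  finally show ?thesis .
next
  case False
  hence "(\<lambda>x. cnt x k = i) = (\<lambda>x. - int (card {j \<in> {k + 1..0}. R x j}) = i)" unfolding cnt_def by simp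
  also have "Measurable.pred M \<dots>"
    by (rule pred_finite_trace[where P = "\<lambda>S. - int (card S) = i"]) (use assms in auto)
  finally show ?thesis .
qed

lemma measurable_T_component [measurable]: "(\<lambda>x. T x i) \<in> measurable \<mu> (count_space UNIV)"
proof (rule measurable_count_space_eq2_countable[THEN iffD2], intro conjI ballI)
  fix k
  have [measurable]: "Measurable.pred \<mu> (\<lambda>x. x \<in> \<Omega>)" using Omega_event by (simp add: pred_def)
  have [measurable]: "Measurable.pred \<mu> (\<lambda>x. cnt x k = i)" by (rule pred_cnt) simp
  have "Measurable.pred \<mu> (\<lambda>x. if x \<in> \<Omega> then R x k \<and> cnt x k = i else i = k)" by measurable
  moreover have "(\<lambda>x. if x \<in> \<Omega> then R x k \<and> cnt x k = i else i = k) = (\<lambda>x. T x i = k)"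
    by (rule ext) (use T_iff in \<open>auto simp: T_def\<close>)
  ultimately have "{x. T x i = k} \<in> events" by (simp add: pred_def)
  moreover have "(\<lambda>x. T x i) -` {k} \<inter> space \<mu> = {x. T x i = k}" by auto
  ultimately show "(\<lambda>x. T x i) -` {k} \<inter> space \<mu> \<in> events" by simp
qed auto

lemma measurable_T: "T \<in> measurable \<mu> (PiM UNIV (\<lambda>_. count_space UNIV))"
  by (rule measurable_PiM_single') (auto simp: space_PiM)

subsection \<open>The law of the blocks\<close>

abbreviation B :: "int \<Rightarrow> (int \<Rightarrow> 'a) \<Rightarrow> 'a list" where
  "B i x \<equiv> block (T x) x i"

lemma block_wd: "B i x = wd x (T x i) (T x (i + 1))"
  unfolding block_def wd_def ..

lemma measurable_block [measurable]: "(\<lambda>x. B i x) \<in> measurable \<mu> (count_space UNIV)"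
proof -
  have "(\<lambda>x. wd x a (T x (i + 1))) \<in> measurable \<mu> (count_space UNIV)" for a
    by (rule measurable_compose_countable[where f = "\<lambda>b x. wd x a b" and g = "\<lambda>x. T x (i + 1)"]) simp_all
  hence "(\<lambda>x. wd x (T x i) (T x (i + 1))) \<in> measurable \<mu> (count_space UNIV)"
    by (intro measurable_compose_countable[where f = "\<lambda>a x. wd x a (T x (i + 1))" and g = "\<lambda>x. T x i"]) simp_all
  thus ?thesis unfolding block_wd .
qed

lemma length_block: "x \<in> \<Omega> \<Longrightarrow> int (length (B i x)) = T x (i + 1) - T x i"
  using T_increasing[of x i] unfolding block_wd length_wd by simp

lemma Pr_cong_Omega:
  assumes "{x. P x} \<in> events" "{x. Q x} \<in> events" "\<And>x. x \<in> \<Omega> \<Longrightarrow> P x \<longleftrightarrow> Q x"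
  shows "Pr P = Pr Q"
  by (rule finite_measure_eq_AE) (use AE_Omega assms in \<open>auto elim!: eventually_mono\<close>)

text \<open>On \<open>\<Omega>\<close> the event is a pattern, so the product formula applies. The condition
  \<open>u 0 \<le> 0 < u 1\<close> fixes the numbering.\<close>

lemma block_law:
  assumes ab: "a \<le> 0" "0 < b" and u: "u 0 \<le> 0" "0 < u 1"
  shows "Pr (\<lambda>x. (\<forall>i. a \<le> i \<longrightarrow> i \<le> b \<longrightarrow> T x i = u i) \<and> (\<forall>i. a \<le> i \<longrightarrow> i < b \<longrightarrow> B i x \<in> A i))
    = \<rho> * (\<Prod>i\<in>{a..<b}. cycle_prob (u (i + 1) - u i) (A i))"
proof -
  have m: "Measurable.pred \<mu> (\<lambda>x. B i x \<in> A i)" for i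
    by (rule measurable_compose[OF measurable_block]) simp
  have m': "Measurable.pred \<mu> (\<lambda>x. wd x c d \<in> A i)" for i c d
    by (rule measurable_compose[OF measurable_wd]) simp
  note [measurable] = m m'
  have "Pr (\<lambda>x. (\<forall>i. a \<le> i \<longrightarrow> i \<le> b \<longrightarrow> T x i = u i) \<and> (\<forall>i. a \<le> i \<longrightarrow> i < b \<longrightarrow> B i x \<in> A i))
    = Pr (\<lambda>x. pattern (R x) x u A a b)"
  proof (rule Pr_cong_Omega)
    have "Measurable.pred \<mu> (\<lambda>x. (\<forall>i. a \<le> i \<longrightarrow> i \<le> b \<longrightarrow> T x i = u i) \<and> (\<forall>i. a \<le> i \<longrightarrow> i < b \<longrightarrow> B i x \<in> A i))"
      by measurable
    thus "{x. (\<forall>i. a \<le> i \<longrightarrow> i \<le> b \<longrightarrow> T x i = u i) \<and> (\<forall>i. a \<le> i \<longrightarrow> i < b \<longrightarrow> B i x \<in> A i)} \<in> events"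
      by (simp add: pred_def)
    have "Measurable.pred \<mu> (\<lambda>x. pattern (R x) x u A a b)" unfolding pattern_def consec_def by measurable
    thus "{x. pattern (R x) x u A a b} \<in> events" by (simp add: pred_def)
    fix x assume x: "x \<in> \<Omega>"
    have "pattern (R x) x u A a b \<longleftrightarrow> (\<forall>i. a \<le> i \<longrightarrow> i < b \<longrightarrow> consec (R x) (u i) (u (i + 1)) \<and> wd x (u i) (u (i + 1)) \<in> A i)"
    proof
      assume *: "\<forall>i. a \<le> i \<longrightarrow> i < b \<longrightarrow> consec (R x) (u i) (u (i + 1)) \<and> wd x (u i) (u (i + 1)) \<in> A i"
      have "R x (u b)" using *[rule_format, of "b - 1"] ab unfolding consec_def by simp
      thus "pattern (R x) x u A a b" using * unfolding pattern_def by blast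
    qed (simp add: pattern_def)
    also have "\<dots> \<longleftrightarrow> (\<forall>i. a \<le> i \<longrightarrow> i \<le> b \<longrightarrow> T x i = u i) \<and> (\<forall>i. a \<le> i \<longrightarrow> i < b \<longrightarrow> wd x (u i) (u (i + 1)) \<in> A i)"
      unfolding T_window_iff[OF x ab u] by blast
    also have "\<dots> \<longleftrightarrow> (\<forall>i. a \<le> i \<longrightarrow> i \<le> b \<longrightarrow> T x i = u i) \<and> (\<forall>i. a \<le> i \<longrightarrow> i < b \<longrightarrow> B i x \<in> A i)"
      unfolding block_wd by (intro conj_cong refl all_cong imp_cong) auto
    finally show "(\<forall>i. a \<le> i \<longrightarrow> i \<le> b \<longrightarrow> T x i = u i) \<and> (\<forall>i. a \<le> i \<longrightarrow> i < b \<longrightarrow> B i x \<in> A i)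
      \<longleftrightarrow> pattern (R x) x u A a b" by simp
  qed
  thus ?thesis using cycle_law[of a b u A] ab by simp
qed


text \<open>The law of a cycle, that is, of the word between two consecutive regeneration times.\<close>

definition cycle_weight :: "'a list \<Rightarrow> real" where
  "cycle_weight s = cycle_prob (int (length s)) {s}"

text \<open>The block of index \<open>0\<close> is found by looking at the origin, which favours long blocks: its law
  is the size-biased one.\<close>

definition block_weight :: "int \<Rightarrow> 'a list \<Rightarrow> real" where
  "block_weight i s = (if i = 0 then \<rho> * real (length s) * cycle_weight s else cycle_weight s)"

lemma cycle_prob_nonneg: "cycle_prob d A \<ge> 0"
  unfolding cycle_prob_def using rho_pos by simp

lemma cycle_weight_nonneg: "cycle_weight s \<ge> 0"
  unfolding cycle_weight_def by (rule cycle_prob_nonneg)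

lemma block_weight_nonneg: "block_weight i s \<ge> 0"
  unfolding block_weight_def using cycle_weight_nonneg rho_pos by simp

lemma cycle_prob_singleton: "cycle_prob d {s} = (if int (length s) = d then cycle_weight s else 0)"
proof (cases "int (length s) = d")
  case True
  thus ?thesis by (auto simp: cycle_weight_def)
next
  case False
  have "\<not> (consec (R x) 0 d \<and> wd x 0 d \<in> {s})" for x
    using False length_wd[of x 0 d] unfolding consec_def by auto
  hence "(\<lambda>x. consec (R x) 0 d \<and> wd x 0 d \<in> {s}) = (\<lambda>x. False)" by blast
  thus ?thesis using False unfolding cycle_prob_def by simp
qed

text \<open>The regeneration times that result from \<open>T 0 = t\<close> and the blocks \<open>s\<close>. For
  each \<open>i\<close> one of the two sums is empty.\<close>

definition cuts :: "int \<Rightarrow> (int \<Rightarrow> 'a list) \<Rightarrow> int \<Rightarrow> int" where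
  "cuts t s i = t + (\<Sum>j\<in>{0..<i}. int (length (s j))) - (\<Sum>j\<in>{i..<0}. int (length (s j)))"

lemma cuts_0: "cuts t s 0 = t"
  unfolding cuts_def by simp

lemma cuts_step: "cuts t s (i + 1) = cuts t s i + int (length (s i))"
proof (cases "i \<ge> 0")
  case True
  hence "{0..<i + 1} = insert i {0..<i}" by auto
  thus ?thesis using True unfolding cuts_def by simp
next
  case False
  hence "{i..<0} = insert i {i + 1..<0}" by auto
  thus ?thesis using False unfolding cuts_def by simp
qed

lemma blocks_cuts:
  assumes x: "x \<in> \<Omega>" and ab: "a \<le> 0" "0 < b"
  shows "(\<forall>i. a \<le> i \<longrightarrow> i < b \<longrightarrow> B i x = s i) \<and> T x 0 = t \<longleftrightarrow>
    (\<forall>i. a \<le> i \<longrightarrow> i \<le> b \<longrightarrow> T x i = cuts t s i) \<and> (\<forall>i. a \<le> i \<longrightarrow> i < b \<longrightarrow> B i x \<in> {s i})"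
proof
  assume *: "(\<forall>i. a \<le> i \<longrightarrow> i < b \<longrightarrow> B i x = s i) \<and> T x 0 = t"
  have step: "T x (i + 1) = T x i + int (length (s i))" if "a \<le> i" "i < b" for i
    using length_block[OF x, of i] * that by simp
  have right: "i \<le> b \<longrightarrow> T x i = cuts t s i" if "0 \<le> i" for i
    using that
  proof (induction i rule: int_ge_induct)
    case (step i)
    thus ?case using \<open>\<And>i. a \<le> i \<Longrightarrow> i < b \<Longrightarrow> T x (i + 1) = T x i + int (length (s i))\<close>[of i]
      cuts_step[of t s i] ab by simp
  qed (use * in \<open>simp add: cuts_0\<close>)
  have left: "a \<le> i \<longrightarrow> T x i = cuts t s i" if "i \<le> 0" for i
    using that
  proof (induction i rule: int_le_induct)
    case (step i)
    thus ?case using \<open>\<And>i. a \<le> i \<Longrightarrow> i < b \<Longrightarrow> T x (i + 1) = T x i + int (length (s i))\<close>[of "i - 1"]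
      cuts_step[of t s "i - 1"] ab by simp
  qed (use * in \<open>simp add: cuts_0\<close>)
  have "T x i = cuts t s i" if "a \<le> i" "i \<le> b" for i
    using left[of i] right[of i] that by (cases "i \<ge> 0") auto
  thus "(\<forall>i. a \<le> i \<longrightarrow> i \<le> b \<longrightarrow> T x i = cuts t s i) \<and> (\<forall>i. a \<le> i \<longrightarrow> i < b \<longrightarrow> B i x \<in> {s i})"
    using * by simp
next
  assume *: "(\<forall>i. a \<le> i \<longrightarrow> i \<le> b \<longrightarrow> T x i = cuts t s i) \<and> (\<forall>i. a \<le> i \<longrightarrow> i < b \<longrightarrow> B i x \<in> {s i})"
  thus "(\<forall>i. a \<le> i \<longrightarrow> i < b \<longrightarrow> B i x = s i) \<and> T x 0 = t"
    using ab cuts_0[of t s] by simp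
qed

lemma pred_blocks [measurable]: "Measurable.pred \<mu> (\<lambda>x. B i x = s)"
  by (rule measurable_compose[OF measurable_block]) simp

lemma pred_T [measurable]: "Measurable.pred \<mu> (\<lambda>x. T x i = k)"
  by (rule measurable_compose[OF measurable_T_component]) simp

lemma pred_all_blocks [measurable]: "Measurable.pred \<mu> (\<lambda>x. \<forall>i. Q i \<longrightarrow> B i x = s i)"
  by measurable

lemma pred_all_T [measurable]: "Measurable.pred \<mu> (\<lambda>x. \<forall>i. Q i \<longrightarrow> T x i = s i)"
  by measurable

lemma blocks_and_origin:
  assumes ab: "a \<le> 0" "0 < b" and t: "t \<le> 0" "0 < t + int (length (s 0))"
  shows "Pr (\<lambda>x. (\<forall>i. a \<le> i \<and> i < b \<longrightarrow> B i x = s i) \<and> T x 0 = t) = \<rho> * (\<Prod>i\<in>{a..<b}. cycle_weight (s i))"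
proof -
  have "Pr (\<lambda>x. (\<forall>i. a \<le> i \<and> i < b \<longrightarrow> B i x = s i) \<and> T x 0 = t)
    = Pr (\<lambda>x. (\<forall>i. a \<le> i \<longrightarrow> i \<le> b \<longrightarrow> T x i = cuts t s i) \<and> (\<forall>i. a \<le> i \<longrightarrow> i < b \<longrightarrow> B i x \<in> {s i}))"
  proof (rule Pr_cong_Omega)
    have "Measurable.pred \<mu> (\<lambda>x. (\<forall>i. a \<le> i \<and> i < b \<longrightarrow> B i x = s i) \<and> T x 0 = t)" by measurable
    thus "{x. (\<forall>i. a \<le> i \<and> i < b \<longrightarrow> B i x = s i) \<and> T x 0 = t} \<in> events" by (simp add: pred_def)
    have "Measurable.pred \<mu> (\<lambda>x. (\<forall>i. a \<le> i \<longrightarrow> i \<le> b \<longrightarrow> T x i = cuts t s i) \<and> (\<forall>i. a \<le> i \<longrightarrow> i < b \<longrightarrow> B i x \<in> {s i}))"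
      by (simp only: singleton_iff) measurable
    thus "{x. (\<forall>i. a \<le> i \<longrightarrow> i \<le> b \<longrightarrow> T x i = cuts t s i) \<and> (\<forall>i. a \<le> i \<longrightarrow> i < b \<longrightarrow> B i x \<in> {s i})} \<in> events"
      by (simp add: pred_def)
    fix x assume "x \<in> \<Omega>"
    from blocks_cuts[OF this ab, of s t]
    show "(\<forall>i. a \<le> i \<and> i < b \<longrightarrow> B i x = s i) \<and> T x 0 = t \<longleftrightarrow>
      (\<forall>i. a \<le> i \<longrightarrow> i \<le> b \<longrightarrow> T x i = cuts t s i) \<and> (\<forall>i. a \<le> i \<longrightarrow> i < b \<longrightarrow> B i x \<in> {s i})"
      by (simp only: imp_conjL)
  qed
  also have "\<dots> = \<rho> * (\<Prod>i\<in>{a..<b}. cycle_prob (cuts t s (i + 1) - cuts t s i) {s i})"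
    by (rule block_law[OF ab]) (use t cuts_0[of t s] cuts_step[of t s 0] in auto)
  also have "(\<Prod>i\<in>{a..<b}. cycle_prob (cuts t s (i + 1) - cuts t s i) {s i}) = (\<Prod>i\<in>{a..<b}. cycle_weight (s i))"
    by (simp add: cuts_step cycle_prob_singleton)
  finally show ?thesis .
qed

text \<open>Given the blocks, the position \<open>t\<close> of \<open>T 0\<close> can be any of
  \<open>1 - |s 0|, \<dots>, 0\<close>, and each choice has the same probability.\<close>

lemma blocks_window:
  assumes ab: "a \<le> 0" "0 < b"
  shows "Pr (\<lambda>x. \<forall>i. a \<le> i \<and> i < b \<longrightarrow> B i x = s i) = (\<Prod>i\<in>{a..<b}. block_weight i (s i))"
proof -
  define n where "n = int (length (s 0))"
  define E where "E t = {x. (\<forall>i. a \<le> i \<and> i < b \<longrightarrow> B i x = s i) \<and> T x 0 = t}" for t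
  have E: "E t \<in> events" for t
  proof -
    have "Measurable.pred \<mu> (\<lambda>x. (\<forall>i. a \<le> i \<and> i < b \<longrightarrow> B i x = s i) \<and> T x 0 = t)" by measurable
    thus ?thesis unfolding E_def by (simp add: pred_def)
  qed
  have "Pr (\<lambda>x. \<forall>i. a \<le> i \<and> i < b \<longrightarrow> B i x = s i) = Pr (\<lambda>x. x \<in> (\<Union>t\<in>{1 - n..0}. E t))"
  proof (rule Pr_cong_Omega)
    have "Measurable.pred \<mu> (\<lambda>x. \<forall>i. a \<le> i \<and> i < b \<longrightarrow> B i x = s i)" by measurable
    thus "{x. \<forall>i. a \<le> i \<and> i < b \<longrightarrow> B i x = s i} \<in> events" by (simp add: pred_def)
    have "(\<Union>t\<in>{1 - n..0}. E t) \<in> events" using E by (intro sets.finite_UN) auto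
    thus "{x. x \<in> (\<Union>t\<in>{1 - n..0}. E t)} \<in> events" by (simp only: Collect_mem_eq)
    fix x assume x: "x \<in> \<Omega>"
    have "T x 0 \<in> {1 - n..0}" if "\<forall>i. a \<le> i \<and> i < b \<longrightarrow> B i x = s i"
    proof -
      have "B 0 x = s 0" using that ab by simp
      hence "T x 1 = T x 0 + n" using length_block[OF x, of 0] n_def by simp
      thus ?thesis using T_0[OF x] T_1[OF x] by simp
    qed
    thus "(\<forall>i. a \<le> i \<and> i < b \<longrightarrow> B i x = s i) \<longleftrightarrow> x \<in> (\<Union>t\<in>{1 - n..0}. E t)"
      unfolding E_def by blast
  qed
  also have "\<dots> = measure \<mu> (\<Union>t\<in>{1 - n..0}. E t)" by (simp only: Collect_mem_eq)
  also have "\<dots> = (\<Sum>t\<in>{1 - n..0}. measure \<mu> (E t))"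
    by (rule finite_measure_finite_Union) (use E in \<open>auto simp: disjoint_family_on_def E_def\<close>)
  also have "\<dots> = (\<Sum>t\<in>{1 - n..0}. \<rho> * (\<Prod>i\<in>{a..<b}. cycle_weight (s i)))"
    by (rule sum.cong) (use blocks_and_origin[OF ab] in \<open>auto simp: E_def n_def\<close>)
  also have "\<dots> = \<rho> * real (length (s 0)) * (\<Prod>i\<in>{a..<b}. cycle_weight (s i))"
    unfolding n_def by simp
  also have "\<dots> = (\<Prod>i\<in>{a..<b}. block_weight i (s i))"
  proof -
    have 0: "0 \<in> {a..<b}" using ab by simp
    have "(\<Prod>i\<in>{a..<b} - {0}. block_weight i (s i)) = (\<Prod>i\<in>{a..<b} - {0}. cycle_weight (s i))"
      by (rule prod.cong) (auto simp: block_weight_def)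
    thus ?thesis unfolding prod.remove[OF finite_atLeastLessThan_int 0] by (simp add: block_weight_def)
  qed
  finally show ?thesis .
qed

text \<open>If \<open>0\<close> is a regeneration time then it is \<open>T 0\<close>, and the block of index
  \<open>0\<close> is the cycle that starts there; such a cycle exists almost surely because there are regeneration
  times to the right.\<close>

lemma sum_cycle_weight: "(\<integral>\<^sup>+s. ennreal (cycle_weight s) \<partial>count_space UNIV) = 1"
proof -
  have eq: "Pr (\<lambda>x. R x 0 \<and> B 0 x = s) = \<rho> * cycle_weight s" for s
  proof (cases "s = []")
    case True
    have "Pr (\<lambda>x. R x 0 \<and> B 0 x = s) = Pr (\<lambda>x. False)"
    proof (rule Pr_cong_Omega)
      have "Measurable.pred \<mu> (\<lambda>x. R x 0 \<and> B 0 x = s)" by measurable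
      thus "{x. R x 0 \<and> B 0 x = s} \<in> events" by (simp add: pred_def)
      show "{x. False} \<in> events" by simp
      fix x assume x: "x \<in> \<Omega>"
      show "(R x 0 \<and> B 0 x = s) \<longleftrightarrow> False"
        using length_block[OF x, of 0] T_increasing[OF x, of 0] True by auto
    qed
    moreover have "cycle_weight s = 0" using True unfolding cycle_weight_def cycle_prob_def consec_def by simp
    ultimately show ?thesis by simp
  next
    case False
    have "Pr (\<lambda>x. R x 0 \<and> B 0 x = s) = Pr (\<lambda>x. (\<forall>i. 0 \<le> i \<and> i < 1 \<longrightarrow> B i x = (\<lambda>_. s) i) \<and> T x 0 = 0)"
    proof (rule Pr_cong_Omega)
      have "Measurable.pred \<mu> (\<lambda>x. R x 0 \<and> B 0 x = s)" by measurable
      thus "{x. R x 0 \<and> B 0 x = s} \<in> events" by (simp add: pred_def)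
      have "Measurable.pred \<mu> (\<lambda>x. (\<forall>i. 0 \<le> i \<and> i < 1 \<longrightarrow> B i x = (\<lambda>_. s) i) \<and> T x 0 = 0)" by measurable
      thus "{x. (\<forall>i. 0 \<le> i \<and> i < 1 \<longrightarrow> B i x = (\<lambda>_. s) i) \<and> T x 0 = 0} \<in> events" by (simp add: pred_def)
      fix x assume x: "x \<in> \<Omega>"
      have "(\<forall>i::int. 0 \<le> i \<and> i < 1 \<longrightarrow> B i x = s) \<longleftrightarrow> B 0 x = s"
        by (metis order_refl zero_less_one int_one_le_iff_zero_less not_le order_antisym)
      thus "R x 0 \<and> B 0 x = s \<longleftrightarrow> (\<forall>i. 0 \<le> i \<and> i < 1 \<longrightarrow> B i x = (\<lambda>_. s) i) \<and> T x 0 = 0"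
        using T_iff[OF x, of 0 0] cnt_0[of x] by auto
    qed
    also have "\<dots> = \<rho> * (\<Prod>i\<in>{0..<1::int}. cycle_weight s)"
      by (rule blocks_and_origin) (use False in auto)
    also have "{0..<1::int} = {0}" by auto
    finally show ?thesis by simp
  qed
  have "ennreal \<rho> = (\<integral>\<^sup>+s. ennreal (Pr (\<lambda>x. R x 0 \<and> B 0 x = s)) \<partial>count_space UNIV)"
    using Pr_partition[OF R_event measurable_block, of 0 0] by (simp add: Pr_R)
  also have "\<dots> = (\<integral>\<^sup>+s. ennreal \<rho> * ennreal (cycle_weight s) \<partial>count_space UNIV)"
    unfolding eq using rho_pos by (simp add: ennreal_mult' cycle_weight_nonneg)
  also have "\<dots> = ennreal \<rho> * (\<integral>\<^sup>+s. ennreal (cycle_weight s) \<partial>count_space UNIV)"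
    by (rule nn_integral_cmult) simp
  finally have "ennreal \<rho> * (\<integral>\<^sup>+s. ennreal (cycle_weight s) \<partial>count_space UNIV) = ennreal \<rho> * 1" by simp
  thus ?thesis using rho_pos by (subst (asm) ennreal_mult_cancel_left) auto
qed

lemma block_0_law: "Pr (\<lambda>x. B 0 x = s) = block_weight 0 s"
proof -
  have "(\<forall>i::int. 0 \<le> i \<and> i < 1 \<longrightarrow> B i x = s) \<longleftrightarrow> B 0 x = s" for x
    by (metis order_refl zero_less_one int_one_le_iff_zero_less not_le order_antisym)
  moreover have "{0..<1::int} = {0}" by auto
  ultimately show ?thesis using blocks_window[of 0 1 "\<lambda>_. s"] by simp
qed

text \<open>At index \<open>0\<close> this is the identity \<open>\<rho> E|s| = 1\<close>.\<close>

lemma sum_block_weight: "(\<integral>\<^sup>+s. ennreal (block_weight i s) \<partial>count_space UNIV) = 1"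
proof (cases "i = 0")
  case True
  have "ennreal (Pr (\<lambda>x. True)) = (\<integral>\<^sup>+s. ennreal (Pr (\<lambda>x. True \<and> B 0 x = s)) \<partial>count_space UNIV)"
    by (rule Pr_partition) (use sets.top[of \<mu>] in auto)
  thus ?thesis using prob_space by (simp add: block_0_law True)
qed (simp add: block_weight_def sum_cycle_weight)

text \<open>The law on a window \<open>{- M..M}\<close> is known; summing over the value of one block removes its
  factor, which has total mass \<open>1\<close>.\<close>

lemma blocks_joint_law:
  assumes "finite J"
  shows "Pr (\<lambda>x. \<forall>i. i \<in> J \<longrightarrow> B i x = s i) = (\<Prod>i\<in>J. block_weight i (s i))"
proof -
  have remove: "Pr (\<lambda>x. \<forall>i. i \<in> K \<longrightarrow> B i x = s i) = (\<Prod>i\<in>K. block_weight i (s i))"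
    if K: "finite K" "k \<notin> K"
      and law: "\<And>s. Pr (\<lambda>x. \<forall>i. i \<in> insert k K \<longrightarrow> B i x = s i) = (\<Prod>i\<in>insert k K. block_weight i (s i))" for K k s
  proof -
    have m: "Measurable.pred \<mu> (\<lambda>x. \<forall>i. i \<in> K \<longrightarrow> B i x = s i)" by measurable
    have "Pr (\<lambda>x. (\<forall>i. i \<in> K \<longrightarrow> B i x = s i) \<and> B k x = v) = block_weight k v * (\<Prod>i\<in>K. block_weight i (s i))" for v
    proof -
      have "(\<lambda>x. (\<forall>i. i \<in> K \<longrightarrow> B i x = s i) \<and> B k x = v) = (\<lambda>x. \<forall>i. i \<in> insert k K \<longrightarrow> B i x = (s(k := v)) i)"
        using K(2) by (intro ext) auto
      moreover have "(\<Prod>i\<in>K. block_weight i ((s(k := v)) i)) = (\<Prod>i\<in>K. block_weight i (s i))"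
        by (rule prod.cong) (use K(2) in auto)
      ultimately show ?thesis using law[of "s(k := v)"] K by simp
    qed
    hence "ennreal (Pr (\<lambda>x. \<forall>i. i \<in> K \<longrightarrow> B i x = s i))
      = (\<integral>\<^sup>+v. ennreal (block_weight k v) * ennreal (\<Prod>i\<in>K. block_weight i (s i)) \<partial>count_space UNIV)"
      using Pr_partition[OF _ measurable_block, of "\<lambda>x. \<forall>i. i \<in> K \<longrightarrow> B i x = s i" k] m
      by (simp add: pred_def ennreal_mult' block_weight_nonneg)
    also have "\<dots> = ennreal (\<Prod>i\<in>K. block_weight i (s i))"
      by (subst nn_integral_multc) (simp_all add: sum_block_weight)
    finally show ?thesis using prod_nonneg[of K "\<lambda>i. block_weight i (s i)"] block_weight_nonneg by simp
  qed
  have extend: "(\<forall>s. Pr (\<lambda>x. \<forall>i. i \<in> J \<union> D \<longrightarrow> B i x = s i) = (\<Prod>i\<in>J \<union> D. block_weight i (s i)))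
      \<Longrightarrow> Pr (\<lambda>x. \<forall>i. i \<in> J \<longrightarrow> B i x = s i) = (\<Prod>i\<in>J. block_weight i (s i))" if "finite D" for D s
    using that
  proof (induction D rule: finite_induct)
    case (insert k D)
    show ?case
    proof (cases "k \<in> J \<union> D")
      case True
      hence "J \<union> insert k D = J \<union> D" by auto
      thus ?thesis using insert by simp
    next
      case False
      have "\<forall>s. Pr (\<lambda>x. \<forall>i. i \<in> J \<union> D \<longrightarrow> B i x = s i) = (\<Prod>i\<in>J \<union> D. block_weight i (s i))"
        using remove[of "J \<union> D" k] False insert assms by simp
      thus ?thesis by (rule insert.IH)
    qed
  qed simp
  \<comment> \<open>a symmetric window that contains \<open>J\<close> and the origin\<close>
  define M where "M = Max (insert 0 (abs ` J))"
  have M: "M \<ge> 0" "\<And>i. i \<in> J \<Longrightarrow> \<bar>i\<bar> \<le> M" unfolding M_def using assms by auto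
  have JM: "J \<union> {- M..<M + 1} = {- M..<M + 1}" using M(2) by force
  show ?thesis
  proof (rule extend[of "{- M..<M + 1}"])
    have "i \<in> {- M..<M + 1} \<longleftrightarrow> - M \<le> i \<and> i < M + 1" for i by auto
    thus "\<forall>s. Pr (\<lambda>x. \<forall>i. i \<in> J \<union> {- M..<M + 1} \<longrightarrow> B i x = s i) = (\<Prod>i\<in>J \<union> {- M..<M + 1}. block_weight i (s i))"
      unfolding JM using blocks_window[of "- M" "M + 1"] M(1) by simp
  qed simp
qed

lemma block_law_single: "Pr (\<lambda>x. B i x = s) = block_weight i s"
  using blocks_joint_law[of "{i}" "\<lambda>_. s"] by simp

lemma event_block: "{x. B i x = s} \<in> events"
  using pred_blocks by (simp add: pred_def)

text \<open>The blocks take countably many values, so independence of the events \<open>{B i = s}\<close>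
  suffices.\<close>

lemma indep_blocks: "indep_vars (\<lambda>_. count_space UNIV) (\<lambda>i x. B i x) I"
proof -
  define F where "F i = insert {} (range (\<lambda>s. {x. B i x = s}))" for i
  have F: "F i \<subseteq> events" for i unfolding F_def using event_block by auto
  have "indep_sets F I"
  proof (rule indep_setsI)
    fix A J assume J: "J \<noteq> {}" "J \<subseteq> I" "finite J" "\<forall>j\<in>J. A j \<in> F j"
    show "prob (\<Inter>j\<in>J. A j) = (\<Prod>j\<in>J. prob (A j))"
    proof (cases "\<exists>j\<in>J. A j = {}")
      case True
      hence "(\<Inter>j\<in>J. A j) = {}" by auto
      moreover have "(\<Prod>j\<in>J. prob (A j)) = 0" using True J(3) by (auto intro!: prod_zero bexI)
      ultimately show ?thesis by simp
    next
      case False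
      hence "\<forall>j\<in>J. \<exists>s. A j = {x. B j x = s}" using J(4) unfolding F_def by blast
      then obtain s where s: "\<And>j. j \<in> J \<Longrightarrow> A j = {x. B j x = s j}" by metis
      have "(\<Inter>j\<in>J. A j) = {x. \<forall>j. j \<in> J \<longrightarrow> B j x = s j}" using s by auto
      thus ?thesis using blocks_joint_law[OF J(3), of s] s by (simp add: block_law_single)
    qed
  qed (use F in auto)
  hence "indep_sets (\<lambda>i. sigma_sets (space \<mu>) (F i)) I"
  proof (rule indep_sets_sigma)
    fix i show "Int_stable (F i)"
      unfolding F_def by (rule Int_stableI) auto
  qed
  hence "indep_sets (\<lambda>i. {(\<lambda>x. B i x) -` A \<inter> space \<mu> | A. A \<in> sets (count_space UNIV)}) I"
  proof (rule indep_sets_mono_sets)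
    fix i
    show "{(\<lambda>x. B i x) -` A \<inter> space \<mu> | A. A \<in> sets (count_space UNIV)} \<subseteq> sigma_sets (space \<mu>) (F i)"
    proof clarify
      fix A :: "'a list set"
      interpret S: sigma_algebra "space \<mu>" "sigma_sets (space \<mu>) (F i)"
        by (rule sigma_algebra_sigma_sets) simp
      have "(\<Union>s\<in>A. {x. B i x = s}) \<in> sigma_sets (space \<mu>) (F i)"
        by (rule S.countable_UN') (auto simp: F_def)
      moreover have "(\<lambda>x. B i x) -` A \<inter> space \<mu> = (\<Union>s\<in>A. {x. B i x = s})" by auto
      ultimately show "(\<lambda>x. B i x) -` A \<inter> space \<mu> \<in> sigma_sets (space \<mu>) (F i)" by simp
    qed
  qed
  thus ?thesis unfolding indep_vars_def2 by simp
qed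

lemma distr_block: "distr \<mu> (count_space UNIV) (\<lambda>x. B i x) = density (count_space UNIV) (\<lambda>s. ennreal (block_weight i s))"
proof (rule measure_eqI_countable)
  fix s :: "'a list"
  have "emeasure (distr \<mu> (count_space UNIV) (\<lambda>x. B i x)) {s} = emeasure \<mu> {x. B i x = s}"
    by (subst emeasure_distr) (auto intro!: arg_cong[where f = "emeasure \<mu>"])
  also have "\<dots> = ennreal (block_weight i s)" by (simp add: emeasure_eq_measure block_law_single)
  also have "\<dots> = emeasure (density (count_space UNIV) (\<lambda>s. ennreal (block_weight i s))) {s}"
    by (simp add: emeasure_density)
  finally show "emeasure (distr \<mu> (count_space UNIV) (\<lambda>x. B i x)) {s}
    = emeasure (density (count_space UNIV) (\<lambda>s. ennreal (block_weight i s))) {s}" .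
qed auto

lemma iid_blocks: "iid_off_zero \<mu> (\<lambda>i x. block (T x) x i)"
  unfolding iid_off_zero_def
proof (intro conjI allI impI)
  show "indep_vars (\<lambda>_. count_space UNIV) (\<lambda>i x. block (T x) x i) (- {0})" by (rule indep_blocks)
  fix i j :: int assume "i \<noteq> 0" "j \<noteq> 0"
  thus "distr \<mu> (count_space UNIV) (\<lambda>x. block (T x) x i) = distr \<mu> (count_space UNIV) (\<lambda>x. block (T x) x j)"
    unfolding distr_block by (simp add: block_weight_def)
qed

text \<open>The mean length under the cycle law, multiplied by \<open>\<rho>\<close>, is the total mass of the
  size-biased law of the block around the origin.\<close>

lemma integrable_length_block:
  assumes "i \<noteq> 0"
  shows "integrable \<mu> (\<lambda>x. real (length (block (T x) x i)))"
proof (rule integrableI_nonneg)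
  show "(\<lambda>x. real (length (B i x))) \<in> borel_measurable \<mu>"
    by (rule measurable_compose[OF measurable_block]) simp
  have "ennreal \<rho> * (\<integral>\<^sup>+x. ennreal (real (length (B i x))) \<partial>\<mu>)
    = ennreal \<rho> * (\<integral>\<^sup>+s. ennreal (real (length s)) \<partial>distr \<mu> (count_space UNIV) (\<lambda>x. B i x))"
    by (subst nn_integral_distr) auto
  also have "\<dots> = ennreal \<rho> * (\<integral>\<^sup>+s. ennreal (block_weight i s) * ennreal (real (length s)) \<partial>count_space UNIV)"
    unfolding distr_block by (subst nn_integral_density) auto
  also have "\<dots> = (\<integral>\<^sup>+s. ennreal \<rho> * (ennreal (block_weight i s) * ennreal (real (length s))) \<partial>count_space UNIV)"
    by (rule nn_integral_cmult[symmetric]) simp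
  also have "\<dots> = (\<integral>\<^sup>+s. ennreal (block_weight 0 s) \<partial>count_space UNIV)"
    using assms rho_pos cycle_weight_nonneg by (intro nn_integral_cong) (simp add: block_weight_def ennreal_mult' mult_ac)
  also have "\<dots> = 1" by (rule sum_block_weight)
  finally have "ennreal \<rho> * (\<integral>\<^sup>+x. ennreal (real (length (B i x))) \<partial>\<mu>) = 1" .
  thus "(\<integral>\<^sup>+x. ennreal (real (length (B i x))) \<partial>\<mu>) < \<infinity>"
    using rho_pos by (auto simp: less_top[symmetric] ennreal_mult_top)
qed simp


subsection \<open>The blocks given the times\<close>

lemma cycle_prob_UNIV: "ennreal (cycle_prob d UNIV) = (\<integral>\<^sup>+s. ennreal (cycle_prob d {s}) \<partial>count_space UNIV)"
proof -
  have m: "Measurable.pred \<mu> (\<lambda>x. consec (R x) 0 d)" unfolding consec_def by measurable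
  have "ennreal \<rho> * ennreal (cycle_prob d UNIV) = ennreal (Pr (\<lambda>x. consec (R x) 0 d))"
    using rho_pos by (simp add: cycle_prob_def ennreal_mult'[symmetric])
  also have "\<dots> = (\<integral>\<^sup>+s. ennreal (Pr (\<lambda>x. consec (R x) 0 d \<and> wd x 0 d = s)) \<partial>count_space UNIV)"
    by (rule Pr_partition) (use m in \<open>auto simp: pred_def\<close>)
  also have "\<dots> = (\<integral>\<^sup>+s. ennreal \<rho> * ennreal (cycle_prob d {s}) \<partial>count_space UNIV)"
    using rho_pos by (simp add: cycle_prob_def ennreal_mult'[symmetric])
  also have "\<dots> = ennreal \<rho> * (\<integral>\<^sup>+s. ennreal (cycle_prob d {s}) \<partial>count_space UNIV)"
    by (rule nn_integral_cmult) simp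
  finally show ?thesis using rho_pos by (subst (asm) ennreal_mult_cancel_left) auto
qed

definition cycle_pmf :: "'a list pmf" where "cycle_pmf = embed_pmf cycle_weight"

lemma pmf_cycle_pmf: "pmf cycle_pmf s = cycle_weight s"
  unfolding cycle_pmf_def by (rule pmf_embed_pmf[OF cycle_weight_nonneg sum_cycle_weight])

text \<open>The cycle law conditioned on the length. Lengths of probability \<open>0\<close> get the default value
  \<open>cycle_pmf\<close>, because \<open>cond_pmf\<close> needs an event that meets the support.\<close>

definition length_kernel :: "int \<Rightarrow> 'a list pmf" where
  "length_kernel d = (if set_pmf cycle_pmf \<inter> {s. int (length s) = d} = {} then cycle_pmf else cond_pmf cycle_pmf {s. int (length s) = d})"

lemma cycle_prob_UNIV_pmf: "cycle_prob d UNIV = measure (measure_pmf cycle_pmf) {s. int (length s) = d}"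
proof -
  have "ennreal (cycle_prob d UNIV) = (\<integral>\<^sup>+s. ennreal (cycle_weight s) * indicator {s. int (length s) = d} s \<partial>count_space UNIV)"
    unfolding cycle_prob_UNIV cycle_prob_singleton by (intro nn_integral_cong) (auto simp: indicator_def)
  also have "\<dots> = (\<integral>\<^sup>+s. ennreal (pmf cycle_pmf s) \<partial>count_space {s. int (length s) = d})"
    unfolding pmf_cycle_pmf by (simp add: nn_integral_count_space_indicator)
  also have "\<dots> = ennreal (measure (measure_pmf cycle_pmf) {s. int (length s) = d})"
    by (simp add: nn_integral_pmf measure_pmf.emeasure_eq_measure)
  finally show ?thesis using cycle_prob_nonneg by simp
qed

text \<open>Bayes formula in a form that needs no division: it also covers lengths of probability \<open>0\<close>,
  where both sides vanish.\<close>

lemma length_kernel_cycle_prob: "pmf (length_kernel d) s * cycle_prob d UNIV = cycle_prob d {s}"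
proof (cases "set_pmf cycle_pmf \<inter> {s. int (length s) = d} = {}")
  case True
  hence "cycle_prob d UNIV = 0" unfolding cycle_prob_UNIV_pmf by (simp add: measure_pmf_zero_iff)
  moreover have "cycle_prob d {s} = 0"
  proof -
    have "cycle_weight s = 0" if "int (length s) = d"
    proof -
      have "s \<notin> set_pmf cycle_pmf" using True that by blast
      thus ?thesis by (simp add: set_pmf_iff pmf_cycle_pmf)
    qed
    thus ?thesis unfolding cycle_prob_singleton by simp
  qed
  ultimately show ?thesis by simp
next
  case False
  hence "measure (measure_pmf cycle_pmf) {s. int (length s) = d} \<noteq> 0" by (simp add: measure_pmf_zero_iff)
  thus ?thesis using False unfolding length_kernel_def cycle_prob_UNIV_pmf cycle_prob_singleton by (simp add: pmf_cond[OF False] pmf_cycle_pmf)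
qed

definition block_kernel :: "int set \<Rightarrow> (int \<Rightarrow> 'a list) \<Rightarrow> (int \<Rightarrow> int) \<Rightarrow> real" where
  "block_kernel J s t = (\<Prod>i\<in>J. pmf (length_kernel (t (i + 1) - t i)) (s i))"

lemma measurable_block_kernel: "block_kernel J s \<in> borel_measurable (PiM UNIV (\<lambda>_. count_space UNIV))"
proof -
  have m: "(\<lambda>t. t i) \<in> measurable (PiM UNIV (\<lambda>_. count_space UNIV)) (count_space UNIV)"
    for i :: int
    by (rule measurable_component_singleton) simp
  have "(\<lambda>t. pmf (length_kernel (t (i + 1) - t i)) (s i)) \<in> borel_measurable (PiM UNIV (\<lambda>_. count_space UNIV))" for i
  proof -
    have "(\<lambda>t. pmf (length_kernel (t (i + 1) - c)) (s i)) \<in> borel_measurable (PiM UNIV (\<lambda>_. count_space UNIV))" for c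
      by (rule measurable_compose[OF m[of "i + 1"]]) simp
    thus ?thesis
      by (rule measurable_compose_countable[where f = "\<lambda>c t. pmf (length_kernel (t (i + 1) - c)) (s i)", OF _ m[of i]])
  qed
  thus ?thesis unfolding block_kernel_def by (intro borel_measurable_prod) simp
qed

lemma block_kernel_nonneg: "block_kernel J s t \<ge> 0" and block_kernel_le: "block_kernel J s t \<le> 1"
  unfolding block_kernel_def by (auto intro!: prod_nonneg prod_le_1 simp: pmf_le_1)

lemma measurable_block_kernel_T [measurable]: "(\<lambda>x. block_kernel J s (T x)) \<in> borel_measurable \<mu>"
  by (rule measurable_compose[OF measurable_T measurable_block_kernel])

text \<open>In the product formula, prescribing the word of block \<open>i\<close> replaces the factor
  \<open>cycle_prob d UNIV\<close> by \<open>cycle_prob d {s i}\<close>, which costs exactly the factor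
  \<open>length_kernel d\<close> at \<open>s i\<close>.\<close>

lemma block_law_given_times:
  assumes J: "J \<subseteq> {a..<b}" and ab: "a \<le> 0" "0 < b"
  shows "Pr (\<lambda>x. (\<forall>i. a \<le> i \<and> i \<le> b \<longrightarrow> T x i = u i) \<and> (\<forall>i. i \<in> J \<longrightarrow> B i x = s i))
    = block_kernel J s u * Pr (\<lambda>x. \<forall>i. a \<le> i \<and> i \<le> b \<longrightarrow> T x i = u i)"
proof (cases "u 0 \<le> 0 \<and> 0 < u 1")
  case True
  define A where "A i = (if i \<in> J then {s i} else UNIV)" for i
  have "(\<forall>i. a \<le> i \<longrightarrow> i < b \<longrightarrow> B i x \<in> A i) \<longleftrightarrow> (\<forall>i. i \<in> J \<longrightarrow> B i x = s i)" for x
    using J unfolding A_def by auto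
  hence "Pr (\<lambda>x. (\<forall>i. a \<le> i \<and> i \<le> b \<longrightarrow> T x i = u i) \<and> (\<forall>i. i \<in> J \<longrightarrow> B i x = s i))
    = \<rho> * (\<Prod>i\<in>{a..<b}. cycle_prob (u (i + 1) - u i) (A i))"
    using block_law[OF ab, of u A] True by (simp only: imp_conjL)
  moreover have "Pr (\<lambda>x. \<forall>i. a \<le> i \<and> i \<le> b \<longrightarrow> T x i = u i) = \<rho> * (\<Prod>i\<in>{a..<b}. cycle_prob (u (i + 1) - u i) UNIV)"
    using block_law[OF ab, of u "\<lambda>_. UNIV"] True by (simp add: imp_conjL)
  moreover have "(\<Prod>i\<in>{a..<b}. cycle_prob (u (i + 1) - u i) (A i))
      = block_kernel J s u * (\<Prod>i\<in>{a..<b}. cycle_prob (u (i + 1) - u i) UNIV)"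
  proof -
    have "(\<Prod>i\<in>{a..<b}. cycle_prob (u (i + 1) - u i) (A i))
      = (\<Prod>i\<in>{a..<b}. (if i \<in> J then pmf (length_kernel (u (i + 1) - u i)) (s i) else 1) * cycle_prob (u (i + 1) - u i) UNIV)"
      by (rule prod.cong) (auto simp: A_def length_kernel_cycle_prob)
    also have "\<dots> = (\<Prod>i\<in>{a..<b}. (if i \<in> J then pmf (length_kernel (u (i + 1) - u i)) (s i) else 1)) *
        (\<Prod>i\<in>{a..<b}. cycle_prob (u (i + 1) - u i) UNIV)"
      by (rule prod.distrib)
    also have "(\<Prod>i\<in>{a..<b}. (if i \<in> J then pmf (length_kernel (u (i + 1) - u i)) (s i) else 1)) = block_kernel J s u"
      unfolding block_kernel_def prod.inter_restrict[symmetric, OF finite_atLeastLessThan_int] using J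
      by (simp add: Int_absorb1)
    finally show ?thesis .
  qed
  ultimately show ?thesis by simp
next
  case False
  have e: "{x. \<forall>i. a \<le> i \<and> i \<le> b \<longrightarrow> T x i = u i} \<in> events"
    using pred_all_T[of "\<lambda>i. a \<le> i \<and> i \<le> b" u] by (simp only: pred_def space_mu UNIV_I simp_thms)
  have 0: "Pr (\<lambda>x. \<forall>i. a \<le> i \<and> i \<le> b \<longrightarrow> T x i = u i) = 0"
  proof -
    have "Pr (\<lambda>x. \<forall>i. a \<le> i \<and> i \<le> b \<longrightarrow> T x i = u i) = Pr (\<lambda>x. False)"
    proof (rule Pr_cong_Omega[OF e])
      fix x assume x: "x \<in> \<Omega>"
      show "(\<forall>i. a \<le> i \<and> i \<le> b \<longrightarrow> T x i = u i) \<longleftrightarrow> False"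
      proof
        assume *: "\<forall>i. a \<le> i \<and> i \<le> b \<longrightarrow> T x i = u i"
        have "T x 0 = u 0" "T x 1 = u 1" using * ab by auto
        thus False using False T_0[OF x] T_1[OF x] by simp
      qed simp
    qed simp
    thus ?thesis by simp
  qed
  moreover have "Pr (\<lambda>x. (\<forall>i. a \<le> i \<and> i \<le> b \<longrightarrow> T x i = u i) \<and> (\<forall>i. i \<in> J \<longrightarrow> B i x = s i))
      \<le> Pr (\<lambda>x. \<forall>i. a \<le> i \<and> i \<le> b \<longrightarrow> T x i = u i)"
    by (rule finite_measure_mono[OF _ e]) auto
  ultimately show ?thesis using measure_nonneg[of \<mu>] by (simp add: measure_le_0_iff)
qed

text \<open>Both sides are finite measures in \<open>D\<close>. They agree when \<open>D\<close> prescribes the times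
  on a window that contains \<open>J\<close>, hence for all window events of the sequence of times, and these form a
  generator that is stable under intersections.\<close>

lemma block_kernel_disintegrates:
  assumes J: "finite J" and D: "D \<in> sets (PiM UNIV (\<lambda>_. count_space UNIV))"
  shows "Pr (\<lambda>x. T x \<in> D \<and> (\<forall>i. i \<in> J \<longrightarrow> B i x = s i)) = (\<integral>x. indicator D (T x) * block_kernel J s (T x) \<partial>\<mu>)"
proof -
  define E where "E = {x. \<forall>i. i \<in> J \<longrightarrow> B i x = s i}"
  have E: "E \<in> events" using pred_all_blocks[of "\<lambda>i. i \<in> J" s] unfolding E_def by (simp add: pred_def)
  define \<nu>\<^sub>1 where "\<nu>\<^sub>1 = density \<mu> (indicator E)"
  define \<nu>\<^sub>2 where "\<nu>\<^sub>2 = density \<mu> (\<lambda>x. ennreal (block_kernel J s (T x)))"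
  have [measurable_cong]: "sets \<nu>\<^sub>1 = sets \<mu>" "sets \<nu>\<^sub>2 = sets \<mu>" unfolding \<nu>\<^sub>1_def \<nu>\<^sub>2_def by simp_all
  have sp: "space \<nu>\<^sub>1 = UNIV" "space \<nu>\<^sub>2 = UNIV" unfolding \<nu>\<^sub>1_def \<nu>\<^sub>2_def by simp_all
  let ?P = "seq_space :: (int \<Rightarrow> int) measure"
  have T1: "T \<in> measurable \<nu>\<^sub>1 ?P" "T \<in> measurable \<nu>\<^sub>2 ?P"
    using measurable_T unfolding \<nu>\<^sub>1_def \<nu>\<^sub>2_def seq_space_def by simp_all
  have push: "emeasure (distr \<nu>\<^sub>1 ?P T) X = emeasure \<nu>\<^sub>1 (T -` X)"
    "emeasure (distr \<nu>\<^sub>2 ?P T) X = emeasure \<nu>\<^sub>2 (T -` X)" if "X \<in> sets ?P" for X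
    using emeasure_distr[OF T1(1) that] emeasure_distr[OF T1(2) that] by (simp_all only: sp Int_UNIV_right)
  have window_agree: "emeasure \<nu>\<^sub>1 (T -` {t. P t}) = emeasure \<nu>\<^sub>2 (T -` {t. P t})"
    if P: "window a b P" for a b P
  proof -
    define M where "M = Max (insert 0 (abs ` (insert a (insert b J))))"
    have fin: "finite (insert 0 (abs ` (insert a (insert b J))))" using J by simp
    have M: "0 \<le> M" "\<bar>a\<bar> \<le> M" "\<bar>b\<bar> \<le> M" "\<And>i. i \<in> J \<Longrightarrow> \<bar>i\<bar> \<le> M"
      unfolding M_def by (rule Max_ge[OF fin]; simp)+
    have JM: "J \<subseteq> {- M..<M + 1}" using M(4) by force
    \<comment> \<open>the word \<open>T (- M), \<dots>, T (M + 1)\<close> contains both ends of every block with index in \<open>{- M..M}\<close>\<close>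
    define V where "V x = wd (T x) (- M) (M + 2)" for x
    have V[measurable]: "V \<in> measurable \<mu> (count_space UNIV)"
    proof -
      have "(\<lambda>t. wd t (- M) (M + 2)) \<in> measurable ?P (count_space UNIV)"
        unfolding wd_def by (rule measurable_map_word) simp
      from measurable_compose[OF measurable_T[folded seq_space_def] this]
      show ?thesis unfolding V_def .
    qed
    have V': "V \<in> measurable \<nu>\<^sub>1 (count_space UNIV)" "V \<in> measurable \<nu>\<^sub>2 (count_space UNIV)"
      using V unfolding \<nu>\<^sub>1_def \<nu>\<^sub>2_def by simp_all
    have point: "emeasure \<nu>\<^sub>1 (V -` {v}) = emeasure \<nu>\<^sub>2 (V -` {v})" for v
    proof (cases "\<exists>x. V x = v")
      case True
      then obtain y where y: "V y = v" by blast
      define u where "u = T y"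
      have Vu: "V x = v \<longleftrightarrow> (\<forall>i. - M \<le> i \<and> i \<le> M + 1 \<longrightarrow> T x i = u i)" for x
        unfolding y[symmetric] V_def wd_eq_iff u_def by (auto simp: imp_conjL)
      have e: "V -` {v} \<in> events" using measurable_sets[OF V, of "{v}"] by simp
      have hu: "block_kernel J s (T x) = block_kernel J s u" if "V x = v" for x
        unfolding block_kernel_def
      proof (rule prod.cong[OF refl])
        fix i assume "i \<in> J"
        hence "- M \<le> i" "i \<le> M" using JM by auto
        thus "pmf (length_kernel (T x (i + 1) - T x i)) (s i) = pmf (length_kernel (u (i + 1) - u i)) (s i)"
          using that unfolding Vu by simp
      qed
      have "emeasure \<nu>\<^sub>1 (V -` {v}) = emeasure \<mu> (E \<inter> V -` {v})"
        unfolding \<nu>\<^sub>1_def using e E by (subst emeasure_density) (auto simp flip: indicator_inter_arith)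
      also have "\<dots> = ennreal (Pr (\<lambda>x. (\<forall>i. - M \<le> i \<and> i \<le> M + 1 \<longrightarrow> T x i = u i) \<and> (\<forall>i. i \<in> J \<longrightarrow> B i x = s i)))"
      proof -
        have "E \<inter> V -` {v} = {x. (\<forall>i. - M \<le> i \<and> i \<le> M + 1 \<longrightarrow> T x i = u i) \<and> (\<forall>i. i \<in> J \<longrightarrow> B i x = s i)}"
          unfolding E_def vimage_def singleton_iff Vu by blast
        thus ?thesis by (simp only: emeasure_eq_measure)
      qed
      also have "\<dots> = ennreal (block_kernel J s u * Pr (\<lambda>x. \<forall>i. - M \<le> i \<and> i \<le> M + 1 \<longrightarrow> T x i = u i))"
        by (subst block_law_given_times[OF JM]) (use M(1) in auto)
      also have "\<dots> = ennreal (block_kernel J s u) * emeasure \<mu> (V -` {v})"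
      proof -
        have "V -` {v} = {x. \<forall>i. - M \<le> i \<and> i \<le> M + 1 \<longrightarrow> T x i = u i}"
          unfolding vimage_def singleton_iff Vu ..
        thus ?thesis by (simp only: emeasure_eq_measure ennreal_mult'[OF measure_nonneg] ennreal_mult block_kernel_nonneg measure_nonneg)
      qed
      also have "\<dots> = (\<integral>\<^sup>+x. ennreal (block_kernel J s u) * indicator (V -` {v}) x \<partial>\<mu>)"
        using e by (simp add: nn_integral_cmult_indicator)
      also have "\<dots> = (\<integral>\<^sup>+x. ennreal (block_kernel J s (T x)) * indicator (V -` {v}) x \<partial>\<mu>)"
        by (intro nn_integral_cong) (auto simp: indicator_def hu)
      also have "\<dots> = emeasure \<nu>\<^sub>2 (V -` {v})"
        unfolding \<nu>\<^sub>2_def using e by (subst emeasure_density) auto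
      finally show ?thesis .
    next
      case False
      hence "V -` {v} = {}" by auto
      thus ?thesis by simp
    qed
    have "distr \<nu>\<^sub>1 (count_space UNIV) V = distr \<nu>\<^sub>2 (count_space UNIV) V"
    proof (rule measure_eqI_countable)
      fix v
      show "emeasure (distr \<nu>\<^sub>1 (count_space UNIV) V) {v} = emeasure (distr \<nu>\<^sub>2 (count_space UNIV) V) {v}"
        using point[of v] by (simp add: emeasure_distr V' sp)
    qed auto
    moreover have "T -` {t. P t} = V -` (V ` {x. P (T x)})"
    proof -
      have "P (T x)" if "P (T y)" "V x = V y" for x y
      proof -
        have "T x i = T y i" if "a \<le> i" "i < b" for i
          using \<open>V x = V y\<close> that M unfolding V_def wd_eq_iff by force
        thus ?thesis using windowD[OF P] that(1) by blast
      qed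
      thus ?thesis by (auto simp: image_iff)
    qed
    ultimately show ?thesis
      using emeasure_distr[OF V'(1), of "V ` {x. P (T x)}"] emeasure_distr[OF V'(2), of "V ` {x. P (T x)}"]
      by (simp add: sp)
  qed
  have "distr \<nu>\<^sub>1 ?P T = distr \<nu>\<^sub>2 ?P T"
  proof (rule measure_eqI_generator_eq[OF Int_stable_window_sets, where A = "\<lambda>_. UNIV"])
    fix X :: "(int \<Rightarrow> int) set" assume "X \<in> window_sets"
    then obtain P a b where X: "X = {t. P t}" "window a b P" unfolding window_sets_def by blast
    have "X \<in> sets ?P" using \<open>X \<in> window_sets\<close> sets_seq_space_window by blast
    from push[OF this] window_agree[OF X(2)]
    show "emeasure (distr \<nu>\<^sub>1 ?P T) X = emeasure (distr \<nu>\<^sub>2 ?P T) X"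
      by (simp only: X(1))
  next
    show "range (\<lambda>_::nat. UNIV) \<subseteq> (window_sets :: (int \<Rightarrow> int) set set)"
    proof -
      have "(UNIV :: (int \<Rightarrow> int) set) \<in> window_sets"
        unfolding window_sets_def mem_Collect_eq by (rule exI[of _ "\<lambda>_. True"]) (simp add: window_True)
      thus ?thesis by blast
    qed
    have "emeasure \<nu>\<^sub>1 UNIV \<le> 1"
      unfolding \<nu>\<^sub>1_def using E sets.top[of \<mu>]
      by (subst emeasure_density) (auto simp: measure_le_1 emeasure_eq_measure)
    moreover have "UNIV \<in> sets ?P" using sets.top[of ?P] by simp
    ultimately show "emeasure (distr \<nu>\<^sub>1 ?P T) UNIV \<noteq> \<infinity>"
      using push(1)[of UNIV] by (auto simp: top_unique)
  qed (auto simp: sets_seq_space_window)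
  hence eq: "emeasure (distr \<nu>\<^sub>1 ?P T) D = emeasure (distr \<nu>\<^sub>2 ?P T) D" by simp
  have D': "D \<in> sets ?P" using D unfolding seq_space_def .
  have TD: "T -` D \<in> events" using measurable_sets[OF measurable_T D] by simp
  have "emeasure (distr \<nu>\<^sub>1 ?P T) D = emeasure \<nu>\<^sub>1 (T -` D)"
    by (rule push(1)[OF D'])
  also have "\<dots> = emeasure \<mu> (E \<inter> T -` D)"
    unfolding \<nu>\<^sub>1_def using TD E by (subst emeasure_density) (auto simp flip: indicator_inter_arith)
  also have "E \<inter> T -` D = {x. T x \<in> D \<and> (\<forall>i. i \<in> J \<longrightarrow> B i x = s i)}" unfolding E_def by auto
  finally have 1: "emeasure (distr \<nu>\<^sub>1 ?P T) D = ennreal (Pr (\<lambda>x. T x \<in> D \<and> (\<forall>i. i \<in> J \<longrightarrow> B i x = s i)))"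
    by (simp add: emeasure_eq_measure)
  have "emeasure (distr \<nu>\<^sub>2 ?P T) D = emeasure \<nu>\<^sub>2 (T -` D)"
    by (rule push(2)[OF D'])
  also have "\<dots> = (\<integral>\<^sup>+x. ennreal (block_kernel J s (T x)) * indicator (T -` D) x \<partial>\<mu>)"
    unfolding \<nu>\<^sub>2_def using TD by (subst emeasure_density) auto
  also have "\<dots> = (\<integral>\<^sup>+x. ennreal (indicator D (T x) * block_kernel J s (T x)) \<partial>\<mu>)"
    by (intro nn_integral_cong) (auto simp: indicator_def)
  finally have 2: "emeasure (distr \<nu>\<^sub>2 ?P T) D = (\<integral>\<^sup>+x. ennreal (indicator D (T x) * block_kernel J s (T x)) \<partial>\<mu>)" .
  have ind: "(\<lambda>x. indicator D (T x) :: real) \<in> borel_measurable \<mu>"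
    by (rule measurable_compose[OF measurable_T borel_measurable_indicator[OF D]])
  have "(\<integral>x. indicator D (T x) * block_kernel J s (T x) \<partial>\<mu>)
    = enn2real (\<integral>\<^sup>+x. ennreal (indicator D (T x) * block_kernel J s (T x)) \<partial>\<mu>)"
    by (rule integral_eq_nn_integral) (use ind in \<open>auto simp: block_kernel_nonneg\<close>)
  thus ?thesis unfolding 2[symmetric] eq[symmetric] 1 by simp
qed

lemma cond_iid_blocks: "cond_iid_off_zero \<mu> T"
  unfolding cond_iid_off_zero_def
proof (intro exI[of _ length_kernel] allI impI)
  fix J :: "int set" and s :: "int \<Rightarrow> 'a list"
  assume J: "finite J" "0 \<notin> J"
  let ?P = "PiM UNIV (\<lambda>_. count_space UNIV) :: (int \<Rightarrow> int) measure"
  let ?G = "vimage_algebra UNIV T ?P"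
  let ?E = "{y. \<forall>i\<in>J. block (T y) y i = s i}"
  have setsG: "sets ?G = {T -` A \<inter> UNIV | A. A \<in> sets ?P}"
    by (rule sets_vimage_algebra2) (simp add: space_PiM)
  have "subalgebra \<mu> ?G" unfolding subalgebra_def
    using measurable_sets[OF measurable_T] by (auto simp: setsG)
  hence "finite_measure_subalgebra \<mu> ?G" by unfold_locales
  then interpret G: sigma_finite_subalgebra \<mu> ?G
    by (rule finite_measure_subalgebra_is_sigma_finite)
  have E: "?E \<in> events" using pred_all_blocks[of "\<lambda>i. i \<in> J" s] by (simp add: pred_def Ball_def)
  have intE: "integrable \<mu> (indicator ?E :: _ \<Rightarrow> real)"
    by (rule integrable_real_indicator) (use E in \<open>auto simp: less_top[symmetric]\<close>)
  have "AE x in \<mu>. real_cond_exp \<mu> ?G (indicator ?E) x = block_kernel J s (T x)"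
  proof (rule G.real_cond_exp_charact[OF _ intE])
    show "integrable \<mu> (\<lambda>x. block_kernel J s (T x))"
      by (rule integrable_const_bound[of _ 1]) (auto simp: block_kernel_nonneg block_kernel_le)
    have "T \<in> measurable ?G ?P" by (rule measurable_vimage_algebra1) (simp add: space_PiM)
    from measurable_compose[OF this measurable_block_kernel] show "(\<lambda>x. block_kernel J s (T x)) \<in> borel_measurable ?G" .
    fix A assume "A \<in> sets ?G"
    then obtain D where A: "A = T -` D" and D: "D \<in> sets ?P" using setsG by auto
    have D': "D \<in> sets ?P" using D unfolding seq_space_def .
  have TD: "T -` D \<in> events" using measurable_sets[OF measurable_T D] by simp
    have "(\<integral>x\<in>A. indicator ?E x \<partial>\<mu>) = (\<integral>x. indicator {x. T x \<in> D \<and> (\<forall>i. i \<in> J \<longrightarrow> B i x = s i)} x \<partial>\<mu>)"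
      unfolding set_lebesgue_integral_def A
      by (intro Bochner_Integration.integral_cong) (auto simp: indicator_def)
    also have "\<dots> = Pr (\<lambda>x. T x \<in> D \<and> (\<forall>i. i \<in> J \<longrightarrow> B i x = s i))" by simp
    also have "\<dots> = (\<integral>x. indicator D (T x) * block_kernel J s (T x) \<partial>\<mu>)"
      by (rule block_kernel_disintegrates[OF J(1) D])
    also have "\<dots> = (\<integral>x\<in>A. block_kernel J s (T x) \<partial>\<mu>)"
      unfolding set_lebesgue_integral_def A
      by (intro Bochner_Integration.integral_cong) (auto simp: indicator_def)
    finally show "(\<integral>x\<in>A. indicator ?E x \<partial>\<mu>) = (\<integral>x\<in>A. block_kernel J s (T x) \<partial>\<mu>)" .
  qed
  thus "AE x in \<mu>. real_cond_exp \<mu> ?G (indicator ?E) x = (\<Prod>i\<in>J. pmf (length_kernel (T x (i + 1) - T x i)) (s i))"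
    unfolding block_kernel_def .
qed

subsection \<open>The times are determined by the future\<close>

lemma R_coord:
  assumes "{k..} \<subseteq> I"
  shows "Measurable.pred (coord_algebra \<Omega>' I) (\<lambda>x. R x k)"
  by (rule R_pred) (rule measurable_coord_algebra, use assms in auto)

lemma T_range_coord: "{x \<in> \<Omega>. \<exists>i. T x i = k} \<in> sets (coord_algebra \<Omega> {k..})"
proof -
  have "{x \<in> \<Omega>. \<exists>i. T x i = k} = {x \<in> space (coord_algebra \<Omega> {k..}). R x k}"
    using T_iff by auto
  thus ?thesis using R_coord[of k "{k..}" \<Omega>] by (simp only: pred_def order_refl)
qed

text \<open>The event \<open>T x i = k\<close> says that \<open>k\<close> is a regeneration time of index
  \<open>i\<close>, and the index of \<open>k\<close> counts regeneration times between \<open>k\<close> and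
  \<open>0\<close>, or between \<open>1\<close> and \<open>k\<close>.\<close>

lemma T_coord:
  assumes "{min k 1..} \<subseteq> I"
  shows "{x \<in> \<Omega>. T x i = k} \<in> sets (coord_algebra \<Omega> I)"
proof -
  have k: "{k..} \<subseteq> I" using assms by auto
  have [measurable]: "Measurable.pred (coord_algebra \<Omega> I) (\<lambda>x. cnt x k = i)"
    by (rule pred_cnt, rule R_coord) (use assms in auto)
  have [measurable]: "Measurable.pred (coord_algebra \<Omega> I) (\<lambda>x. R x k)" by (rule R_coord[OF k])
  have "Measurable.pred (coord_algebra \<Omega> I) (\<lambda>x. R x k \<and> cnt x k = i)" by measurable
  moreover have "{x \<in> \<Omega>. T x i = k} = {x \<in> space (coord_algebra \<Omega> I). R x k \<and> cnt x k = i}"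
    using T_iff by auto
  ultimately show ?thesis by (simp only: pred_def)
qed

text \<open>Only \<open>k \<le> 0\<close> can have a non-positive index.\<close>

lemma T_coord_nonpos:
  assumes "i \<le> 0"
  shows "{x \<in> \<Omega>. T x i = k} \<in> sets (coord_algebra \<Omega> {k..})"
proof (cases "k \<le> 0")
  case True
  thus ?thesis by (intro T_coord) auto
next
  case False
  have "T x i \<noteq> k" if "x \<in> \<Omega>" for x
    using T_iff[OF that, of i k] cnt_less[of 0 k x] cnt_0[of x] False assms by auto
  hence "{x \<in> \<Omega>. T x i = k} = {}" by auto
  thus ?thesis by (simp only: sets.empty_sets)
qed

text \<open>Only \<open>k \<ge> 1\<close> can have a positive index.\<close>

lemma T_coord_pos:
  assumes "1 \<le> i"
  shows "{x \<in> \<Omega>. T x i = k} \<in> sets (coord_algebra \<Omega> {1..})"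
proof (cases "k \<ge> 1")
  case True
  thus ?thesis by (intro T_coord) auto
next
  case False
  have "T x i \<noteq> k" if "x \<in> \<Omega>" for x
    using T_iff[OF that, of i k] cnt_mono[of k 0 x] cnt_0[of x] False assms by auto
  hence "{x \<in> \<Omega>. T x i = k} = {}" by auto
  thus ?thesis by (simp only: sets.empty_sets)
qed

end

section \<open>Chains with a reference string\<close>

definition past_at :: "(int \<Rightarrow> 'a) \<Rightarrow> int \<Rightarrow> nat \<Rightarrow> 'a" where
  "past_at x n j = x (n - int j - 1)"

text \<open>Of two suffixes of the same past the shorter is a suffix of the longer.\<close>

lemma suffix_unique:
  assumes "context_tree \<tau>" "v \<in> \<tau>" "v' \<in> \<tau>" "is_suffix v (Past u)" "is_suffix v' (Past u)"
  shows "v = v'"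
proof -
  have *: "s = t" if "s \<in> \<tau>" "t \<in> \<tau>" "is_suffix s (Past u)" "is_suffix t (Past u)" "slen s \<le> slen t" for s t
  proof -
    have "is_suffix s t"
      using that unfolding is_suffix_def by (metis order_less_le_trans)
    thus ?thesis using assms(1) that unfolding context_tree_def is_tree_def by blast
  qed
  show ?thesis using *[of v v'] *[of v' v] assms linear by metis
qed

lemma ctx_suffix:
  assumes "context_tree \<tau>"
  shows "ctx \<tau> u \<in> \<tau> \<and> is_suffix (ctx \<tau> u) (Past u)"
proof -
  obtain v where v: "v \<in> \<tau>" "is_suffix v (Past u)"
    using assms unfolding context_tree_def by blast
  show ?thesis unfolding ctx_def
    by (rule theI[of _ v]) (use v suffix_unique[OF assms] in blast)+
qed

lemma ctx_eqI:
  assumes "context_tree \<tau>" "v \<in> \<tau>" "is_suffix v (Past u)"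
  shows "ctx \<tau> u = v"
  using ctx_suffix[OF assms(1)] suffix_unique[OF assms(1)] assms by blast

locale reference_chain = stationary_law \<mu>
  for \<mu> :: "(int \<Rightarrow> 'a :: countable) measure" +
  fixes \<tau> :: "'a strg set" and p :: "'a strg \<Rightarrow> 'a pmf" and \<epsilon> :: real
    and w :: "'a list" and lw :: "nat \<Rightarrow> nat"
  assumes tree: "context_tree \<tau>"
    and eps: "0 < \<epsilon>" "\<epsilon> < 1"
    and ref: "reference_string \<tau> w lw"
    and reg: "regular_string \<tau> p \<epsilon> w"
    and lim: "limsup (\<lambda>k. elog (lw k) / ereal (C_const \<epsilon> w * real k)) < 1"
    and comp: "compatible \<mu> \<tau> p"
begin

abbreviation l :: nat where "l \<equiv> length w"

definition occ :: "(int \<Rightarrow> 'a) \<Rightarrow> int \<Rightarrow> bool" where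
  "occ x i \<longleftrightarrow> (\<forall>j<l. x (i + int j) = w ! j)"

text \<open>The last copy of \<open>w\<close> that is completed by time \<open>n\<close> ends \<open>m\<close> places
  before \<open>n\<close>.\<close>

definition lastocc :: "(int \<Rightarrow> 'a) \<Rightarrow> int \<Rightarrow> nat \<Rightarrow> bool" where
  "lastocc x n m \<longleftrightarrow> occ x (n - int l - int m) \<and> (\<forall>m'<m. \<not> occ x (n - int l - int m'))"

lemma l_pos: "0 < l"
  using ref unfolding reference_string_def by simp

lemma window_occ: "a \<le> i \<Longrightarrow> i + int l \<le> b \<Longrightarrow> window a b (\<lambda>x. occ x i)"
  unfolding occ_def by (rule windowI) auto

lemma window_lastocc: "a \<le> n - int l - int m \<Longrightarrow> n \<le> b \<Longrightarrow> window a b (\<lambda>x. lastocc x n m)"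
  unfolding lastocc_def
  by (intro window_conj window_all window_imp window_not window_occ) auto

lemma occ_shift: "occ (\<lambda>n. x (n + c)) i \<longleftrightarrow> occ x (i + c)"
  unfolding occ_def by (simp add: ac_simps)

lemma lastocc_shift: "lastocc (\<lambda>n. x (n + c)) i m \<longleftrightarrow> lastocc x (i + c) m"
  unfolding lastocc_def occ_shift by (simp add: algebra_simps)

lemma lastocc_unique: "lastocc x n m \<Longrightarrow> lastocc x n m' \<Longrightarrow> m = m'"
  unfolding lastocc_def by (metis linorder_neqE_nat)

lemma occ_past_at:
  "(\<forall>i<l. past_at x n (j + i) = sym_at (Fin w) i) \<longleftrightarrow> occ x (n - int l - int j)" (is "?A \<longleftrightarrow> ?B")
proof
  assume A: ?A
  show ?B unfolding occ_def
  proof (intro allI impI)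
    fix i assume "i < l"
    thus "x (n - int l - int j + int i) = w ! i"
      using A[rule_format, of "l - 1 - i"] by (simp add: past_at_def rev_nth of_nat_diff algebra_simps)
  qed
next
  assume B: ?B
  show ?A
  proof (intro allI impI)
    fix i assume "i < l"
    thus "past_at x n (j + i) = sym_at (Fin w) i"
      using B[unfolded occ_def, rule_format, of "l - 1 - i"]
      by (simp add: past_at_def rev_nth of_nat_diff algebra_simps)
  qed
qed

text \<open>The context contains the last copy of \<open>w\<close> of the past. If it did not contain any copy, it
  would be infinite and hence be the whole past; if it contained an earlier one, it would also reach the last
  one.\<close>

lemma slen_ctx:
  assumes lo: "lastocc x n m"
  shows "slen (ctx \<tau> (past_at x n)) = enat (m + l + lw m)"
proof -
  define v where "v = ctx \<tau> (past_at x n)"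
  have v: "v \<in> \<tau>" "is_suffix v (Past (past_at x n))"
    using ctx_suffix[OF tree] v_def by auto
  define S where "S = {enat j | j. enat (j + l) \<le> slen v \<and> (\<forall>i<l. sym_at v (j + i) = sym_at (Fin w) i)}"
  have S: "enat j \<in> S \<longleftrightarrow> enat (j + l) \<le> slen v \<and> occ x (n - int l - int j)" for j
  proof (cases "enat (j + l) \<le> slen v")
    case True
    have "sym_at v (j + i) = past_at x n (j + i)" if "i < l" for i
    proof -
      have "enat (j + i) < slen v" using True that by (metis enat_ord_simps(2) nat_add_left_cancel_less order_less_le_trans)
      thus ?thesis using v(2) unfolding is_suffix_def by simp
    qed
    thus ?thesis unfolding S_def occ_past_at[symmetric] using True by auto
  qed (auto simp: S_def)
  have Inf: "last_occ w v = Inf S" unfolding last_occ_def S_def ..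
  have sl: "slen v = (case last_occ w v of enat m \<Rightarrow> enat (m + l + lw m) | \<infinity> \<Rightarrow> \<infinity>)"
    using ref v(1) unfolding reference_string_def by blast
  have occm: "occ x (n - int l - int m)" and nocc: "\<And>m'. m' < m \<Longrightarrow> \<not> occ x (n - int l - int m')"
    using lo unfolding lastocc_def by auto
  have "last_occ w v = enat m"
  proof (cases "last_occ w v")
    case infinity
    hence "enat m \<in> S" using sl S occm by simp
    hence "Inf S \<le> enat m" by (rule Inf_lower)
    thus ?thesis using infinity Inf by simp
  next
    case (enat m0)
    hence "S \<noteq> {}" using Inf by (auto simp: top_enat_def)
    hence "enat m0 \<in> S" using Inf enat by (metis all_not_in_conv wellorder_InfI)
    hence m0: "enat (m0 + l) \<le> slen v" "occ x (n - int l - int m0)" using S by auto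
    hence "m \<le> m0" using nocc by (meson not_le)
    hence "enat (m + l) \<le> slen v" using m0(1) by (meson add_le_mono1 enat_ord_simps(1) order_trans)
    hence "enat m \<in> S" using S occm by simp
    hence "Inf S \<le> enat m" by (rule Inf_lower)
    thus ?thesis using enat Inf \<open>m \<le> m0\<close> by simp
  qed
  thus ?thesis using sl v_def by simp
qed

text \<open>The old context is still a suffix of the new past, and contexts are unique.\<close>

lemma ctx_cong:
  assumes lo: "lastocc x n m"
    and eq: "\<And>i. n - int (m + l + lw m) \<le> i \<Longrightarrow> i < n \<Longrightarrow> x i = y i"
  shows "ctx \<tau> (past_at y n) = ctx \<tau> (past_at x n)"
proof (rule ctx_eqI[OF tree])
  let ?v = "ctx \<tau> (past_at x n)"
  have v: "?v \<in> \<tau>" "is_suffix ?v (Past (past_at x n))" using ctx_suffix[OF tree] by auto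
  show "?v \<in> \<tau>" by (rule v)
  have "past_at y n j = past_at x n j" if "j < m + l + lw m" for j
    unfolding past_at_def by (rule eq[symmetric]) (use that in auto)
  thus "is_suffix ?v (Past (past_at y n))"
    using v(2) slen_ctx[OF lo] unfolding is_suffix_def by simp
qed

section \<open>One-step transitions\<close>

lemma subalgebra_coord: "subalgebra \<mu> (coord_algebra UNIV I)"
proof -
  have m: "(\<lambda>x. restrict x I) \<in> measurable \<mu> (PiM I (\<lambda>_. count_space UNIV))"
    by (rule measurable_restrict) simp
  have "sets (coord_algebra UNIV I) \<subseteq> sets \<mu>"
    unfolding coord_algebra_def
    by (subst sets_vimage_algebra2) (use measurable_sets[OF m] in \<open>auto simp: space_PiM\<close>)
  thus ?thesis unfolding subalgebra_def by simp
qed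

text \<open>The function \<open>h\<close> is the conditional expectation: it is measurable by construction, and agrees
  almost surely with the transition probability as a function of the past.\<close>

lemma transition_kernel:
  obtains h where "integrable \<mu> h" "AE x in \<mu>. h x = pmf (p (ctx \<tau> (past x))) c"
    "\<And>a B. window a 0 B \<Longrightarrow> Pr (\<lambda>x. B x \<and> x 0 = c) = (\<integral>x. indicator {x. B x} x * h x \<partial>\<mu>)"
proof -
  let ?F = "coord_algebra UNIV {..<0}"
  let ?h = "real_cond_exp \<mu> ?F (indicator {y. y 0 = c})"
  have "finite_measure_subalgebra \<mu> ?F"
    by unfold_locales (rule subalgebra_coord)
  then interpret F: sigma_finite_subalgebra \<mu> ?F
    by (rule finite_measure_subalgebra_is_sigma_finite)
  have ev: "{y. y 0 = c} \<in> events"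
    by (rule window_event[of 0 1]) (rule windowI, simp)
  have int: "integrable \<mu> (indicator {y. y 0 = c} :: _ \<Rightarrow> real)"
    by (rule integrable_real_indicator) (use ev in \<open>auto simp: less_top[symmetric]\<close>)
  show ?thesis
  proof (rule that[of ?h])
    show "integrable \<mu> ?h" using F.real_cond_exp_int(1)[OF int] .
    show "AE x in \<mu>. ?h x = pmf (p (ctx \<tau> (past x))) c"
      using comp unfolding compatible_def by (rule AE_mp) simp
    fix a and B :: "(int \<Rightarrow> 'a) \<Rightarrow> bool" assume B: "window a 0 B"
    have "Measurable.pred ?F B"
      by (rule window_measurable[OF B]) (simp add: measurable_coord_algebra)
    hence BF: "{x. B x} \<in> sets ?F" by (simp add: pred_def)
    have "(\<integral>x\<in>{x. B x}. indicator {y. y 0 = c} x \<partial>\<mu>) = (\<integral>x. indicator {x. B x \<and> x 0 = c} x \<partial>\<mu>)"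
      unfolding set_lebesgue_integral_def by (intro Bochner_Integration.integral_cong) (auto simp: indicator_def)
    also have "\<dots> = Pr (\<lambda>x. B x \<and> x 0 = c)" by simp
    finally show "Pr (\<lambda>x. B x \<and> x 0 = c) = (\<integral>x. indicator {x. B x} x * ?h x \<partial>\<mu>)"
      using F.real_cond_exp_intA[OF int BF] unfolding set_lebesgue_integral_def by simp
  qed
qed

lemma step_at_zero:
  assumes "window a 0 B"
  shows "(\<And>x. B x \<Longrightarrow> ctx \<tau> (past x) = v) \<Longrightarrow> Pr (\<lambda>x. B x \<and> x 0 = c) = pmf (p v) c * Pr B"
    and "c \<in> set w \<Longrightarrow> Pr (\<lambda>x. B x \<and> x 0 = c) \<ge> \<epsilon> * Pr B"
proof -
  obtain h where h: "integrable \<mu> h" "AE x in \<mu>. h x = pmf (p (ctx \<tau> (past x))) c"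
    and h_int: "\<And>a B. window a 0 B \<Longrightarrow> Pr (\<lambda>x. B x \<and> x 0 = c) = (\<integral>x. indicator {x. B x} x * h x \<partial>\<mu>)"
    by (rule transition_kernel[of c]) blast
  note hB = h_int[OF assms]
  have ev: "{x. B x} \<in> events" by (rule window_event[OF assms])
  have int: "integrable \<mu> (\<lambda>x. indicator {x. B x} x * h x)"
    using integrable_mult_indicator[OF ev h(1)] by simp
  have int': "integrable \<mu> (\<lambda>x. indicator {x. B x} x * q)" for q :: real
    using integrable_mult_indicator[OF ev integrable_const[of q]] by simp
  have val: "(\<integral>x. indicator {x. B x} x * q \<partial>\<mu>) = q * Pr B" for q :: real
    using ev by simp
  show "Pr (\<lambda>x. B x \<and> x 0 = c) = pmf (p v) c * Pr B" if v: "\<And>x. B x \<Longrightarrow> ctx \<tau> (past x) = v"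
  proof -
    have "(\<integral>x. indicator {x. B x} x * h x \<partial>\<mu>) = (\<integral>x. indicator {x. B x} x * pmf (p v) c \<partial>\<mu>)"
      proof (rule integral_cong_AE)
      show "AE x in \<mu>. indicator {x. B x} x * h x = indicator {x. B x} x * pmf (p v) c"
        using h(2) by eventually_elim (use v in \<open>simp add: indicator_def\<close>)
    qed (use int int' in \<open>blast dest: borel_measurable_integrable\<close>)+
    thus ?thesis using hB val by simp
  qed
  show "Pr (\<lambda>x. B x \<and> x 0 = c) \<ge> \<epsilon> * Pr B" if c: "c \<in> set w"
  proof -
    have ge: "pmf (p (ctx \<tau> u)) c \<ge> \<epsilon>" for u
    proof -
      have "(INF v\<in>\<tau>. pmf (p v) c) \<le> pmf (p (ctx \<tau> u)) c"
        by (rule cINF_lower) (use ctx_suffix[OF tree] in \<open>auto intro!: bdd_belowI[of _ 0]\<close>)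
      thus ?thesis using reg c unfolding regular_string_def regular_symbol_def by fastforce
    qed
    have "(\<integral>x. indicator {x. B x} x * \<epsilon> \<partial>\<mu>) \<le> (\<integral>x. indicator {x. B x} x * h x \<partial>\<mu>)"
    proof (rule integral_mono_AE[OF int' int])
      show "AE x in \<mu>. indicator {x. B x} x * \<epsilon> \<le> indicator {x. B x} x * h x"
        using h(2) by eventually_elim (use ge in \<open>simp add: indicator_def\<close>)
    qed
    thus ?thesis unfolding hB val .
  qed
qed

lemma
  assumes "window a n B"
  shows step_const: "(\<And>x. B x \<Longrightarrow> ctx \<tau> (past_at x n) = v) \<Longrightarrow> Pr (\<lambda>x. B x \<and> x n = c) = pmf (p v) c * Pr B"
    and step_ge: "c \<in> set w \<Longrightarrow> Pr (\<lambda>x. B x \<and> x n = c) \<ge> \<epsilon> * Pr B"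
proof -
  define B' where "B' = (\<lambda>y. B (\<lambda>i. y (i - n)))"
  have w: "window (a - n) 0 B'"
    unfolding B'_def by (rule windowI) (rule windowD[OF assms], simp)
  have ev: "{x. B' x} \<in> events" by (rule window_event[OF w])
  have "window (min (a - n) 0) 1 (\<lambda>y. y 0 = c)" by (rule windowI) simp
  hence "window (min (a - n) 0) 1 (\<lambda>y. B' y \<and> y 0 = c)"
    by (intro window_conj window_mono[OF w]) auto
  from Pr_shift[OF window_event[OF this], of n]
  have 1: "Pr (\<lambda>x. B x \<and> x n = c) = Pr (\<lambda>y. B' y \<and> y 0 = c)"
    unfolding B'_def by simp
  have 2: "Pr B = Pr B'" using Pr_shift[OF ev, of n] unfolding B'_def by simp
  show "Pr (\<lambda>x. B x \<and> x n = c) = pmf (p v) c * Pr B" if v: "\<And>x. B x \<Longrightarrow> ctx \<tau> (past_at x n) = v"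
  proof -
    have "ctx \<tau> (past y) = v" if "B' y" for y
    proof -
      have "past_at (\<lambda>i. y (i - n)) n = past y" unfolding past_at_def past_def by (rule ext) simp
      thus ?thesis using v[of "\<lambda>i. y (i - n)"] that unfolding B'_def by simp
    qed
    thus ?thesis unfolding 1 2 by (rule step_at_zero(1)[OF w])
  qed
  show "Pr (\<lambda>x. B x \<and> x n = c) \<ge> \<epsilon> * Pr B" if "c \<in> set w"
    unfolding 1 2 by (rule step_at_zero(2)[OF w that])
qed

lemma occ_ge:
  assumes B: "window a n B"
  shows "Pr (\<lambda>x. B x \<and> occ x n) \<ge> \<epsilon> ^ l * Pr B"
proof -
  have "Pr (\<lambda>x. B x \<and> (\<forall>j<r. x (n + int j) = w ! j)) \<ge> \<epsilon> ^ r * Pr B" if "r \<le> l" for r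
    using that
  proof (induction r)
    case (Suc r)
    let ?C = "\<lambda>x. B x \<and> (\<forall>j<r. x (n + int j) = w ! j)"
    have "window (min a n) (n + int r) (\<lambda>x. \<forall>j<r. x (n + int j) = w ! j)"
      by (rule windowI) auto
    hence "window (min a n) (n + int r) ?C"
      by (intro window_conj window_mono[OF B]) auto
    from step_ge[OF this, of "w ! r"] Suc.prems
    have "Pr (\<lambda>x. ?C x \<and> x (n + int r) = w ! r) \<ge> \<epsilon> * Pr ?C" by simp
    moreover have "(\<lambda>x. ?C x \<and> x (n + int r) = w ! r) = (\<lambda>x. B x \<and> (\<forall>j<Suc r. x (n + int j) = w ! j))"
      by (auto simp: less_Suc_eq)
    moreover have "\<epsilon> * Pr ?C \<ge> \<epsilon> * (\<epsilon> ^ r * Pr B)"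
      using Suc eps by (intro mult_left_mono) auto
    ultimately show ?case by (simp add: mult.assoc)
  qed simp
  from this[of l] show ?thesis unfolding occ_def by simp
qed

text \<open>Each of \<open>q\<close> disjoint stretches of length \<open>|w|\<close> is a fresh chance of at least
  \<open>\<epsilon> ^ |w|\<close> to write \<open>w\<close>.\<close>

lemma no_occ_le:
  assumes B: "window a n B"
  shows "Pr (\<lambda>x. B x \<and> (\<forall>r<q. \<not> occ x (n + int (r * l)))) \<le> (1 - \<epsilon> ^ l) ^ q * Pr B"
proof (induction q)
  case (Suc q)
  let ?C = "\<lambda>x. B x \<and> (\<forall>r<q. \<not> occ x (n + int (r * l)))"
  let ?n = "n + int (q * l)"
  have W: "window (min a n) ?n ?C"
  proof (intro window_conj window_mono[OF B] window_all window_imp window_not window_occ)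
    fix r assume "r < q"
    hence "(r + 1) * l \<le> q * l" by (intro mult_right_mono) auto
    thus "n + int (r * l) + int l \<le> ?n" by (simp add: algebra_simps flip: of_nat_add of_nat_mult)
  next
    fix r show "min a n \<le> n + int (r * l)" by (simp add: min.coboundedI2)
  qed auto
  have O: "window (min a n) (?n + int l) (\<lambda>x. occ x ?n)"
    by (rule window_occ) (simp_all add: min.coboundedI2)
  have WC: "window (min a n) (?n + int l) ?C" using W by (rule window_mono) auto
  have e: "{x. ?C x} \<in> events" "{x. ?C x \<and> occ x ?n} \<in> events"
    using window_event[OF W] window_event[OF window_conj[OF WC O]] by auto
  have "{x. B x \<and> (\<forall>r<Suc q. \<not> occ x (n + int (r * l)))} = {x. ?C x} - {x. ?C x \<and> occ x ?n}"
    by (auto simp: less_Suc_eq)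
  hence "Pr (\<lambda>x. B x \<and> (\<forall>r<Suc q. \<not> occ x (n + int (r * l)))) = Pr ?C - Pr (\<lambda>x. ?C x \<and> occ x ?n)"
    by (simp only:) (rule finite_measure_Diff[OF e], blast)
  also have "\<dots> \<le> Pr ?C - \<epsilon> ^ l * Pr ?C" using occ_ge[OF W] by linarith
  also have "\<dots> = (1 - \<epsilon> ^ l) * Pr ?C" by (simp add: algebra_simps)
  also have "\<dots> \<le> (1 - \<epsilon> ^ l) * ((1 - \<epsilon> ^ l) ^ q * Pr B)"
    using Suc eps by (intro mult_left_mono) (auto simp: power_le_one)
  finally show ?case by (simp add: mult.assoc)
qed simp


section \<open>Choosing the length of the initial run\<close>

text \<open>The constant \<open>C\<close> of the growth condition is chosen such that
  \<open>(1 - \<epsilon> ^ |w|) ^ (m div |w|)\<close> is, up to a bounded factor,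
  \<open>exp (- C m)\<close>; the condition gives \<open>lw m \<le> exp (\<theta> C m)\<close> eventually,
  with some \<open>\<theta> < 1\<close>.\<close>

lemma summable_weighted_lw: "summable (\<lambda>m. real (lw m) * (1 - \<epsilon> ^ l) ^ (m div l))"
proof -
  define C where "C = C_const \<epsilon> w"
  define r where "r = 1 - \<epsilon> ^ l"
  have r: "0 < r" "r < 1" using eps l_pos unfolding r_def by (auto simp: power_Suc_less_one power_less_one_iff)
  have C: "C = - ln r / real l" unfolding C_def C_const_def r_def by simp
  have Cpos: "C > 0" using r l_pos unfolding C by (simp add: divide_neg_pos)
  have rexp: "r = exp (- C * real l)" using r l_pos unfolding C by simp
  obtain \<theta> where \<theta>: "limsup (\<lambda>k. elog (lw k) / ereal (C * real k)) < ereal \<theta>" "ereal \<theta> < 1"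
    using ereal_dense2[OF lim] unfolding C_def by blast
  have ev: "\<forall>\<^sub>F k in sequentially. elog (lw k) / ereal (C * real k) < ereal \<theta>"
    by (rule Limsup_lessD[OF \<theta>(1)])
  have "\<forall>\<^sub>F k in sequentially. norm (real (lw k) * r ^ (k div l)) \<le> exp (C * real l) * exp (- (1 - \<theta>) * C) ^ k"
    using ev eventually_gt_at_top[of 0]
  proof eventually_elim
    case (elim k)
    have "real (lw k) \<le> exp (\<theta> * C * real k)"
    proof (cases "lw k = 0")
      case False
      hence "ln (real (lw k)) / (C * real k) < \<theta>"
        using elim Cpos by (simp add: elog_def)
      hence "ln (real (lw k)) < \<theta> * C * real k"
        using elim Cpos by (simp add: divide_less_eq mult.assoc)
      hence "exp (ln (real (lw k))) < exp (\<theta> * C * real k)" by simp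
      thus ?thesis using False by simp
    qed simp
    moreover have "r ^ (k div l) \<le> exp (C * real l) * exp (- C * real k)"
    proof -
      have "k mod l < l" using l_pos by simp
      hence "k \<le> l * (k div l) + l" by (metis add_left_mono less_imp_le mult_div_mod_eq)
      hence "real k \<le> real l * real (k div l) + real l" by (metis of_nat_add of_nat_le_iff of_nat_mult)
      hence "C * real k \<le> C * (real l * real (k div l) + real l)" using Cpos by (intro mult_left_mono) auto
      hence "real (k div l) * (- C * real l) \<le> C * real l + - C * real k" by (simp add: algebra_simps)
      moreover have "r ^ (k div l) = exp (real (k div l) * (- C * real l))"
        by (subst rexp) (simp only: exp_of_nat_mult)
      ultimately show ?thesis by (simp only: exp_add[symmetric] exp_le_cancel_iff)
    qed
    ultimately have "real (lw k) * r ^ (k div l) \<le> exp (\<theta> * C * real k) * (exp (C * real l) * exp (- C * real k))"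
      using r by (intro mult_mono) auto
    also have "\<dots> = exp (C * real l) * (exp (\<theta> * C * real k) * exp (- C * real k))" by simp
    also have "exp (\<theta> * C * real k) * exp (- C * real k) = exp (real k * (- (1 - \<theta>) * C))"
      by (simp add: algebra_simps flip: exp_add)
    also have "\<dots> = exp (- (1 - \<theta>) * C) ^ k" by (rule exp_of_nat_mult)
    finally show ?case using r by simp
  qed
  moreover have "summable (\<lambda>k. exp (C * real l) * exp (- (1 - \<theta>) * C) ^ k)"
    using Cpos \<theta>(2) by (intro summable_mult summable_geometric) (simp add: mult_neg_pos)
  ultimately show ?thesis unfolding r_def[symmetric] by (rule summable_comparison_test_ev)
qed

text \<open>Choose \<open>M\<close> such that the tail of the convergent series from \<open>M\<close> on is below
  \<open>1\<close>, and then \<open>N\<close> so large that the terms before \<open>M\<close> vanish.\<close>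

lemma exists_run_length:
  "\<exists>N. summable (\<lambda>m. real (lw m - N * l) * (1 - \<epsilon> ^ l) ^ (m div l)) \<and>
       (\<Sum>m. real (lw m - N * l) * (1 - \<epsilon> ^ l) ^ (m div l)) < 1"
proof -
  define a where "a = (\<lambda>m. real (lw m) * (1 - \<epsilon> ^ l) ^ (m div l))"
  have a: "summable a" unfolding a_def by (rule summable_weighted_lw)
  obtain M where M: "\<And>n. n \<ge> M \<Longrightarrow> norm (\<Sum>i. a (i + n)) < 1"
    using suminf_exist_split[OF zero_less_one a] by blast
  \<comment> \<open>large enough for \<open>lw m \<le> N * l\<close> whenever \<open>m < M\<close>\<close>
  define N where "N = (\<Sum>m<M. lw m)"
  define b where "b = (\<lambda>m. real (lw m - N * l) * (1 - \<epsilon> ^ l) ^ (m div l))"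
  have r: "0 \<le> 1 - \<epsilon> ^ l" using eps by (simp add: power_le_one)
  have b_ge: "b m \<ge> 0" for m unfolding b_def using r by simp
  have b_le: "b m \<le> a m" for m unfolding a_def b_def using r by (intro mult_right_mono) auto
  have b: "summable b" by (rule summable_comparison_test[OF _ a]) (use b_ge b_le in auto)
  have "b m = 0" if "m < M" for m
  proof -
    have "lw m \<le> N" unfolding N_def using that by (intro member_le_sum) auto
    also have "N \<le> N * l" using mult_le_mono2[OF Suc_leI[OF l_pos], of N] by simp
    finally show ?thesis unfolding b_def by simp
  qed
  hence "suminf b = (\<Sum>i. b (i + M))"
    using suminf_split_initial_segment[OF b, of M] by simp
  also have "\<dots> \<le> (\<Sum>i. a (i + M))"
    by (rule suminf_le) (use b_le a b in \<open>auto simp: summable_iff_shift\<close>)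
  also have "\<dots> < 1" using M[of M] by simp
  finally show ?thesis using b unfolding b_def by blast
qed

definition N :: nat where
  "N = (SOME N. summable (\<lambda>m. real (lw m - N * l) * (1 - \<epsilon> ^ l) ^ (m div l)) \<and>
       (\<Sum>m. real (lw m - N * l) * (1 - \<epsilon> ^ l) ^ (m div l)) < 1)"

lemma N_props: "summable (\<lambda>m. real (lw m - N * l) * (1 - \<epsilon> ^ l) ^ (m div l))"
  "(\<Sum>m. real (lw m - N * l) * (1 - \<epsilon> ^ l) ^ (m div l)) < 1"
  using someI_ex[OF exists_run_length] unfolding N_def by blast+

abbreviation L :: nat where "L \<equiv> (N + 1) * l"

section \<open>Regeneration times\<close>

definition run :: "(int \<Rightarrow> 'a) \<Rightarrow> int \<Rightarrow> bool" where
  "run x k \<longleftrightarrow> (\<forall>r\<le>N. occ x (k + int (r * l)))"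

text \<open>Candidates for a regeneration at \<open>k\<close>, tested by the contexts of the times \<open>n\<close> up
  to \<open>e\<close>. The context at time \<open>n\<close> serves to predict \<open>x n\<close> and uses
  \<open>x\<close> before \<open>n\<close> only, so this is an event of the window from \<open>k\<close> to
  \<open>e\<close>. The bound on \<open>m\<close> says that the last copy of \<open>w\<close> is the last copy of the
  run or a later one, as it must be after a run; it confines the condition to the window.\<close>

definition regen_upto :: "int \<Rightarrow> (int \<Rightarrow> 'a) \<Rightarrow> int \<Rightarrow> bool" where
  "regen_upto e x k \<longleftrightarrow> run x k \<and>
     (\<forall>n m. k + int L \<le> n \<longrightarrow> n \<le> e \<longrightarrow> int m + int L \<le> n - k \<longrightarrow> lastocc x n m \<longrightarrow> int (m + l + lw m) \<le> n - k)"

definition regen :: "(int \<Rightarrow> 'a) \<Rightarrow> int \<Rightarrow> bool" where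
  "regen x k \<longleftrightarrow> (\<forall>e. regen_upto e x k)"

lemma window_run: "window k (k + int L) (\<lambda>x. run x k)"
  unfolding run_def
proof (intro window_all window_imp window_occ)
  fix r assume "r \<le> N"
  hence "(r + 1) * l \<le> L" by (intro mult_right_mono) auto
  hence "r * l + l \<le> L" by simp
  hence "int (r * l + l) \<le> int L" by (rule zle_int[THEN iffD2])
  thus "k + int (r * l) + int l \<le> k + int L" by (simp only: of_nat_add)
qed simp

lemma window_regen_upto: "window k (max e (k + int L)) (\<lambda>x. regen_upto e x k)"
  unfolding regen_upto_def
proof (intro window_conj window_all window_imp window_impl window_lastocc window_True)
  show "window k (max e (k + int L)) (\<lambda>x. run x k)" by (rule window_mono[OF window_run]) auto
  fix n m
  assume "n \<le> e" "int m + int L \<le> n - k"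
  moreover have "int l \<le> int L" by simp
  ultimately show "k \<le> n - int l - int m" "n \<le> max e (k + int L)" by linarith+
qed

lemma window_regen_upto': "a \<le> k \<Longrightarrow> e \<le> b \<Longrightarrow> k + int L \<le> b \<Longrightarrow> window a b (\<lambda>x. regen_upto e x k)"
  by (rule window_mono[OF window_regen_upto]) auto

lemma run_shift: "run (\<lambda>n. x (n + c)) k \<longleftrightarrow> run x (k + c)"
  unfolding run_def occ_shift by (simp add: ac_simps)

lemma regen_upto_shift: "regen_upto e (\<lambda>n. x (n + c)) k \<longleftrightarrow> regen_upto (e + c) x (k + c)"
  (is "?A \<longleftrightarrow> ?B")
proof
  assume A: ?A
  show ?B unfolding regen_upto_def
  proof (intro conjI allI impI)
    show "run x (k + c)" using A unfolding regen_upto_def run_shift by blast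
    fix n m assume "k + c + int L \<le> n" "n \<le> e + c" "int m + int L \<le> n - (k + c)" "lastocc x n m"
    thus "int (m + l + lw m) \<le> n - (k + c)"
      using A[unfolded regen_upto_def lastocc_shift, THEN conjunct2, rule_format, of "n - c" m] by simp
  qed
next
  assume B: ?B
  show ?A unfolding regen_upto_def lastocc_shift
  proof (intro conjI allI impI)
    show "run (\<lambda>n. x (n + c)) k" using B unfolding regen_upto_def run_shift by blast
    fix n m assume "k + int L \<le> n" "n \<le> e" "int m + int L \<le> n - k" "lastocc x (n + c) m"
    thus "int (m + l + lw m) \<le> n - k"
      using B[unfolded regen_upto_def, THEN conjunct2, rule_format, of "n + c" m] by simp
  qed
qed

lemma regen_shift: "regen (\<lambda>n. x (n + c)) k \<longleftrightarrow> regen x (k + c)"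
  unfolding regen_def regen_upto_shift by (metis diff_add_cancel)

lemma regen_upto_antimono: "regen_upto e x k \<Longrightarrow> e' \<le> e \<Longrightarrow> regen_upto e' x k"
  unfolding regen_upto_def by (meson order_trans)

lemma lastocc_exists:
  assumes "run x k" "k + int L \<le> n"
  obtains m where "lastocc x n m" "int m + int L \<le> n - k"
proof -
  define m0 where "m0 = nat (n - k - int L)"
  have "n - int l - int m0 = k + int (N * l)" using assms(2) unfolding m0_def by (simp add: algebra_simps)
  hence o: "occ x (n - int l - int m0)" using assms(1) unfolding run_def by auto
  define m where "m = (LEAST m. occ x (n - int l - int m))"
  have "lastocc x n m" unfolding lastocc_def m_def
    using LeastI[of "\<lambda>m. occ x (n - int l - int m)", OF o] not_less_Least by blast
  moreover have "m \<le> m0" unfolding m_def by (rule Least_le[of "\<lambda>m. occ x (n - int l - int m)", OF o])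
  ultimately show ?thesis using that assms(2) unfolding m0_def by force
qed

lemma regen_upto_lastocc:
  assumes "regen_upto n x k" "k + int L \<le> n"
  obtains m where "lastocc x n m" "int (m + l + lw m) \<le> n - k"
proof -
  from assms have "run x k" unfolding regen_upto_def by blast
  from lastocc_exists[OF this assms(2)] obtain m where m: "lastocc x n m" "int m + int L \<le> n - k" by blast
  thus ?thesis using that assms unfolding regen_upto_def by blast
qed

text \<open>After the run at \<open>k\<close>, contexts that start at or after \<open>k\<close> also start at or after
  \<open>j\<close>.\<close>

lemma regen_upto_extend:
  assumes "j \<le> k" "regen_upto e x k" "regen_upto (k + int L) x j"
  shows "regen_upto e x j"
  unfolding regen_upto_def
proof (intro conjI allI impI)
  show "run x j" using assms(3) unfolding regen_upto_def by blast
  fix n m assume n: "j + int L \<le> n" "n \<le> e" "int m + int L \<le> n - j" "lastocc x n m"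
  show "int (m + l + lw m) \<le> n - j"
  proof (cases "n \<le> k + int L")
    case True
    thus ?thesis using assms(3) n unfolding regen_upto_def by blast
  next
    case False
    have "regen_upto n x k" using assms(2) n(2) by (rule regen_upto_antimono)
    from regen_upto_lastocc[OF this] False
    obtain m' where "lastocc x n m'" "int (m' + l + lw m') \<le> n - k" by force
    thus ?thesis using lastocc_unique[OF n(4)] assms(1) by fastforce
  qed
qed

lemma regen_iff_upto: "regen x k \<Longrightarrow> j \<le> k \<Longrightarrow> regen x j \<longleftrightarrow> regen_upto (k + int L) x j"
  unfolding regen_def by (meson regen_upto_extend)

lemma run_ge:
  assumes B: "window a k B"
  shows "Pr (\<lambda>x. B x \<and> run x k) \<ge> (\<epsilon> ^ l) ^ (N + 1) * Pr B"
proof -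
  have "Pr (\<lambda>x. B x \<and> (\<forall>r<q. occ x (k + int (r * l)))) \<ge> (\<epsilon> ^ l) ^ q * Pr B" for q
  proof (induction q)
    case (Suc q)
    let ?C = "\<lambda>x. B x \<and> (\<forall>r<q. occ x (k + int (r * l)))"
    have W: "window (min a k) (k + int (q * l)) ?C"
    proof (intro window_conj window_mono[OF B] window_all window_imp window_occ)
      fix r assume "r < q"
      hence "(r + 1) * l \<le> q * l" by (intro mult_right_mono) auto
      thus "k + int (r * l) + int l \<le> k + int (q * l)" by (simp add: algebra_simps flip: of_nat_add of_nat_mult)
    next
      fix r show "min a k \<le> k + int (r * l)" by (simp add: min.coboundedI2)
    qed auto
    have "(\<lambda>x. ?C x \<and> occ x (k + int (q * l))) = (\<lambda>x. B x \<and> (\<forall>r<Suc q. occ x (k + int (r * l))))"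
      by (auto simp: less_Suc_eq)
    moreover have "\<epsilon> ^ l * Pr ?C \<ge> \<epsilon> ^ l * ((\<epsilon> ^ l) ^ q * Pr B)"
      using Suc eps by (intro mult_left_mono) auto
    ultimately show ?case using occ_ge[OF W] by (simp add: mult.assoc)
  qed simp
  from this[of "N + 1"] show ?thesis unfolding run_def by (simp only: less_Suc_eq_le Suc_eq_plus1[symmetric])
qed

lemma run_event: "{x. run x k} \<in> events"
  by (rule window_event[OF window_run])

lemma regen_event: "{x. regen x k} \<in> events"
proof -
  have "{x. regen x k} = (\<Inter>e. {x. regen_upto e x k})" unfolding regen_def by auto
  moreover have "{x. regen_upto e x k} \<in> events" for e by (rule window_event[OF window_regen_upto])
  ultimately show ?thesis by simp
qed

lemma Pr_run: "Pr (\<lambda>x. run x k) = Pr (\<lambda>x. run x 0)"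
proof -
  have "Pr (\<lambda>x. run (\<lambda>n. x (n + k)) 0) = Pr (\<lambda>x. run x 0)" by (rule Pr_shift[OF run_event])
  thus ?thesis by (simp add: run_shift)
qed

lemma Pr_regen: "Pr (\<lambda>x. regen x k) = Pr (\<lambda>x. regen x 0)"
proof -
  have "Pr (\<lambda>x. regen (\<lambda>n. x (n + k)) 0) = Pr (\<lambda>x. regen x 0)" by (rule Pr_shift[OF regen_event])
  thus ?thesis by (simp add: regen_shift)
qed

lemma Pr_run_pos: "Pr (\<lambda>x. run x 0) > 0"
proof -
  have "Pr (\<lambda>x. True \<and> run x 0) \<ge> (\<epsilon> ^ l) ^ (N + 1) * Pr (\<lambda>x. True)"
    by (rule run_ge[OF window_True])
  moreover have "Pr (\<lambda>x. True) = 1" using prob_space by simp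
  moreover have "(\<epsilon> ^ l) ^ (N + 1) > 0" using eps by simp
  ultimately show ?thesis by (metis (no_types, lifting) mult.right_neutral order_less_le_trans)
qed

text \<open>If the last copy of \<open>w\<close> before \<open>n\<close> is at distance \<open>m\<close>, none is
  written in the \<open>m div |w|\<close> disjoint stretches of length \<open>|w|\<close> that end at
  \<open>n\<close>.\<close>

lemma run_lastocc_le:
  assumes "int m + int L \<le> n"
  shows "Pr (\<lambda>x. run x 0 \<and> lastocc x n m) \<le> (1 - \<epsilon> ^ l) ^ (m div l) * Pr (\<lambda>x. run x 0)"
proof -
  define q where "q = m div l"
  let ?s = "n - int (q * l)"
  have qm: "q * l \<le> m" unfolding q_def by simp
  hence qm': "int (q * l) \<le> int m" by (simp only: zle_int)
  have W: "window 0 ?s (\<lambda>x. run x 0)"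
    by (rule window_mono[OF window_run]) (use assms qm' in \<open>auto simp del: of_nat_mult\<close>)
  have sub: "{x. run x 0 \<and> lastocc x n m} \<subseteq> {x. run x 0 \<and> (\<forall>r<q. \<not> occ x (?s + int (r * l)))}"
  proof safe
    fix x r assume x: "lastocc x n m" "r < q" "occ x (?s + int (r * l))"
    \<comment> \<open>the distance of the stretch number \<open>r\<close> from the end\<close>
    define m' where "m' = (q - 1 - r) * l"
    have "q * l = ((q - 1 - r) + (r + 1)) * l" using x(2) by simp
    hence e: "m' + (r * l + l) = q * l" unfolding m'_def by (simp only: add_mult_distrib mult_1)
    hence "m' < m" using qm l_pos by linarith
    hence "\<not> occ x (n - int l - int m')" using x(1) unfolding lastocc_def by blast
    moreover have "?s + int (r * l) = n - int l - int m'" using e by linarith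
    ultimately show False using x(3) by (simp only:)
  qed
  have "window 0 n (\<lambda>x. run x 0 \<and> (\<forall>r<q. \<not> occ x (?s + int (r * l))))"
  proof (intro window_conj window_mono[OF W] window_all window_imp window_not window_occ)
    fix r assume "r < q"
    hence "(r + 1) * l \<le> q * l" by (intro mult_right_mono) auto
    thus "?s + int (r * l) + int l \<le> n" by (simp add: algebra_simps flip: of_nat_add of_nat_mult)
    show "0 \<le> ?s + int (r * l)" using assms qm' by linarith
  qed (use qm' in auto)
  from finite_measure_mono[OF sub window_event[OF this]] no_occ_le[OF W, of q]
  show ?thesis unfolding q_def by linarith
qed

text \<open>Union bound over the failures after a run at \<open>0\<close>. A context at time
  \<open>n = m + L + j\<close> with the last copy of \<open>w\<close> at distance \<open>m\<close> reaches back
  behind \<open>0\<close> iff \<open>j + N |w| < lw m\<close>, so for each \<open>m\<close> there are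
  \<open>lw m - N |w|\<close> times to consider (none if this is negative).\<close>

lemma Pr_regen_pos: "Pr (\<lambda>x. regen x 0) > 0"
proof -
  let ?W = "Pr (\<lambda>x. run x 0)"
  let ?r = "1 - \<epsilon> ^ l"
  define E where "E m j = {x. run x 0 \<and> lastocc x (int m + int L + int j) m}" for m j :: nat
  define A where "A m = (\<Union>j<lw m - N * l. E m j)" for m
  have E: "E m j \<in> events" for m j
  proof -
    have "window 0 (int m + int L + int j) (\<lambda>x. run x 0 \<and> lastocc x (int m + int L + int j) m)"
      by (intro window_conj window_mono[OF window_run] window_lastocc) auto
    from window_event[OF this] show ?thesis unfolding E_def .
  qed
  have A: "A m \<in> events" for m unfolding A_def using E by auto
  have A_le: "measure \<mu> (A m) \<le> (real (lw m - N * l) * ?r ^ (m div l)) * ?W" for m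
  proof -
    have "measure \<mu> (A m) \<le> (\<Sum>j<lw m - N * l. measure \<mu> (E m j))"
      unfolding A_def by (rule finite_measure_subadditive_finite) (use E in auto)
    also have "\<dots> \<le> real (card {..<lw m - N * l}) * (?r ^ (m div l) * ?W)"
      by (rule sum_bounded_above) (auto simp: E_def simp del: of_nat_mult of_nat_add intro!: run_lastocc_le)
    finally show ?thesis by (simp add: mult.assoc)
  qed
  have s: "summable (\<lambda>m. (real (lw m - N * l) * ?r ^ (m div l)) * ?W)"
    by (rule summable_mult2[OF N_props(1)])
  have sA: "summable (\<lambda>m. measure \<mu> (A m))"
    by (rule summable_comparison_test[OF _ s]) (use A_le in auto)
  have "measure \<mu> (\<Union>m. A m) \<le> (\<Sum>m. measure \<mu> (A m))"
    by (rule finite_measure_subadditive_countably) (use A sA in auto)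
  also have "\<dots> \<le> (\<Sum>m. (real (lw m - N * l) * ?r ^ (m div l)) * ?W)"
    by (rule suminf_le[OF A_le sA s])
  also have "\<dots> = (\<Sum>m. real (lw m - N * l) * ?r ^ (m div l)) * ?W"
    by (rule suminf_mult2[OF N_props(1), symmetric])
  also have "\<dots> < 1 * ?W" using N_props(2) Pr_run_pos by (intro mult_strict_right_mono) auto
  finally have less: "measure \<mu> (\<Union>m. A m) < ?W" by simp
  have "{x. run x 0} \<subseteq> {x. regen x 0} \<union> (\<Union>m. A m)"
  proof
    fix x assume x: "x \<in> {x. run x 0}"
    show "x \<in> {x. regen x 0} \<union> (\<Union>m. A m)"
    proof (cases "regen x 0")
      case False
      then obtain e where "\<not> regen_upto e x 0" unfolding regen_def by blast
      then obtain n m where nm: "int m + int L \<le> n" "lastocc x n m" "int (m + l + lw m) > n"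
        using x unfolding regen_upto_def by fastforce
      define j where "j = nat (n - int m - int L)"
      have j: "n = int m + int L + int j" using nm(1) unfolding j_def by simp
      have "j + N * l < lw m" using nm(3) unfolding j by (simp add: algebra_simps flip: of_nat_add of_nat_mult)
      hence "x \<in> A m" unfolding A_def E_def using x nm(2) j by (auto intro!: bexI[of _ j])
      thus ?thesis by blast
    qed simp
  qed
  hence "?W \<le> measure \<mu> ({x. regen x 0} \<union> (\<Union>m. A m))"
    by (rule finite_measure_mono) (use A regen_event in auto)
  also have "\<dots> \<le> Pr (\<lambda>x. regen x 0) + measure \<mu> (\<Union>m. A m)"
    by (rule measure_Un_le) (use A regen_event in auto)
  finally show ?thesis using less by linarith
qed

section \<open>The regeneration property\<close>

lemma run_determines:
  assumes "run x k" "run y k" "k \<le> i" "i < k + int L"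
  shows "x i = y i"
proof -
  define d where "d = nat (i - k)"
  define r where "r = d div l"
  have d: "i = k + int d" using assms(3) unfolding d_def by simp
  hence "d < L" using assms(4) by (simp only: add_less_cancel_left of_nat_less_iff)
  hence r: "r \<le> N" using l_pos unfolding r_def
    by (simp add: div_less_iff_less_mult less_Suc_eq_le[symmetric])
  have m: "d mod l < l" using l_pos by (rule mod_less_divisor)
  have "int d = int (r * l) + int (d mod l)"
    unfolding r_def of_nat_add[symmetric] by simp
  hence i: "i = (k + int (r * l)) + int (d mod l)" using d by linarith
  have *: "z i = w ! (d mod l)" if "run z k" for z
    using that[unfolded run_def occ_def, rule_format, OF r m] unfolding i .
  show ?thesis using *[OF assms(1)] *[OF assms(2)] by simp
qed

text \<open>When the word is extended by one symbol, both probabilities are multiplied by the same transition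
  probability, because the context at time \<open>n\<close> is a function of the word since \<open>k\<close>. At the
  end of the run the claim is trivial, as the word is then the run itself.\<close>

lemma regen_word:
  assumes B: "window a (k + int L) B" "\<And>x. B x \<Longrightarrow> run x k"
    and n: "k + int L \<le> n"
    and y: "regen_upto n y k"
  shows "Pr (\<lambda>x. B x \<and> wd x k n = wd y k n) * Pr (\<lambda>x. run x 0) = Pr B * Pr (\<lambda>x. wd x k n = wd y k n)"
  using n y
proof (induction n rule: int_ge_induct)
  case base
  have ry: "run y k" using base unfolding regen_upto_def by blast
  \<comment> \<open>a word that starts with the run has no freedom before its end\<close>
  have W: "wd x k (k + int L) = wd y k (k + int L) \<longleftrightarrow> run x k" for x
  proof
    assume "wd x k (k + int L) = wd y k (k + int L)"
    thus "run x k" using windowD[OF window_run, of k x y] ry unfolding wd_eq_iff by simp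
  next
    assume "run x k"
    from run_determines[OF this ry] show "wd x k (k + int L) = wd y k (k + int L)"
      unfolding wd_eq_iff by blast
  qed
  have "(\<lambda>x. B x \<and> run x k) = B" by (rule ext) (use B(2) in auto)
  thus ?case unfolding W by (simp add: Pr_run[of k])
next
  case (step n)
  have y: "regen_upto n y k" by (rule regen_upto_antimono[OF step.prems]) simp
  obtain m where m: "lastocc y n m" "int (m + l + lw m) \<le> n - k"
    using regen_upto_lastocc[OF y step.hyps(1)] by blast
  have kn: "k \<le> n" using step.hyps(1) by (meson le_add_same_cancel1 of_nat_0_le_iff order_trans)
  have c: "ctx \<tau> (past_at x n) = ctx \<tau> (past_at y n)" if "wd x k n = wd y k n" for x
    by (rule ctx_cong[OF m(1)]) (use that m(2) in \<open>auto simp: wd_eq_iff\<close>)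
  have W0: "window (min a k) n (\<lambda>x. wd x k n = wd y k n)"
    by (rule window_mono[OF window_wd]) auto
  have WB: "window (min a k) n (\<lambda>x. B x \<and> wd x k n = wd y k n)"
    by (intro window_conj W0 window_mono[OF B(1)]) (use step.hyps in auto)
  have s: "wd x k (n + 1) = wd y k (n + 1) \<longleftrightarrow> wd x k n = wd y k n \<and> x n = y n" for x
    using kn by (simp add: wd_snoc)
  let ?q = "pmf (p (ctx \<tau> (past_at y n))) (y n)"
  have "Pr (\<lambda>x. (B x \<and> wd x k n = wd y k n) \<and> x n = y n) = ?q * Pr (\<lambda>x. B x \<and> wd x k n = wd y k n)"
    by (rule step_const[OF WB]) (use c in blast)
  moreover have "Pr (\<lambda>x. wd x k n = wd y k n \<and> x n = y n) = ?q * Pr (\<lambda>x. wd x k n = wd y k n)"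
    by (rule step_const[OF W0]) (use c in blast)
  ultimately show ?case using step.IH[OF y] unfolding s by (simp add: conj_assoc)
qed

lemma regen_window:
  assumes B: "window a (k + int L) B" "\<And>x. B x \<Longrightarrow> run x k"
    and n: "k + int L \<le> n"
    and D: "window k n D" "\<And>x. D x \<Longrightarrow> regen_upto n x k"
  shows "Pr (\<lambda>x. B x \<and> D x) * Pr (\<lambda>x. run x 0) = Pr B * Pr D"
proof (rule Pr_ratio_partition[where V = "\<lambda>x. wd x k n"])
  have "window (min a k) n (\<lambda>x. B x \<and> D x)"
    by (intro window_conj window_mono[OF B(1)] window_mono[OF D(1)]) (use n in auto)
  from window_event[OF this] show "{x. B x \<and> D x} \<in> events" .
  show "{x. D x} \<in> events" by (rule window_event[OF D(1)])
  fix s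
  show "Pr (\<lambda>x. (B x \<and> D x) \<and> wd x k n = s) * Pr (\<lambda>x. run x 0) = Pr B * Pr (\<lambda>x. D x \<and> wd x k n = s)"
  proof (cases "\<exists>y. D y \<and> wd y k n = s")
    case True
    then obtain y where y: "D y" "wd y k n = s" by blast
    have "D x" if "wd x k n = wd y k n" for x
      using windowD[OF D(1), of x y] that y(1) unfolding wd_eq_iff by blast
    hence "(\<lambda>x. (B x \<and> D x) \<and> wd x k n = s) = (\<lambda>x. B x \<and> wd x k n = wd y k n)"
      "(\<lambda>x. D x \<and> wd x k n = s) = (\<lambda>x. wd x k n = wd y k n)" using y(2) by auto
    thus ?thesis using regen_word[OF B n D(2)[OF y(1)]] by simp
  next
    case False
    hence "(\<lambda>x. (B x \<and> D x) \<and> wd x k n = s) = (\<lambda>x. False)" "(\<lambda>x. D x \<and> wd x k n = s) = (\<lambda>x. False)"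
      by auto
    thus ?thesis by simp
  qed
qed simp_all

text
  \<open>The futures to which the regeneration property is applied are decreasing limits of window events; it extends to them from window events by continuity of measure.\<close>

definition closed_regen_event :: "int \<Rightarrow> ((int \<Rightarrow> 'a) \<Rightarrow> bool) \<Rightarrow> bool" where
  "closed_regen_event k C \<longleftrightarrow> (\<exists>D :: nat \<Rightarrow> (int \<Rightarrow> 'a) \<Rightarrow> bool.
     (\<forall>i. window k (k + int L + int i) (D i)) \<and>
     (\<forall>i x. D i x \<longrightarrow> regen_upto (k + int L + int i) x k) \<and>
     (\<forall>i x. D (Suc i) x \<longrightarrow> D i x) \<and>
     (\<forall>x. C x \<longleftrightarrow> (\<forall>i. D i x)))"

text \<open>Given a run at \<open>k\<close>, the past up to the end of the run is independent of the part of the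
  future in which \<open>k\<close> is a regeneration time.\<close>

lemma regeneration:
  assumes B: "window a (k + int L) B" "\<And>x. B x \<Longrightarrow> run x k"
    and C: "closed_regen_event k C"
  shows "Pr (\<lambda>x. B x \<and> C x) * Pr (\<lambda>x. run x 0) = Pr B * Pr C"
proof -
  obtain D :: "nat \<Rightarrow> (int \<Rightarrow> 'a) \<Rightarrow> bool"
    where D: "\<And>i. window k (k + int L + int i) (D i)"
      "\<And>i x. D i x \<Longrightarrow> regen_upto (k + int L + int i) x k"
      "\<And>i x. D (Suc i) x \<Longrightarrow> D i x" "\<And>x. C x \<longleftrightarrow> (\<forall>i. D i x)"
    using C unfolding closed_regen_event_def by blast
  have eB: "{x. B x} \<in> events" by (rule window_event[OF B(1)])
  have eD: "{x. D i x} \<in> events" for i by (rule window_event[OF D(1)])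
  have eBD: "{x. B x \<and> D i x} \<in> events" for i using sets.Int[OF eB eD[of i]] by (simp add: Collect_conj_eq)
  have "(\<lambda>i. measure \<mu> {x. D i x}) \<longlonglongrightarrow> measure \<mu> (\<Inter>i. {x. D i x})"
    by (rule finite_Lim_measure_decseq) (use eD D(3) in \<open>auto intro!: decseq_SucI\<close>)
  moreover have "(\<Inter>i. {x. D i x}) = {x. C x}" using D(4) by auto
  ultimately have l1: "(\<lambda>i. Pr B * Pr (D i)) \<longlonglongrightarrow> Pr B * Pr C" by (intro tendsto_mult_left) simp
  have "(\<lambda>i. measure \<mu> {x. B x \<and> D i x}) \<longlonglongrightarrow> measure \<mu> (\<Inter>i. {x. B x \<and> D i x})"
    by (rule finite_Lim_measure_decseq) (use eBD D(3) in \<open>auto intro!: decseq_SucI\<close>)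
  moreover have "(\<Inter>i. {x. B x \<and> D i x}) = {x. B x \<and> C x}" using D(4) by auto
  ultimately have l2: "(\<lambda>i. Pr (\<lambda>x. B x \<and> D i x) * Pr (\<lambda>x. run x 0)) \<longlonglongrightarrow> Pr (\<lambda>x. B x \<and> C x) * Pr (\<lambda>x. run x 0)"
    by (intro tendsto_mult_right) simp
  have "Pr (\<lambda>x. B x \<and> D i x) * Pr (\<lambda>x. run x 0) = Pr B * Pr (D i)" for i
    by (rule regen_window[OF B _ D(1) D(2)]) auto
  thus ?thesis using LIMSEQ_unique[OF l1] l2 by simp
qed

lemma closed_regen: "closed_regen_event k (\<lambda>x. regen x k)"
  unfolding closed_regen_event_def
proof (intro exI[of _ "\<lambda>i x. regen_upto (k + int L + int i) x k"] conjI allI impI)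
  show "regen x k \<longleftrightarrow> (\<forall>i::nat. regen_upto (k + int L + int i) x k)" for x
  proof
    assume *: "\<forall>i::nat. regen_upto (k + int L + int i) x k"
    show "regen x k" unfolding regen_def
    proof
      fix e show "regen_upto e x k"
        by (rule regen_upto_antimono[OF *[rule_format, of "nat (e - k - int L)"]]) simp
    qed
  qed (simp add: regen_def)
qed (auto intro!: window_regen_upto' intro: regen_upto_antimono)


section \<open>Regeneration times are unbounded on both sides\<close>

text \<open>Whatever the past, the run at \<open>n\<close> is written with a probability bounded below, and after it
  \<open>n\<close> is a regeneration time with a fixed conditional probability.\<close>

lemma regen_ge:
  assumes B: "window a n B"
  shows "Pr (\<lambda>x. B x \<and> regen x n) \<ge> ((\<epsilon> ^ l) ^ (N + 1) * Pr (\<lambda>x. regen x 0)) * Pr B"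
proof -
  have W: "window (min a n) (n + int L) (\<lambda>x. B x \<and> run x n)"
    by (intro window_conj window_mono[OF B] window_mono[OF window_run]) auto
  have "(\<lambda>x. (B x \<and> run x n) \<and> regen x n) = (\<lambda>x. B x \<and> regen x n)"
    unfolding regen_def regen_upto_def by auto
  with regeneration[OF W _ closed_regen]
  have "Pr (\<lambda>x. B x \<and> regen x n) * Pr (\<lambda>x. run x 0) = Pr (\<lambda>x. B x \<and> run x n) * Pr (\<lambda>x. regen x 0)"
    by (simp add: Pr_regen[of n])
  moreover have "Pr (\<lambda>x. B x \<and> regen x n) * Pr (\<lambda>x. run x 0) \<le> Pr (\<lambda>x. B x \<and> regen x n)"
    by (rule mult_left_le) auto
  moreover have "((\<epsilon> ^ l) ^ (N + 1) * Pr B) * Pr (\<lambda>x. regen x 0) \<le> Pr (\<lambda>x. B x \<and> run x n) * Pr (\<lambda>x. regen x 0)"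
    by (intro mult_right_mono run_ge[OF B]) auto
  ultimately show ?thesis by (simp only: ac_simps)
qed

lemma event_regen_all: "{x. \<forall>n. Q n \<longrightarrow> \<not> regen x n} \<in> events"
proof -
  have "{x. \<forall>n. Q n \<longrightarrow> \<not> regen x n} = (\<Inter>n. {x. Q n \<longrightarrow> \<not> regen x n})" by auto
  moreover have "{x. Q n \<longrightarrow> \<not> regen x n} \<in> events" for n
  proof (cases "Q n")
    case True
    hence "{x. Q n \<longrightarrow> \<not> regen x n} = space \<mu> - {x. regen x n}" by auto
    thus ?thesis using regen_event by (metis sets.compl_sets)
  qed (use sets.top[of \<mu>] in simp)
  ultimately show ?thesis by simp
qed

text \<open>A zero-one argument: approximate the event \<open>A\<close> of no regeneration after \<open>k\<close> by a
  window event \<open>P\<close>, and test a time \<open>n\<close> after the window. The regeneration at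
  \<open>n\<close> has conditional probability at least \<open>\<delta>\<close> given \<open>P\<close>, but excludes
  \<open>A\<close>.\<close>

lemma Pr_no_regen_above: "Pr (\<lambda>x. \<forall>n. k \<le> n \<longrightarrow> \<not> regen x n) = 0"
proof (rule ccontr)
  define A where "A = {x. \<forall>n. k \<le> n \<longrightarrow> \<not> regen x n}"
  define \<delta> where "\<delta> = (\<epsilon> ^ l) ^ (N + 1) * Pr (\<lambda>x. regen x 0)"
  assume "Pr (\<lambda>x. \<forall>n. k \<le> n \<longrightarrow> \<not> regen x n) \<noteq> 0"
  hence pos: "measure \<mu> A > 0" unfolding A_def by (simp add: zero_less_measure_iff)
  have A: "A \<in> events" unfolding A_def by (rule event_regen_all)
  have "(\<epsilon> ^ l) ^ (N + 1) \<le> 1" using eps by (intro power_le_one) auto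
  hence \<delta>1: "\<delta> \<le> 1" unfolding \<delta>_def by (intro mult_le_one) auto
  have \<delta>0: "\<delta> > 0" unfolding \<delta>_def using eps Pr_regen_pos by simp
  \<comment> \<open>an error \<open>e\<close> for which \<open>e / \<delta> + e \<le> measure \<mu> A\<close>, since \<open>\<delta> \<le> 1\<close>\<close>
  define e where "e = measure \<mu> A * \<delta> / 2"
  have "e > 0" unfolding e_def using pos \<delta>0 by simp
  from approx_by_window[OF A this] obtain P a b where P: "window a b P"
    and d: "measure \<mu> ((A - {x. P x}) \<union> ({x. P x} - A)) < e" by blast
  have PE: "{x. P x} \<in> events" by (rule window_event[OF P])
  define n where "n = max b k"
  have "\<delta> * Pr P \<le> Pr (\<lambda>x. P x \<and> regen x n)"
    unfolding \<delta>_def by (rule regen_ge[OF window_mono[OF P]]) (auto simp: n_def)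
  also have "\<dots> \<le> measure \<mu> ((A - {x. P x}) \<union> ({x. P x} - A))"
    by (rule finite_measure_mono) (use A PE in \<open>auto simp: A_def n_def\<close>)
  finally have 1: "\<delta> * Pr P < e" using d by linarith
  have "measure \<mu> A \<le> measure \<mu> ({x. P x} \<union> ((A - {x. P x}) \<union> ({x. P x} - A)))"
    by (rule finite_measure_mono) (use A PE in auto)
  also have "\<dots> \<le> Pr P + measure \<mu> ((A - {x. P x}) \<union> ({x. P x} - A))"
    by (rule measure_Un_le) (use A PE in auto)
  finally have "measure \<mu> A < Pr P + e" using d by linarith
  hence "\<delta> * measure \<mu> A < \<delta> * (Pr P + e)" using \<delta>0 by simp
  also have "\<dots> < e + \<delta> * e" using 1 by (simp add: algebra_simps)
  also have "\<delta> * e \<le> e" using \<delta>1 \<open>e > 0\<close> by simp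
  finally show False unfolding e_def by (simp add: algebra_simps)
qed

text \<open>By stationarity the probability does not depend on \<open>k\<close>; as \<open>k\<close> grows the events
  decrease to the event of no regeneration at all.\<close>

lemma Pr_no_regen_below: "Pr (\<lambda>x. \<forall>n. n \<le> k \<longrightarrow> \<not> regen x n) = 0"
proof -
  have sh: "Pr (\<lambda>x. \<forall>n. n \<le> c \<longrightarrow> \<not> regen x n) = Pr (\<lambda>x. \<forall>n. n \<le> 0 \<longrightarrow> \<not> regen x n)" for c
  proof -
    have "Pr (\<lambda>x. \<forall>n. n \<le> 0 \<longrightarrow> \<not> regen (\<lambda>i. x (i + c)) n) = Pr (\<lambda>x. \<forall>n. n \<le> 0 \<longrightarrow> \<not> regen x n)"
      by (rule Pr_shift[OF event_regen_all])
    moreover have "(\<forall>n. n \<le> 0 \<longrightarrow> \<not> regen (\<lambda>i. x (i + c)) n) \<longleftrightarrow> (\<forall>n. n \<le> c \<longrightarrow> \<not> regen x n)" for x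
      unfolding regen_shift
    proof (intro iffI allI impI)
      fix n assume *: "\<forall>n\<le>0. \<not> regen x (n + c)" and n: "n \<le> c"
      show "\<not> regen x n" using *[rule_format, of "n - c"] n by simp
    qed simp
    ultimately show ?thesis by simp
  qed
  define E where "E i = {x. \<forall>n. n \<le> int i \<longrightarrow> \<not> regen x n}" for i :: nat
  have E: "E i \<in> events" for i unfolding E_def by (rule event_regen_all)
  have "decseq E" unfolding E_def by (rule decseq_SucI) auto
  from finite_Lim_measure_decseq[OF _ this] E
  have "(\<lambda>i. measure \<mu> (E i)) \<longlonglongrightarrow> measure \<mu> (\<Inter>i. E i)" by blast
  moreover have "measure \<mu> (E i) = Pr (\<lambda>x. \<forall>n. n \<le> k \<longrightarrow> \<not> regen x n)" for i
    unfolding E_def sh[of "int i"] sh[of k] ..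
  ultimately have "Pr (\<lambda>x. \<forall>n. n \<le> k \<longrightarrow> \<not> regen x n) = measure \<mu> (\<Inter>i. E i)"
    by (simp only: LIMSEQ_const_iff)
  also have "\<dots> \<le> Pr (\<lambda>x. \<forall>n. 0 \<le> n \<longrightarrow> \<not> regen x n)"
  proof (rule finite_measure_mono[OF _ event_regen_all])
    show "(\<Inter>i. E i) \<subseteq> {x. \<forall>n. 0 \<le> n \<longrightarrow> \<not> regen x n}"
    proof safe
      fix x n assume "x \<in> (\<Inter>i. E i)" and n: "0 \<le> (n :: int)" "regen x n"
      hence "x \<in> E (nat n)" by blast
      thus False using n unfolding E_def by simp
    qed
  qed
  finally show ?thesis using Pr_no_regen_above[of 0] by (simp add: measure_le_0_iff)
qed

lemma AE_regen_unbounded: "AE x in \<mu>. (\<forall>k. \<exists>n\<ge>k. regen x n) \<and> (\<forall>k. \<exists>n\<le>k. regen x n)"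
proof -
  have "AE x in \<mu>. \<not> (\<forall>n. k \<le> n \<longrightarrow> \<not> regen x n)" for k
    by (rule AE_I'[of "{x. \<forall>n. k \<le> n \<longrightarrow> \<not> regen x n}"])
       (auto intro!: null_setsI simp: emeasure_eq_measure Pr_no_regen_above event_regen_all)
  moreover have "AE x in \<mu>. \<not> (\<forall>n. n \<le> k \<longrightarrow> \<not> regen x n)" for k
    by (rule AE_I'[of "{x. \<forall>n. n \<le> k \<longrightarrow> \<not> regen x n}"])
       (auto intro!: null_setsI simp: emeasure_eq_measure Pr_no_regen_below event_regen_all)
  ultimately have "AE x in \<mu>. (\<forall>k. \<not> (\<forall>n. k \<le> n \<longrightarrow> \<not> regen x n)) \<and> (\<forall>k. \<not> (\<forall>n. n \<le> k \<longrightarrow> \<not> regen x n))"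
    by (simp only: AE_all_countable AE_conj_iff) blast
  thus ?thesis by (rule AE_mp) (rule AE_I2, blast)
qed

section \<open>Cutting at a regeneration time\<close>

lemma regen_run: "regen x k \<Longrightarrow> run x k"
  unfolding regen_def regen_upto_def by blast

lemma consec_regen_upto:
  assumes "regen x e" "k' \<le> e"
  shows "consec (regen x) k k' \<longleftrightarrow> consec (regen_upto (e + int L) x) k k'"
  unfolding consec_def using regen_iff_upto[OF assms(1)] assms(2) by auto

lemma window_consec_upto:
  assumes "a \<le> k" "k' \<le> e"
  shows "window a (e + int L) (\<lambda>x. consec (regen_upto (e + int L) x) k k')"
proof (cases "k < k'")
  case True
  thus ?thesis unfolding consec_def using assms
    by (intro window_conj window_all window_imp window_not window_regen_upto' window_True) auto
qed (simp add: consec_def window_True)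

lemma window_wd_in: "window a b (\<lambda>x. wd x a b \<in> A)"
  by (rule windowI) (metis wd_eq_iff)

text \<open>Once \<open>u b\<close> is a regeneration time, the rest of the pattern is decided by the window that
  ends with the run at \<open>u b\<close>. What is left is the condition that \<open>u b\<close>, and with it
  \<open>u a\<close>, stays a candidate for ever.\<close>

lemma closed_pattern:
  assumes inc: "\<And>i. a \<le> i \<Longrightarrow> i < b \<Longrightarrow> u i < u (i + 1)" and ab: "a \<le> b"
  shows "closed_regen_event (u a) (\<lambda>x. pattern (regen x) x u A a b)"
proof -
  have mono: "u i \<le> u j" if "a \<le> i" "i \<le> j" "j \<le> b" for i j
    using increasing_range[of a b u i j] inc that by blast
  define E where "E = u b + int L"
  define conds where "conds x \<longleftrightarrow> (\<forall>i. a \<le> i \<longrightarrow> i < b \<longrightarrow>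
    consec (regen_upto E x) (u i) (u (i + 1)) \<and> wd x (u i) (u (i + 1)) \<in> A i)" for x
  define D where "D i x \<longleftrightarrow> (let e = u a + int L + int i in regen_upto e x (u a) \<and>
    (E \<le> e \<longrightarrow> regen_upto e x (u b) \<and> conds x))" for i :: nat and x
  have le: "u a \<le> u b" using mono ab by simp
  have Wc: "window (u a) e conds" if "E \<le> e" for e
    unfolding conds_def
  proof (intro window_all window_imp window_conj)
    fix i assume i: "a \<le> i" "i < b"
    have "window (u a) E (\<lambda>x. consec (regen_upto E x) (u i) (u (i + 1)))"
      unfolding E_def by (rule window_consec_upto) (use mono i in auto)
    thus "window (u a) e (\<lambda>x. consec (regen_upto E x) (u i) (u (i + 1)))"
      by (rule window_mono) (use that in auto)
    have "u (i + 1) \<le> u b" using mono i by simp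
    hence "u (i + 1) \<le> E" unfolding E_def by (metis add_increasing2 of_nat_0_le_iff)
    thus "window (u a) e (\<lambda>x. wd x (u i) (u (i + 1)) \<in> A i)"
      by (intro window_mono[OF window_wd_in]) (use mono i that in auto)
  qed
  show ?thesis unfolding closed_regen_event_def
  proof (intro exI[of _ D] conjI allI impI)
    fix i
    show "window (u a) (u a + int L + int i) (D i)"
      unfolding D_def Let_def
      by (intro window_conj window_imp window_regen_upto' Wc) (use le in \<open>auto simp: E_def\<close>)
    fix x
    show "D i x \<Longrightarrow> regen_upto (u a + int L + int i) x (u a)" unfolding D_def Let_def by blast
    show "D (Suc i) x \<Longrightarrow> D i x" unfolding D_def Let_def
      by (auto elim!: regen_upto_antimono)
  next
    fix x
    have eq: "conds x \<longleftrightarrow> (\<forall>i. a \<le> i \<longrightarrow> i < b \<longrightarrow>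
      consec (regen x) (u i) (u (i + 1)) \<and> wd x (u i) (u (i + 1)) \<in> A i)" if "regen x (u b)"
    proof -
      have "consec (regen x) (u i) (u (i + 1)) \<longleftrightarrow> consec (regen_upto E x) (u i) (u (i + 1))"
        if "a \<le> i" "i < b" for i
        unfolding E_def using consec_regen_upto[OF \<open>regen x (u b)\<close>, of "u (i + 1)"] mono that by simp
      thus ?thesis unfolding conds_def by blast
    qed
    show "pattern (regen x) x u A a b \<longleftrightarrow> (\<forall>i. D i x)"
    proof
      assume p: "pattern (regen x) x u A a b"
      have "regen x (u b)" using p unfolding pattern_def by blast
      moreover have "conds x" using p eq unfolding pattern_def by blast
      moreover have "regen x (u a)" using pattern_start[OF ab p] .
      ultimately show "\<forall>i. D i x" unfolding D_def Let_def regen_def by blast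
    next
      assume D: "\<forall>i. D i x"
      have up: "regen_upto e x (u b) \<and> conds x" for e
      proof -
        define i where "i = nat (max e E - u a - int L)"
        have "max e E \<le> u a + int L + int i" unfolding i_def by linarith
        hence "e \<le> u a + int L + int i" "E \<le> u a + int L + int i" by auto
        thus ?thesis using D[rule_format, of i] unfolding D_def Let_def
          by (blast intro: regen_upto_antimono)
      qed
      hence "regen x (u b)" unfolding regen_def by blast
      thus "pattern (regen x) x u A a b" unfolding pattern_def using eq up by blast
    qed
  qed
qed

lemma cancel_common_factor:
  fixes X W :: real
  assumes "X * W = b * C" "Y * W = b * r" "W \<noteq> 0"
  shows "X * r = Y * C"
proof -
  have "(X * r) * W = (Y * C) * W" using assms(1,2) by algebra
  thus ?thesis using assms(3) by simp
qed

text \<open>Let \<open>k'\<close> be the second point of the pattern. The first cycle is an event \<open>B\<close> of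
  the past up to the end of the run at \<open>k'\<close>, the remaining cycles are a future \<open>C\<close> that
  regenerates at \<open>k'\<close>. The regeneration property is used twice, for \<open>C\<close> and for the bare
  regeneration at \<open>k'\<close>, and the probability of the run cancels.\<close>

lemma pattern_renewal:
  assumes ab: "a < b"
  shows "Pr (\<lambda>x. pattern (regen x) x u A a b) * Pr (\<lambda>x. regen x 0)
    = Pr (\<lambda>x. consec (regen x) 0 (u (a + 1) - u a) \<and> wd x 0 (u (a + 1) - u a) \<in> A a) *
      Pr (\<lambda>x. pattern (regen x) x u A (a + 1) b)"
proof (cases "\<forall>i. a < i \<longrightarrow> i < b \<longrightarrow> u i < u (i + 1)")
  case False
  then obtain i where "a < i" "i < b" "\<not> u i < u (i + 1)" by blast
  hence "\<not> pattern (regen x) x u A a b" "\<not> pattern (regen x) x u A (a + 1) b" for x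
    unfolding pattern_def consec_def by (auto intro!: exI[of _ i])
  thus ?thesis by simp
next
  case inc: True
  define k where "k = u a"
  define k' where "k' = u (a + 1)"
  define C where "C x \<longleftrightarrow> pattern (regen x) x u A (a + 1) b" for x
  have clC: "closed_regen_event k' C"
    unfolding k'_def C_def by (rule closed_pattern) (use inc ab in auto)
  have Ck: "C x \<Longrightarrow> regen x k'" for x
    unfolding C_def k'_def by (rule pattern_start[of "a + 1" b]) (use ab in auto)
  define S where "S x \<longleftrightarrow> consec (regen x) k k' \<and> wd x k k' \<in> A a" for x
  define B where "B x \<longleftrightarrow> run x k' \<and> consec (regen_upto (k' + int L) x) k k' \<and> wd x k k' \<in> A a" for x
  have WB: "window (min k k') (k' + int L) B"
    unfolding B_def
    by (intro window_conj window_mono[OF window_run] window_consec_upto window_mono[OF window_wd_in]) auto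
  have B: "B x \<longleftrightarrow> S x" if "regen x k'" for x
    unfolding B_def S_def using consec_regen_upto[OF that order_refl] regen_run[OF that] by blast
  have run: "B x \<Longrightarrow> run x k'" for x unfolding B_def by blast
  have 1: "Pr (\<lambda>x. B x \<and> C x) * Pr (\<lambda>x. run x 0) = Pr B * Pr C"
    by (rule regeneration[OF WB run clC])
  have 2: "Pr (\<lambda>x. B x \<and> regen x k') * Pr (\<lambda>x. run x 0) = Pr B * Pr (\<lambda>x. regen x 0)"
    using regeneration[OF WB run closed_regen] by (simp add: Pr_regen[of k'])
  have "pattern (regen x) x u A a b \<longleftrightarrow> S x \<and> C x" for x
    unfolding pattern_step[OF ab] C_def S_def k_def k'_def ..
  hence "(\<lambda>x. B x \<and> C x) = (\<lambda>x. pattern (regen x) x u A a b)"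
    using B Ck by (intro ext) blast
  moreover have "S x \<Longrightarrow> regen x k'" for x unfolding S_def consec_def by blast
  hence "(\<lambda>x. B x \<and> regen x k') = S"
    using B by (intro ext) blast
  moreover have "Pr S = Pr (\<lambda>x. consec (regen x) 0 (k' - k) \<and> wd x 0 (k' - k) \<in> A a)"
  proof -
    let ?Q = "\<lambda>x. consec (regen x) 0 (k' - k) \<and> wd x 0 (k' - k) \<in> A a"
    have "consec (regen (\<lambda>n. x (n + k))) 0 (k' - k) \<longleftrightarrow> consec (regen x) k k'" for x
    proof -
      have "(\<forall>j. 0 < j \<longrightarrow> j < k' - k \<longrightarrow> \<not> regen x (j + k)) \<longleftrightarrow> (\<forall>j. k < j \<longrightarrow> j < k' \<longrightarrow> \<not> regen x j)"
        by (metis add.commute add_less_cancel_left add.right_neutral diff_add_cancel)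
      thus ?thesis unfolding consec_def regen_shift by simp
    qed
    moreover have "wd (\<lambda>n. x (n + k)) 0 (k' - k) = wd x k k'" for x :: "int \<Rightarrow> 'a"
      unfolding wd_def by (rule nth_equalityI) (auto simp: ac_simps)
    ultimately have "Pr (\<lambda>x. ?Q (\<lambda>n. x (n + k))) = Pr S" unfolding S_def by simp
    moreover have "{x. ?Q x} \<in> events"
    proof -
      have e1: "{x. wd x 0 (k' - k) \<in> A a} \<in> events" by (rule window_event[OF window_wd_in])
      have e2: "{x. consec (regen x) 0 (k' - k)} \<in> events"
      proof -
        have m: "Measurable.pred \<mu> (\<lambda>x. regen x j)" for j using regen_event by (simp add: pred_def)
        note [measurable] = m
        have "Measurable.pred \<mu> (\<lambda>x. consec (regen x) 0 (k' - k))" unfolding consec_def by measurable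
        thus ?thesis by (simp add: pred_def)
      qed
      show ?thesis unfolding Collect_conj_eq by (rule sets.Int[OF e2 e1])
    qed
    hence "Pr (\<lambda>x. ?Q (\<lambda>n. x (n + k))) = Pr ?Q" by (rule Pr_shift)
    ultimately show ?thesis by simp
  qed
  ultimately have 3: "Pr (\<lambda>x. pattern (regen x) x u A a b) * Pr (\<lambda>x. run x 0) = Pr B * Pr C"
    "Pr (\<lambda>x. consec (regen x) 0 (k' - k) \<and> wd x 0 (k' - k) \<in> A a) * Pr (\<lambda>x. run x 0) = Pr B * Pr (\<lambda>x. regen x 0)"
    using 1 2 by simp_all
  have "Pr (\<lambda>x. run x 0) \<noteq> 0" using Pr_run_pos by linarith
  from cancel_common_factor[OF 3 this] show ?thesis
    unfolding C_def[abs_def] k_def k'_def .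
qed

section \<open>The chain as a regenerative process\<close>

lemma regenerative_regen: "regenerative_process \<mu> regen"
proof (unfold_locales)
  show "\<exists>D. (\<forall>i::nat. window k (k + int i) (D i)) \<and> (\<forall>x. regen x k \<longleftrightarrow> (\<forall>i. D i x))" for k
  proof (intro exI[of _ "\<lambda>i x. L \<le> i \<longrightarrow> regen_upto (k + int i) x k"] conjI allI)
    show "window k (k + int i) (\<lambda>x. L \<le> i \<longrightarrow> regen_upto (k + int i) x k)" for i
      by (intro window_imp window_regen_upto') (auto simp del: of_nat_mult of_nat_add)
    show "regen x k \<longleftrightarrow> (\<forall>i. L \<le> i \<longrightarrow> regen_upto (k + int i) x k)" for x
    proof
      assume *: "\<forall>i. L \<le> i \<longrightarrow> regen_upto (k + int i) x k"
      show "regen x k" unfolding regen_def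
      proof
        fix e show "regen_upto e x k"
          by (rule regen_upto_antimono[OF *[rule_format, of "max L (nat (e - k))"]]) linarith+
      qed
    qed (simp add: regen_def)
  qed
qed (rule regen_shift AE_regen_unbounded pattern_renewal; assumption?)+

end

theorem theorem5p2:
  fixes \<tau> :: "('a :: countable) strg set"
    and p :: "'a strg \<Rightarrow> 'a pmf"
    and \<epsilon> :: real
    and w :: "'a list"
    and lw :: "nat \<Rightarrow> nat"
    and \<mu> :: "(int \<Rightarrow> 'a) measure"
  assumes "context_tree \<tau>"
    and "unbounded_tree \<tau>"
    and "0 < \<epsilon>" and "\<epsilon> < 1"
    and "reference_string \<tau> w lw"
    and "regular_string \<tau> p \<epsilon> w"
    and "limsup (\<lambda>k. elog (lw k) / ereal (C_const \<epsilon> w * real k)) < 1"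
    and "chain_law \<mu>"
    and "stationary \<mu>"
    and "compatible \<mu> \<tau> p"
  shows "\<exists>(\<Omega> :: (int \<Rightarrow> 'a) set) (T :: (int \<Rightarrow> 'a) \<Rightarrow> int \<Rightarrow> int).
           \<Omega> \<in> sets \<mu> \<and> (AE x in \<mu>. x \<in> \<Omega>) \<and>
           T \<in> \<mu> \<rightarrow>\<^sub>M PiM UNIV (\<lambda>_. count_space UNIV) \<and>
           (\<forall>x\<in>\<Omega>. (\<forall>i. T x i < T x (i + 1)) \<and> T x 0 \<le> 0 \<and> 0 < T x 1) \<and>
           (\<forall>k. {x \<in> \<Omega>. \<exists>i. T x i = k} \<in> sets (coord_algebra \<Omega> {k..})) \<and>
           (\<forall>i\<le>0. \<forall>k. {x \<in> \<Omega>. T x i = k} \<in> sets (coord_algebra \<Omega> {k..})) \<and>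
           (\<forall>i\<ge>1. \<forall>k. {x \<in> \<Omega>. T x i = k} \<in> sets (coord_algebra \<Omega> {1..})) \<and>
           iid_off_zero \<mu> (\<lambda>i x. block (T x) x i) \<and>
           cond_iid_off_zero \<mu> T \<and>
           (\<forall>i. i \<noteq> 0 \<longrightarrow> integrable \<mu> (\<lambda>x. real (length (block (T x) x i))))"
proof -
  interpret reference_chain \<mu> \<tau> p \<epsilon> w lw
    by unfold_locales (fact assms)+
  interpret regenerative_process \<mu> regen by (rule regenerative_regen)
  show ?thesis
  proof (intro exI[of _ \<Omega>] exI[of _ T] conjI allI impI ballI)
    fix i :: int assume "i \<noteq> 0"
    thus "integrable \<mu> (\<lambda>x. real (length (block (T x) x i)))" by (rule integrable_length_block)
  qed (simp_all add: Omega_event AE_Omega measurable_T T_increasing T_0 T_1 T_range_coord T_coord_nonpos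
      T_coord_pos iid_blocks cond_iid_blocks)
qed

end
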